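(* Let $(M_1,g_1)$ and $(M_2,g_2)$ be pseudo-Riemannian manifolds, let $f\colon M_1\to(0,\infty)$ be smooth, and let $M=M_1\times_f M_2$ be the warped product manifold with metric tensor $g=g_1\oplus f^2g_2$. Suppose $M$ is concircularly symmetric. Then: (1) both $M_1$ and $M_2$ are locally symmetric; (2) $M_2$ is of constant curvature, given that $f$ is not constant; and (3) $\mathcal F=\frac1f H^f$ is parallel.
   Context: The warped product metric is $g=\pi_1^*(g_1)+(f\circ\pi_1)^2\pi_2^*(g_2)$ on $M_1\times M_2$, with $\pi_i$ the natural projections. With $\mathcal R(X,Y)Z=\nabla_Y\nabla_XZ-\nabla_X\nabla_YZ+\nabla_{[X,Y]}Z$, the concircular curvature tensor of an $n$-dimensional pseudo-Riemannian manifold ($n\ge 3$) with metric $g$ and scalar curvature $\tau$ is $\mathcal C(X,Y)Z=\mathcal R(X,Y)Z-\frac{\tau}{n(n-1)}[g(X,Z)Y-g(Y,Z)X]$. A manifold is concircularly symmetric if $\nabla\mathcal C=0$, and locally symmetric if $\nabla\mathcal R=0$. $H^f(Y_1,Z_1)=g_1(\nabla^1_{Y_1}\mathrm{grad} f,Z_1)$ is the Hessian of $f$ on $(M_1,g_1)$, with $\nabla^1$ the Levi-Civita connection and $\mathrm{grad}$ the gradient of $g_1$; $\mathcal F$ is a tensor on $M_1$ and parallel means $\nabla^1\mathcal F=0$.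
   Formalization: Part (2) is stated for connected M_1 (on a disconnected M_1 a nonconstant but locally constant f makes it false), and both M_1 and M_2 have dimension at least 1 (for M_2 a point, (3) fails). *)

theory Defs
  imports "HOL-Analysis.Analysis" "HOL-Library.Function_Algebras"
begin

section \<open>Smooth manifolds\<close>

primrec Ck_on :: "nat \<Rightarrow> 'e::euclidean_space set \<Rightarrow> ('e \<Rightarrow> 'f::real_normed_vector) \<Rightarrow> bool" where
  "Ck_on 0 S f \<longleftrightarrow> continuous_on S f"
| "Ck_on (Suc k) S f \<longleftrightarrow> (\<forall>x\<in>S. f differentiable (at x)) \<and>
     (\<forall>v. Ck_on k S (\<lambda>x. frechet_derivative f (at x) v))"

text \<open>Used for open \<open>S\<close> only, where the derivatives at points of \<open>S\<close> are determined by \<open>f\<close> on \<open>S\<close>.\<close>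

definition smooth_on :: "'e::euclidean_space set \<Rightarrow> ('e \<Rightarrow> 'f::real_normed_vector) \<Rightarrow> bool" where
  "smooth_on S f \<longleftrightarrow> (\<forall>k. Ck_on k S f)"

text \<open>A chart \<open>(V, \<phi>)\<close> consists of its domain and its coordinate map; the values of \<open>\<phi>\<close> outside
  \<open>V\<close> are irrelevant. The dimension of the manifold is \<open>DIM('e)\<close>, hence at least \<open>1\<close>.\<close>

type_synonym ('a, 'e) chart = "'a set \<times> ('a \<Rightarrow> 'e)"

record ('a, 'e) manifold =
  mtop :: "'a topology"
  charts :: "('a, 'e) chart set"

abbreviation points :: "('a, 'e) manifold \<Rightarrow> 'a set" where
  "points M \<equiv> topspace (mtop M)"

definition second_countable_space :: "'a topology \<Rightarrow> bool" where
  "second_countable_space X \<longleftrightarrow> (\<exists>\<B>. countable \<B> \<and> (\<forall>B\<in>\<B>. openin X B) \<and>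
     (\<forall>U x. openin X U \<and> x \<in> U \<longrightarrow> (\<exists>B\<in>\<B>. x \<in> B \<and> B \<subseteq> U)))"

definition smooth_manifold :: "('a, 'e::euclidean_space) manifold \<Rightarrow> bool" where
  "smooth_manifold M \<longleftrightarrow>
     points M \<noteq> {} \<and> Hausdorff_space (mtop M) \<and> second_countable_space (mtop M) \<and>
     (\<forall>(V, \<phi>) \<in> charts M. openin (mtop M) V \<and> open (\<phi> ` V) \<and>
        homeomorphic_map (subtopology (mtop M) V) (top_of_set (\<phi> ` V)) \<phi>) \<and>
     (\<Union>(V, \<phi>) \<in> charts M. V) = points M \<and>
     (\<forall>(V, \<phi>) \<in> charts M. \<forall>(W, \<psi>) \<in> charts M. smooth_on (\<phi> ` (V \<inter> W)) (\<psi> \<circ> inv_into V \<phi>))"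

definition prod_manifold ::
  "('a, 'e::euclidean_space) manifold \<Rightarrow> ('b, 'f::euclidean_space) manifold \<Rightarrow> ('a \<times> 'b, 'e \<times> 'f) manifold" where
  "prod_manifold M N = \<lparr>mtop = prod_topology (mtop M) (mtop N),
     charts = {(V \<times> W, map_prod \<phi> \<psi>) | V \<phi> W \<psi>. (V, \<phi>) \<in> charts M \<and> (W, \<psi>) \<in> charts N}\<rparr>"

definition smooth_fun :: "('a, 'e::euclidean_space) manifold \<Rightarrow> 'a set \<Rightarrow> ('a \<Rightarrow> real) \<Rightarrow> bool" where
  "smooth_fun M U h \<longleftrightarrow> openin (mtop M) U \<and>
     (\<forall>(V, \<phi>) \<in> charts M. smooth_on (\<phi> ` (U \<inter> V)) (h \<circ> inv_into V \<phi>))"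

definition smooth_at :: "('a, 'e::euclidean_space) manifold \<Rightarrow> 'a \<Rightarrow> ('a \<Rightarrow> real) \<Rightarrow> bool" where
  "smooth_at M p h \<longleftrightarrow> (\<exists>U. p \<in> U \<and> smooth_fun M U h)"


section \<open>Tangent vectors and vector fields\<close>

text \<open>A tangent vector at \<open>p\<close> is a derivation on the functions that are smooth near \<open>p\<close>, extended
  by \<open>0\<close> to all other functions. By the Leibniz rule its value at \<open>h\<close> depends only on the germ of
  \<open>h\<close> at \<open>p\<close>. Addition and \<open>0\<close> of tangent vectors and vector fields are pointwise.\<close>

type_synonym 'a tvec = "('a \<Rightarrow> real) \<Rightarrow> real"
type_synonym 'a vfield = "'a \<Rightarrow> 'a tvec"

definition tscale :: "real \<Rightarrow> 'a tvec \<Rightarrow> 'a tvec" (infixr "*\<^sub>t" 75) where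
  "c *\<^sub>t v = (\<lambda>h. c * v h)"

definition vscale :: "('a \<Rightarrow> real) \<Rightarrow> 'a vfield \<Rightarrow> 'a vfield" (infixr "*\<^sub>v" 75) where
  "h *\<^sub>v X = (\<lambda>p. h p *\<^sub>t X p)"

definition tangent_space :: "('a, 'e::euclidean_space) manifold \<Rightarrow> 'a \<Rightarrow> 'a tvec set" where
  "tangent_space M p = {v.
     (\<forall>h. \<not> smooth_at M p h \<longrightarrow> v h = 0) \<and>
     (\<forall>h k. smooth_at M p h \<and> smooth_at M p k \<longrightarrow> v (\<lambda>q. h q + k q) = v h + v k) \<and>
     (\<forall>c h. smooth_at M p h \<longrightarrow> v (\<lambda>q. c * h q) = c * v h) \<and>
     (\<forall>h k. smooth_at M p h \<and> smooth_at M p k \<longrightarrow> v (\<lambda>q. h q * k q) = v h * k p + h p * v k)}"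

definition pushforward ::
  "('b, 'f::euclidean_space) manifold \<Rightarrow> ('a \<Rightarrow> 'b) \<Rightarrow> 'a \<Rightarrow> 'a tvec \<Rightarrow> 'b tvec" where
  "pushforward N F p v = (\<lambda>h. if smooth_at N (F p) h then v (h \<circ> F) else 0)"

definition vector_field :: "('a, 'e::euclidean_space) manifold \<Rightarrow> 'a set \<Rightarrow> 'a vfield \<Rightarrow> bool" where
  "vector_field M U X \<longleftrightarrow> openin (mtop M) U \<and> (\<forall>p\<in>U. X p \<in> tangent_space M p) \<and>
     (\<forall>W h. W \<subseteq> U \<and> smooth_fun M W h \<longrightarrow> smooth_fun M W (\<lambda>p. X p h))"

definition lie_bracket :: "('a, 'e::euclidean_space) manifold \<Rightarrow> 'a vfield \<Rightarrow> 'a vfield \<Rightarrow> 'a vfield" where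
  "lie_bracket M X Y = (\<lambda>p h. if smooth_at M p h then X p (\<lambda>q. Y q h) - Y p (\<lambda>q. X q h) else 0)"

text \<open>The coordinate field \<open>\<partial>/\<partial>x\<^sup>b\<close> and the coordinate function \<open>x\<^sup>b\<close> of a chart.\<close>

definition coord_field :: "('a, 'e::euclidean_space) manifold \<Rightarrow> ('a, 'e) chart \<Rightarrow> 'e \<Rightarrow> 'a vfield" where
  "coord_field M c b = (\<lambda>p h. if smooth_at M p h
     then frechet_derivative (h \<circ> inv_into (fst c) (snd c)) (at (snd c p)) b else 0)"

definition coord_fun :: "('a, 'e::euclidean_space) chart \<Rightarrow> 'e \<Rightarrow> 'a \<Rightarrow> real" where
  "coord_fun c b = (\<lambda>p. snd c p \<bullet> b)"


section \<open>Pseudo-Riemannian metrics and the Levi-Civita connection\<close>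

type_synonym 'a metric_tensor = "'a \<Rightarrow> 'a tvec \<Rightarrow> 'a tvec \<Rightarrow> real"

definition pseudo_riemannian_metric ::
  "('a, 'e::euclidean_space) manifold \<Rightarrow> 'a metric_tensor \<Rightarrow> bool" where
  "pseudo_riemannian_metric M g \<longleftrightarrow>
     (\<forall>p \<in> points M.
        (\<forall>u\<in>tangent_space M p. \<forall>v\<in>tangent_space M p. g p u v = g p v u) \<and>
        (\<forall>u\<in>tangent_space M p. \<forall>v\<in>tangent_space M p. \<forall>w\<in>tangent_space M p.
           g p (u + v) w = g p u w + g p v w) \<and>
        (\<forall>c. \<forall>u\<in>tangent_space M p. \<forall>v\<in>tangent_space M p. g p (c *\<^sub>t u) v = c * g p u v) \<and>
        (\<forall>u\<in>tangent_space M p. (\<forall>v\<in>tangent_space M p. g p u v = 0) \<longrightarrow> u = 0)) \<and>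
     (\<forall>U X Y. vector_field M U X \<and> vector_field M U Y \<longrightarrow> smooth_fun M U (\<lambda>p. g p (X p) (Y p)))"

definition pseudo_riemannian_manifold ::
  "('a, 'e::euclidean_space) manifold \<Rightarrow> 'a metric_tensor \<Rightarrow> bool" where
  "pseudo_riemannian_manifold M g \<longleftrightarrow> smooth_manifold M \<and> pseudo_riemannian_metric M g"

text \<open>Connections act on vector fields defined on arbitrary open subsets of the manifold.\<close>

type_synonym 'a connection = "'a vfield \<Rightarrow> 'a vfield \<Rightarrow> 'a vfield"

definition affine_connection :: "('a, 'e::euclidean_space) manifold \<Rightarrow> 'a connection \<Rightarrow> bool" where
  "affine_connection M D \<longleftrightarrow>
     (\<forall>U X Y. vector_field M U X \<and> vector_field M U Y \<longrightarrow> vector_field M U (D X Y)) \<and>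
     (\<forall>U X X' Y. vector_field M U X \<and> vector_field M U X' \<and> vector_field M U Y \<longrightarrow>
        (\<forall>p\<in>U. D (X + X') Y p = D X Y p + D X' Y p)) \<and>
     (\<forall>U h X Y. smooth_fun M U h \<and> vector_field M U X \<and> vector_field M U Y \<longrightarrow>
        (\<forall>p\<in>U. D (h *\<^sub>v X) Y p = h p *\<^sub>t D X Y p)) \<and>
     (\<forall>U X Y Y'. vector_field M U X \<and> vector_field M U Y \<and> vector_field M U Y' \<longrightarrow>
        (\<forall>p\<in>U. D X (Y + Y') p = D X Y p + D X Y' p)) \<and>
     (\<forall>U h X Y. smooth_fun M U h \<and> vector_field M U X \<and> vector_field M U Y \<longrightarrow>
        (\<forall>p\<in>U. D X (h *\<^sub>v Y) p = X p h *\<^sub>t Y p + h p *\<^sub>t D X Y p))"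

definition is_levi_civita ::
  "('a, 'e::euclidean_space) manifold \<Rightarrow> 'a metric_tensor \<Rightarrow> 'a connection \<Rightarrow> bool" where
  "is_levi_civita M g D \<longleftrightarrow> affine_connection M D \<and>
     (\<forall>U X Y. vector_field M U X \<and> vector_field M U Y \<longrightarrow>
        (\<forall>p\<in>U. D X Y p - D Y X p = lie_bracket M X Y p)) \<and>
     (\<forall>U X Y Z. vector_field M U X \<and> vector_field M U Y \<and> vector_field M U Z \<longrightarrow>
        (\<forall>p\<in>U. X p (\<lambda>q. g q (Y q) (Z q)) = g p (D X Y p) (Z p) + g p (Y p) (D X Z p)))"

text \<open>By the Koszul formula, \<open>levi_civita M g X Y p\<close> is uniquely determined for vector fields \<open>X\<close>,
  \<open>Y\<close> on an open set containing \<open>p\<close>; the choice only concerns irrelevant arguments.\<close>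

definition levi_civita ::
  "('a, 'e::euclidean_space) manifold \<Rightarrow> 'a metric_tensor \<Rightarrow> 'a connection" where
  "levi_civita M g = (SOME D. is_levi_civita M g D)"

definition grad :: "('a, 'e::euclidean_space) manifold \<Rightarrow> 'a metric_tensor \<Rightarrow> ('a \<Rightarrow> real) \<Rightarrow> 'a vfield" where
  "grad M g f = (\<lambda>p. THE v. v \<in> tangent_space M p \<and> (\<forall>w \<in> tangent_space M p. g p v w = w f))"

definition hessian ::
  "('a, 'e::euclidean_space) manifold \<Rightarrow> 'a metric_tensor \<Rightarrow> ('a \<Rightarrow> real) \<Rightarrow> 'a vfield \<Rightarrow> 'a vfield \<Rightarrow> 'a \<Rightarrow> real" where
  "hessian M g f Y Z = (\<lambda>p. g p (levi_civita M g Y (grad M g f) p) (Z p))"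


section \<open>Curvature\<close>

definition riemann ::
  "('a, 'e::euclidean_space) manifold \<Rightarrow> 'a metric_tensor \<Rightarrow> 'a vfield \<Rightarrow> 'a vfield \<Rightarrow> 'a vfield \<Rightarrow> 'a vfield" where
  "riemann M g X Y Z = (let D = levi_civita M g in
     D Y (D X Z) - D X (D Y Z) + D (lie_bracket M X Y) Z)"

text \<open>\<open>Ric(X, Y)\<close> is the trace of \<open>V \<mapsto> R(X, V)Y\<close>, which with the above sign of \<open>R\<close> makes the Ricci
  curvature of the round sphere positive. The trace of an endomorphism \<open>L\<close> of the tangent space is
  \<open>\<Sum>\<^sub>b (L \<partial>\<^sub>b)(x\<^sup>b)\<close>, independently of the chart. The scalar curvature is
  \<open>g\<^sup>a\<^sup>b Ric(\<partial>\<^sub>a, \<partial>\<^sub>b)\<close>, where \<open>g\<^sup>a\<^sup>b \<partial>\<^sub>a = grad x\<^sup>b\<close>.\<close>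

definition chart_at :: "('a, 'e::euclidean_space) manifold \<Rightarrow> 'a \<Rightarrow> ('a, 'e) chart" where
  "chart_at M p = (SOME c. c \<in> charts M \<and> p \<in> fst c)"

definition ricci ::
  "('a, 'e::euclidean_space) manifold \<Rightarrow> 'a metric_tensor \<Rightarrow> 'a vfield \<Rightarrow> 'a vfield \<Rightarrow> 'a \<Rightarrow> real" where
  "ricci M g X Y = (\<lambda>p. let c = chart_at M p in
     \<Sum>b\<in>Basis. riemann M g X (coord_field M c b) Y p (coord_fun c b))"

definition scalar_curvature ::
  "('a, 'e::euclidean_space) manifold \<Rightarrow> 'a metric_tensor \<Rightarrow> 'a \<Rightarrow> real" where
  "scalar_curvature M g = (\<lambda>p. let c = chart_at M p in
     \<Sum>b\<in>Basis. ricci M g (grad M g (coord_fun c b)) (coord_field M c b) p)"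

definition concircular ::
  "('a, 'e::euclidean_space) manifold \<Rightarrow> 'a metric_tensor \<Rightarrow> 'a vfield \<Rightarrow> 'a vfield \<Rightarrow> 'a vfield \<Rightarrow> 'a vfield" where
  "concircular M g X Y Z = (\<lambda>p. riemann M g X Y Z p -
     (scalar_curvature M g p / (real DIM('e) * (real DIM('e) - 1))) *\<^sub>t
       (g p (X p) (Z p) *\<^sub>t Y p - g p (Y p) (Z p) *\<^sub>t X p))"

text \<open>Sectional curvature of the plane spanned by \<open>X\<close> and \<open>Y\<close>; the plane is nondegenerate iff
  \<open>plane_area\<close> is nonzero.\<close>

definition plane_area :: "'a metric_tensor \<Rightarrow> 'a vfield \<Rightarrow> 'a vfield \<Rightarrow> 'a \<Rightarrow> real" where
  "plane_area g X Y p = g p (X p) (X p) * g p (Y p) (Y p) - (g p (X p) (Y p))\<^sup>2"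

definition sectional_curvature ::
  "('a, 'e::euclidean_space) manifold \<Rightarrow> 'a metric_tensor \<Rightarrow> 'a vfield \<Rightarrow> 'a vfield \<Rightarrow> 'a \<Rightarrow> real" where
  "sectional_curvature M g X Y p = g p (riemann M g X Y X p) (Y p) / plane_area g X Y p"

definition constant_curvature ::
  "('a, 'e::euclidean_space) manifold \<Rightarrow> 'a metric_tensor \<Rightarrow> bool" where
  "constant_curvature M g \<longleftrightarrow> (\<exists>\<kappa>. \<forall>U X Y. vector_field M U X \<and> vector_field M U Y \<longrightarrow>
     (\<forall>p\<in>U. plane_area g X Y p \<noteq> 0 \<longrightarrow> sectional_curvature M g X Y p = \<kappa>))"


section \<open>Parallel tensors\<close>

text \<open>The tensor fields of type \<open>(0,2)\<close> and \<open>(1,3)\<close> below are given by their action on vector fields.\<close>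

definition cov_deriv_02 ::
  "('a, 'e::euclidean_space) manifold \<Rightarrow> 'a metric_tensor \<Rightarrow> ('a vfield \<Rightarrow> 'a vfield \<Rightarrow> 'a \<Rightarrow> real) \<Rightarrow>
   'a vfield \<Rightarrow> 'a vfield \<Rightarrow> 'a vfield \<Rightarrow> 'a \<Rightarrow> real" where
  "cov_deriv_02 M g T W X Y = (let D = levi_civita M g in
     (\<lambda>p. W p (T X Y) - T (D W X) Y p - T X (D W Y) p))"

definition parallel_02 ::
  "('a, 'e::euclidean_space) manifold \<Rightarrow> 'a metric_tensor \<Rightarrow> ('a vfield \<Rightarrow> 'a vfield \<Rightarrow> 'a \<Rightarrow> real) \<Rightarrow> bool" where
  "parallel_02 M g T \<longleftrightarrow> (\<forall>U W X Y. vector_field M U W \<and> vector_field M U X \<and> vector_field M U Y \<longrightarrow>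
     (\<forall>p\<in>U. cov_deriv_02 M g T W X Y p = 0))"

definition cov_deriv_13 ::
  "('a, 'e::euclidean_space) manifold \<Rightarrow> 'a metric_tensor \<Rightarrow> ('a vfield \<Rightarrow> 'a vfield \<Rightarrow> 'a vfield \<Rightarrow> 'a vfield) \<Rightarrow>
   'a vfield \<Rightarrow> 'a vfield \<Rightarrow> 'a vfield \<Rightarrow> 'a vfield \<Rightarrow> 'a vfield" where
  "cov_deriv_13 M g T W X Y Z = (let D = levi_civita M g in
     D W (T X Y Z) - T (D W X) Y Z - T X (D W Y) Z - T X Y (D W Z))"

definition parallel_13 ::
  "('a, 'e::euclidean_space) manifold \<Rightarrow> 'a metric_tensor \<Rightarrow> ('a vfield \<Rightarrow> 'a vfield \<Rightarrow> 'a vfield \<Rightarrow> 'a vfield) \<Rightarrow> bool" where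
  "parallel_13 M g T \<longleftrightarrow> (\<forall>U W X Y Z.
     vector_field M U W \<and> vector_field M U X \<and> vector_field M U Y \<and> vector_field M U Z \<longrightarrow>
     (\<forall>p\<in>U. cov_deriv_13 M g T W X Y Z p = 0))"

definition locally_symmetric :: "('a, 'e::euclidean_space) manifold \<Rightarrow> 'a metric_tensor \<Rightarrow> bool" where
  "locally_symmetric M g \<longleftrightarrow> parallel_13 M g (riemann M g)"

definition concircularly_symmetric :: "('a, 'e::euclidean_space) manifold \<Rightarrow> 'a metric_tensor \<Rightarrow> bool" where
  "concircularly_symmetric M g \<longleftrightarrow> parallel_13 M g (concircular M g)"


section \<open>Warped products\<close>

definition warped_metric ::
  "('a, 'e::euclidean_space) manifold \<Rightarrow> 'a metric_tensor \<Rightarrow>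
   ('b, 'f::euclidean_space) manifold \<Rightarrow> 'b metric_tensor \<Rightarrow> ('a \<Rightarrow> real) \<Rightarrow> ('a \<times> 'b) metric_tensor" where
  "warped_metric M1 g1 M2 g2 f = (\<lambda>p v w.
     g1 (fst p) (pushforward M1 fst p v) (pushforward M1 fst p w) +
     (f (fst p))\<^sup>2 * g2 (snd p) (pushforward M2 snd p v) (pushforward M2 snd p w))"

end

theory Submission
  imports Defs
begin

text \<open>A concircularly symmetric manifold of dimension at least \<open>3\<close> is locally symmetric: with
  \<open>\<sigma> = \<tau> / (n (n - 1))\<close>, \<open>\<nabla>C = 0\<close> says that \<open>(\<nabla>\<^sub>W R)(X, Y)Z = (W \<sigma>) (g(X, Z)Y - g(Y, Z)X)\<close>, and
  the second Bianchi identity for three independent coordinate fields \<open>W\<close>, \<open>X\<close>, \<open>Y\<close> forces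
  \<open>d\<sigma> = 0\<close>. For the warped product, let \<open>X\<close>, \<open>Y\<close>, \<open>A\<close> be lifts from \<open>M1\<close> and \<open>V\<close>, \<open>T\<close>, \<open>S\<close>
  lifts from \<open>M2\<close>. The slices of \<open>M1\<close> are totally geodesic, so \<open>\<nabla>R = 0\<close> restricts to \<open>M1\<close>. Since
  \<open>R(V, X)Y = (H\<^sup>f(X, Y) / f) V\<close> and \<open>\<nabla>\<^sub>A V = (A f / f) V\<close>, the equation \<open>(\<nabla>\<^sub>A R)(V, X)Y = 0\<close> says
  that \<open>H\<^sup>f / f\<close> is parallel. Since \<open>R(V, T)S = R\<^sub>2(V, T)S - \<bar>grad f\<bar>\<^sup>2 (g\<^sub>2(V, S)T - g\<^sub>2(T, S)V)\<close>, the
  component along \<open>M2\<close> of \<open>\<nabla>R = 0\<close> on lifts from \<open>M2\<close> is \<open>\<nabla>\<^sup>2R\<^sub>2 = 0\<close>, while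
  \<open>(\<nabla>\<^sub>A R)(V, T)S = 0\<close> at a point of \<open>M1\<close> with \<open>A f \<noteq> 0\<close> makes \<open>R\<^sub>2\<close> a fixed multiple of
  \<open>g\<^sub>2(V, S)T - g\<^sub>2(T, S)V\<close>. The connection and curvature of the product are never computed in
  coordinates: a tangent vector of the product is determined by its two push-forwards, and the Koszul
  formula is evaluated on lifts only.\<close>

section \<open>Calculus of smooth functions on open sets\<close>

text \<open>Two obstacles shape the work before the warped product. The connection is a Hilbert
  choice, and the scalar curvature is a trace in a chart chosen anew at each point; existence of a
  Levi-Civita connection and chart independence of the traces come first. Smoothness of gradients
  and of the constructed connection rests on the smooth dependence of the solution of a linear
  system, with the Gram matrix of the metric, on its coefficients. Tangent vectors are derivations,
  so that even their finite dimension needs Hadamard's lemma. The constant in the last step arises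
  as follows. Let \<open>a = A f / f\<close> and let \<open>N\<close> be the squared length of
  \<open>grad f\<close>. Differentiating lifts from \<open>M2\<close> along \<open>A\<close>
  multiplies them by \<open>a\<close>, so \<open>(\<nabla>\<^sub>A R)(V, T)S\<close> is
  \<open>a (R\<^sub>2 - N G) - (A N) G\<close>, minus \<open>a (R\<^sub>2 - N G)\<close> for each of
  three arguments. Its vanishing gives \<open>R\<^sub>2 = (N - f (A N) / (2 A f)) G\<close>. In that
  part \<open>M1\<close> is connected, which provides a point with nonzero differential for a
  nonconstant \<open>f\<close>.\<close>

lemma Ck_on_SucD:
  assumes "Ck_on (Suc k) S f"
  shows "x \<in> S \<Longrightarrow> (f has_derivative frechet_derivative f (at x)) (at x)"
    and "Ck_on k S (\<lambda>x. frechet_derivative f (at x) v)"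
  using assms by (auto simp: frechet_derivative_works)

lemma Ck_on_cong:
  assumes "open S" "\<And>x. x \<in> S \<Longrightarrow> f x = g x" "Ck_on k S f"
  shows "Ck_on k S g"
  using assms(2,3)
proof (induction k arbitrary: f g)
  case 0
  then show ?case by (auto cong: continuous_on_cong)
next
  case (Suc k)
  have d: "(g has_derivative frechet_derivative f (at x)) (at x)" if "x \<in> S" for x
    using has_derivative_transform_within_open[OF Ck_on_SucD(1)[OF Suc.prems(2) that] assms(1) that]
      Suc.prems(1) by blast
  then have "frechet_derivative g (at x) = frechet_derivative f (at x)" if "x \<in> S" for x
    using frechet_derivative_at that by metis
  then have "Ck_on k S (\<lambda>x. frechet_derivative g (at x) v)" for v
    by (intro Suc.IH[OF _ Ck_on_SucD(2)[OF Suc.prems(2)]]) auto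
  moreover have "\<forall>x\<in>S. g differentiable at x"
    using d by (auto simp: differentiable_def)
  ultimately show ?case by simp
qed

text \<open>\<open>frechet_derivative\<close> is a choice, but derivatives are unique, so any
  explicit formula \<open>f'\<close> may replace it on \<open>S\<close>. Most closure rules below
  are this rule combined with a differentiation rule.\<close>

lemma Ck_on_SucI:
  assumes "open S" "\<And>x. x \<in> S \<Longrightarrow> (f has_derivative f' x) (at x)" "\<And>v. Ck_on k S (\<lambda>x. f' x v)"
  shows "Ck_on (Suc k) S f"
proof -
  have "frechet_derivative f (at x) = f' x" if "x \<in> S" for x
    by (rule frechet_derivative_at[symmetric, OF assms(2)[OF that]])
  then have "Ck_on k S (\<lambda>x. frechet_derivative f (at x) v)" for v
    by (intro Ck_on_cong[OF assms(1) _ assms(3)]) simp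
  then show ?thesis
    using assms(2) by (auto simp: differentiable_def)
qed

lemma Ck_on_subset: "Ck_on k S f \<Longrightarrow> T \<subseteq> S \<Longrightarrow> Ck_on k T f"
  by (induction k arbitrary: f) (auto intro: continuous_on_subset)

lemma Ck_on_continuous: "Ck_on k S f \<Longrightarrow> continuous_on S f"
  by (cases k)
    (auto intro!: continuous_at_imp_continuous_on differentiable_imp_continuous_within)

lemma Ck_on_mono: "Ck_on (Suc k) S f \<Longrightarrow> Ck_on k S f"
proof (induction k arbitrary: f)
  case 0
  then show ?case using Ck_on_continuous[OF 0] by simp
next
  case (Suc k)
  show ?case
    using Suc.prems Suc.IH[OF Ck_on_SucD(2)[OF Suc.prems]] by simp
qed

lemma Ck_on_local:
  assumes "\<And>x. x \<in> S \<Longrightarrow> \<exists>T. open T \<and> x \<in> T \<and> Ck_on k T f"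
  shows "Ck_on k S f"
  using assms
proof (induction k arbitrary: f)
  case 0
  then show ?case
    by (metis Ck_on.simps(1) continuous_at_imp_continuous_on continuous_on_eq_continuous_at)
next
  case (Suc k)
  have "Ck_on k S (\<lambda>x. frechet_derivative f (at x) v)" for v
    by (rule Suc.IH) (use Suc.prems in \<open>fastforce\<close>)
  then show ?case using Suc.prems by fastforce
qed

lemma Ck_on_const: "Ck_on k S (\<lambda>x. c)"
  by (induction k arbitrary: c) auto

lemma Ck_on_linear:
  assumes "open S" "bounded_linear f"
  shows "Ck_on k S f"
proof (cases k)
  case 0
  then show ?thesis
    using assms linear_continuous_on by auto
next
  case (Suc n)
  then show ?thesis
    using Ck_on_SucI[OF assms(1), of f "\<lambda>x. f" n]
      bounded_linear_imp_has_derivative[OF assms(2)] Ck_on_const by metis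
qed

lemma Ck_on_linear_comp:
  assumes "open S" "bounded_linear L" "Ck_on k S f"
  shows "Ck_on k S (\<lambda>x. L (f x))"
  using assms(3)
proof (induction k arbitrary: f)
  case 0
  then show ?case
    using bounded_linear.continuous_on[OF assms(2)] by auto
next
  case (Suc k)
  show ?case
    by (rule Ck_on_SucI[OF assms(1) bounded_linear.has_derivative[OF assms(2) Ck_on_SucD(1)[OF Suc.prems]]])
      (use Suc.IH Ck_on_SucD(2)[OF Suc.prems] in auto)
qed

lemma Ck_on_add:
  assumes "open S" "Ck_on k S f" "Ck_on k S g"
  shows "Ck_on k S (\<lambda>x. f x + g x)"
  using assms(2,3)
proof (induction k arbitrary: f g)
  case 0
  then show ?case by (auto intro: continuous_on_add)
next
  case (Suc k)
  show ?case
    by (rule Ck_on_SucI[OF assms(1) has_derivative_add[OF Ck_on_SucD(1)[OF Suc.prems(1)] Ck_on_SucD(1)[OF Suc.prems(2)]]])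
      (use Suc.IH Ck_on_SucD(2)[OF Suc.prems(1)] Ck_on_SucD(2)[OF Suc.prems(2)] in auto)
qed

lemma Ck_on_bilinear:
  assumes "open S" "bounded_bilinear B" "Ck_on k S f" "Ck_on k S g"
  shows "Ck_on k S (\<lambda>x. B (f x) (g x))"
  using assms(3,4)
proof (induction k arbitrary: f g)
  case 0
  then show ?case using bounded_bilinear.continuous_on[OF assms(2)] by auto
next
  case (Suc k)
  show ?case
    by (rule Ck_on_SucI[OF assms(1) bounded_bilinear.FDERIV[OF assms(2) Ck_on_SucD(1)[OF Suc.prems(1)] Ck_on_SucD(1)[OF Suc.prems(2)]]])
      (assumption+, intro Ck_on_add assms(1) Suc.IH Ck_on_SucD(2)[OF Suc.prems(1)] Ck_on_SucD(2)[OF Suc.prems(2)]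
         Ck_on_mono[OF Suc.prems(1)] Ck_on_mono[OF Suc.prems(2)])
qed

lemma Ck_on_mult:
  fixes f g :: "'e::euclidean_space \<Rightarrow> real"
  assumes "open S" "Ck_on k S f" "Ck_on k S g"
  shows "Ck_on k S (\<lambda>x. f x * g x)"
  using Ck_on_bilinear[OF assms(1) bounded_bilinear_mult assms(2,3)] .

lemma Ck_on_sum:
  assumes "open S" "\<And>i. i \<in> I \<Longrightarrow> Ck_on k S (f i)"
  shows "Ck_on k S (\<lambda>x. \<Sum>i\<in>I. f i x)"
  using assms(2)
  by (induction I rule: infinite_finite_induct) (auto intro: Ck_on_const Ck_on_add[OF assms(1)])

lemma Ck_on_inverse:
  fixes f :: "'e::euclidean_space \<Rightarrow> real"
  assumes "open S" "Ck_on k S f" "\<And>x. x \<in> S \<Longrightarrow> f x \<noteq> 0"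
  shows "Ck_on k S (\<lambda>x. inverse (f x))"
  using assms(2)
proof (induction k)
  case 0
  then show ?case using assms(3) by (auto intro: continuous_on_inverse)
next
  case (Suc k)
  \<comment> \<open>The sign is kept as a factor \<open>- 1\<close>, so that the derivative is a
    product to which \<open>Ck_on_mult\<close> applies, with the inductive hypothesis for the two
    copies of \<open>inverse (f x)\<close>.\<close>
  have d: "((\<lambda>x. inverse (f x)) has_derivative
      (\<lambda>v. - 1 * (inverse (f x) * frechet_derivative f (at x) v * inverse (f x)))) (at x)" if "x \<in> S" for x
    using Deriv.has_derivative_inverse[OF assms(3)[OF that] Ck_on_SucD(1)[OF Suc.prems that]] by simp
  show ?case
    by (rule Ck_on_SucI[OF assms(1) d])
      (assumption, intro Ck_on_mult assms(1) Ck_on_const Suc.IH[OF Ck_on_mono[OF Suc.prems]] Ck_on_SucD(2)[OF Suc.prems])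
qed

lemma linear_basis_expansion:
  fixes L :: "'e::euclidean_space \<Rightarrow> 'f::real_vector"
  assumes "linear L"
  shows "L y = (\<Sum>b\<in>Basis. (y \<bullet> b) *\<^sub>R L b)"
proof -
  have "L y = L (\<Sum>b\<in>Basis. (y \<bullet> b) *\<^sub>R b)"
    by (simp add: euclidean_representation)
  then show ?thesis
    using assms by (simp add: linear_sum linear_cmul)
qed

lemma Ck_on_compose:
  fixes f :: "'e::euclidean_space \<Rightarrow> 'f::euclidean_space" and g :: "'f \<Rightarrow> 'g::real_normed_vector"
  assumes "open S" "Ck_on k S f" "Ck_on k T g" "f ` S \<subseteq> T"
  shows "Ck_on k S (\<lambda>x. g (f x))"
  using assms(2,3)
proof (induction k arbitrary: g)
  case 0
  then show ?case using assms(4) by (auto intro: continuous_on_compose2)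
next
  case (Suc k)
  note f = Ck_on_SucD[OF Suc.prems(1)] and g = Ck_on_SucD[OF Suc.prems(2)]
  \<comment> \<open>Expanding the inner derivative in the basis leaves derivatives of
    \<open>g\<close> in fixed directions \<open>b\<close> only; these are again functions composed
    with \<open>f\<close>, so the induction, general in \<open>g\<close>, applies.\<close>
  have d: "((\<lambda>x. g (f x)) has_derivative
      (\<lambda>v. \<Sum>b\<in>Basis. (frechet_derivative f (at x) v \<bullet> b) *\<^sub>R frechet_derivative g (at (f x)) b)) (at x)"
    if x: "x \<in> S" for x
  proof -
    have fx: "f x \<in> T" using x assms(4) by auto
    have "((\<lambda>x. g (f x)) has_derivative
        (\<lambda>v. frechet_derivative g (at (f x)) (frechet_derivative f (at x) v))) (at x)"
      using has_derivative_compose[OF f(1)[OF x] g(1)[OF fx]] .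
    moreover have "(\<lambda>v. frechet_derivative g (at (f x)) (frechet_derivative f (at x) v)) =
       (\<lambda>v. \<Sum>b\<in>Basis. (frechet_derivative f (at x) v \<bullet> b) *\<^sub>R frechet_derivative g (at (f x)) b)"
      by (intro ext linear_basis_expansion[OF has_derivative_linear[OF g(1)[OF fx]]])
    ultimately show ?thesis by (simp only:)
  qed
  show ?case
  proof (rule Ck_on_SucI[OF assms(1) d])
    fix v
    show "Ck_on k S (\<lambda>x. \<Sum>b\<in>Basis. (frechet_derivative f (at x) v \<bullet> b) *\<^sub>R frechet_derivative g (at (f x)) b)"
      by (intro Ck_on_sum assms Ck_on_bilinear[OF assms(1) bounded_bilinear_scaleR]
          Ck_on_linear_comp[OF assms(1) bounded_linear_inner_left] f(2) Suc.IH g(2) Ck_on_mono[OF Suc.prems(1)])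
  qed
qed

section \<open>Closure rules for infinitely differentiable functions, and Hadamard's lemma\<close>

lemma smooth_on_cong:
  assumes "open S" "\<And>x. x \<in> S \<Longrightarrow> f x = g x" "smooth_on S f"
  shows "smooth_on S g"
  using assms Ck_on_cong unfolding smooth_on_def by blast

lemma smooth_on_subset: "smooth_on S f \<Longrightarrow> T \<subseteq> S \<Longrightarrow> smooth_on T f"
  using Ck_on_subset unfolding smooth_on_def by blast

lemma smooth_on_local:
  assumes "\<And>x. x \<in> S \<Longrightarrow> \<exists>T. open T \<and> x \<in> T \<and> smooth_on T f"
  shows "smooth_on S f"
  unfolding smooth_on_def
  by (intro allI Ck_on_local) (use assms in \<open>auto simp: smooth_on_def\<close>)

lemma smooth_on_const: "smooth_on S (\<lambda>x. c)"
  by (simp add: smooth_on_def Ck_on_const)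

lemma smooth_on_linear: "open S \<Longrightarrow> bounded_linear f \<Longrightarrow> smooth_on S f"
  by (simp add: smooth_on_def Ck_on_linear)

lemma smooth_on_linear_comp:
  "open S \<Longrightarrow> bounded_linear L \<Longrightarrow> smooth_on S f \<Longrightarrow> smooth_on S (\<lambda>x. L (f x))"
  by (simp add: smooth_on_def Ck_on_linear_comp)

lemma smooth_on_add:
  "open S \<Longrightarrow> smooth_on S f \<Longrightarrow> smooth_on S g \<Longrightarrow> smooth_on S (\<lambda>x. f x + g x)"
  by (simp add: smooth_on_def Ck_on_add)

lemma smooth_on_mult:
  fixes f g :: "'e::euclidean_space \<Rightarrow> real"
  shows "open S \<Longrightarrow> smooth_on S f \<Longrightarrow> smooth_on S g \<Longrightarrow> smooth_on S (\<lambda>x. f x * g x)"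
  by (simp add: smooth_on_def Ck_on_mult)

lemma smooth_on_sum:
  "open S \<Longrightarrow> (\<And>i. i \<in> I \<Longrightarrow> smooth_on S (f i)) \<Longrightarrow> smooth_on S (\<lambda>x. \<Sum>i\<in>I. f i x)"
  by (simp add: smooth_on_def Ck_on_sum)

lemma smooth_on_inverse:
  fixes f :: "'e::euclidean_space \<Rightarrow> real"
  shows "open S \<Longrightarrow> smooth_on S f \<Longrightarrow> (\<And>x. x \<in> S \<Longrightarrow> f x \<noteq> 0) \<Longrightarrow> smooth_on S (\<lambda>x. inverse (f x))"
  by (simp add: smooth_on_def Ck_on_inverse)

lemma smooth_on_compose:
  fixes f :: "'e::euclidean_space \<Rightarrow> 'f::euclidean_space" and g :: "'f \<Rightarrow> 'g::real_normed_vector"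
  assumes "open S" "smooth_on S f" "smooth_on T g" "f ` S \<subseteq> T"
  shows "smooth_on S (\<lambda>x. g (f x))"
  using assms Ck_on_compose unfolding smooth_on_def by blast

lemma smooth_on_has_derivative:
  assumes "smooth_on S f" "x \<in> S"
  shows "(f has_derivative frechet_derivative f (at x)) (at x)"
  using assms Ck_on_SucD(1) unfolding smooth_on_def by blast

lemma smooth_on_continuous: "smooth_on S f \<Longrightarrow> continuous_on S f"
  using Ck_on_continuous unfolding smooth_on_def by blast

lemma smooth_on_frechet_derivative:
  "smooth_on S f \<Longrightarrow> smooth_on S (\<lambda>x. frechet_derivative f (at x) v)"
  using Ck_on_SucD(2) unfolding smooth_on_def by blast

text \<open>Each differentiation under the integral sign brings out one more factor \<open>t\<close>
  by the chain rule; the power \<open>t ^ m\<close> is there to make the induction on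
  \<open>k\<close> close.\<close>

lemma Ck_on_segment_integral:
  fixes F :: "'e::euclidean_space \<Rightarrow> real"
  assumes "open S" "convex S" "p \<in> S" "Ck_on k S F"
  shows "Ck_on k S (\<lambda>x. integral (cbox 0 1) (\<lambda>t. t ^ m * F (p + t *\<^sub>R (x - p))))"
  using assms(4)
proof (induction k arbitrary: F m)
  case 0
  have seg: "p + t *\<^sub>R (x - p) \<in> S" if "x \<in> S" "t \<in> cbox 0 (1::real)" for x t
    using convexD[OF assms(2,3) that(1), of "1 - t" t] that(2) by (simp add: algebra_simps)
  have "continuous_on (S \<times> cbox 0 (1::real)) (\<lambda>(x, t). t ^ m * F (p + t *\<^sub>R (x - p)))"
    unfolding split_def
    using seg 0 by (auto intro!: continuous_intros continuous_on_compose2[of S F])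
  from integral_continuous_on_param[OF this] show ?case by simp
next
  case (Suc k)
  note F = Ck_on_SucD[OF Suc.prems]
  have seg: "p + t *\<^sub>R (x - p) \<in> S" if "x \<in> S" "t \<in> cbox 0 (1::real)" for x t
    using convexD[OF assms(2,3) that(1), of "1 - t" t] that(2) by (simp add: algebra_simps)
  \<comment> \<open>The derivative in \<open>x\<close> as a bounded linear map, the form in which
    the Leibniz integral rule takes it; its joint continuity is checked direction by
    direction.\<close>
  define fx where "fx x t = t ^ Suc m *\<^sub>R Blinfun (frechet_derivative F (at (p + t *\<^sub>R (x - p))))" for x t
  have fx: "blinfun_apply (fx x t) v = t ^ Suc m * frechet_derivative F (at (p + t *\<^sub>R (x - p))) v"
    if "x \<in> S" "t \<in> cbox 0 (1::real)" for x t v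
    unfolding fx_def
    by (simp add: scaleR_blinfun.rep_eq bounded_linear_Blinfun_apply
        has_derivative_bounded_linear[OF F(1)[OF seg[OF that]]])
  have cF: "continuous_on S F" using Ck_on_continuous[OF Suc.prems] .
  have cD: "continuous_on S (\<lambda>x. frechet_derivative F (at x) v)" for v
    using Ck_on_continuous[OF F(2)] .
  have cfx: "continuous_on (S \<times> cbox 0 1) (\<lambda>(x, t). fx x t)"
  proof (rule continuous_on_blinfun_componentwise)
    fix i :: 'e
    have "continuous_on (S \<times> cbox 0 (1::real))
       (\<lambda>z. snd z ^ Suc m * frechet_derivative F (at (p + snd z *\<^sub>R (fst z - p))) i)"
      using seg by (intro continuous_intros continuous_on_compose2[OF cD]) auto
    then show "continuous_on (S \<times> cbox 0 1) (\<lambda>x. blinfun_apply (case x of (x, xa) \<Rightarrow> fx x xa) i)"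
      by (rule continuous_on_eq) (auto simp: fx split_def)
  qed
  have int: "(\<lambda>t. t ^ m * F (p + t *\<^sub>R (x - p))) integrable_on cbox 0 1" if "x \<in> S" for x
    using seg that by (intro integrable_continuous continuous_intros continuous_on_compose2[OF cF]) auto
  have dfx: "((\<lambda>x. t ^ m * F (p + t *\<^sub>R (x - p))) has_derivative blinfun_apply (fx x t)) (at x within S)"
    if "x \<in> S" "t \<in> cbox 0 1" for x t
  proof -
    let ?D = "frechet_derivative F (at (p + t *\<^sub>R (x - p)))"
    have "((\<lambda>x. p + t *\<^sub>R (x - p)) has_derivative (\<lambda>v. t *\<^sub>R v)) (at x within S)"
      by (auto intro!: derivative_eq_intros)
    from has_derivative_compose[OF this F(1)[OF seg[OF that]]]
    have "((\<lambda>x. t ^ m * F (p + t *\<^sub>R (x - p))) has_derivative (\<lambda>v. t ^ m * ?D (t *\<^sub>R v))) (at x within S)"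
      by (intro has_derivative_mult_right)
    moreover have "?D (t *\<^sub>R v) = t * ?D v" for v
      using linear_cmul[OF has_derivative_linear[OF F(1)[OF seg[OF that]]]] by simp
    moreover have "(\<lambda>v. t ^ m * ?D (t *\<^sub>R v)) = blinfun_apply (fx x t)"
      using calculation(2) fx[OF that] by auto
    ultimately show ?thesis by (simp only:)
  qed
  have "((\<lambda>x. integral (cbox 0 1) (\<lambda>t. t ^ m * F (p + t *\<^sub>R (x - p)))) has_derivative
      integral (cbox 0 1) (fx x)) (at x)" if x: "x \<in> S" for x
    using leibniz_rule[OF dfx int cfx x assms(2)] at_within_open[OF x assms(1)] by simp
  moreover have "Ck_on k S (\<lambda>x. blinfun_apply (integral (cbox 0 1) (fx x)) v)" for v
  proof (rule Ck_on_cong[OF assms(1) _ Suc.IH[OF F(2)]])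
    fix x assume x: "x \<in> S"
    have "continuous_on (cbox 0 1) (\<lambda>t. case (x, t) of (x, t) \<Rightarrow> fx x t)"
      using x by (intro continuous_on_compose2[OF cfx] continuous_intros) auto
    then have "fx x integrable_on cbox 0 1"
      by (intro integrable_continuous) simp
    then show "integral (cbox 0 1) (\<lambda>t. t ^ Suc m * frechet_derivative F (at (p + t *\<^sub>R (x - p))) v) =
        blinfun_apply (integral (cbox 0 1) (fx x)) v"
      using fx[OF x] by (subst blinfun_apply_integral) (auto intro!: integral_cong)
  qed
  ultimately show ?case
    by (intro Ck_on_SucI[OF assms(1)])
qed

text \<open>The fundamental theorem of calculus along the segment from \<open>p\<close> to
  \<open>x\<close>, with \<open>G b\<close> the average of the partial derivative in direction
  \<open>b\<close> over the segment; at \<open>x = p\<close> this is the average of a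
  constant.\<close>

lemma hadamard:
  fixes F :: "'e::euclidean_space \<Rightarrow> real"
  assumes "open S" "convex S" "p \<in> S" "smooth_on S F"
  obtains G where "\<And>b. smooth_on S (G b)"
    and "\<And>x. x \<in> S \<Longrightarrow> F x = F p + (\<Sum>b\<in>Basis. ((x - p) \<bullet> b) * G b x)"
    and "\<And>b. G b p = frechet_derivative F (at p) b"
proof -
  define G where "G b x = integral (cbox 0 1) (\<lambda>t. frechet_derivative F (at (p + t *\<^sub>R (x - p))) b)" for b x
  have seg: "p + t *\<^sub>R (x - p) \<in> S" if "x \<in> S" "t \<in> cbox 0 (1::real)" for x t
    using convexD[OF assms(2,3) that(1), of "1 - t" t] that(2) by (simp add: algebra_simps)
  have "smooth_on S (G b)" for b
    using Ck_on_segment_integral[OF assms(1-3), of _ "\<lambda>x. frechet_derivative F (at x) b" 0]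
      smooth_on_frechet_derivative[OF assms(4)]
    by (simp add: smooth_on_def G_def[abs_def])
  moreover have "F x = F p + (\<Sum>b\<in>Basis. ((x - p) \<bullet> b) * G b x)" if x: "x \<in> S" for x
  proof -
    let ?D = "\<lambda>t. frechet_derivative F (at (p + t *\<^sub>R (x - p)))"
    have lin: "linear (?D t)" if "t \<in> cbox 0 1" for t
      using has_derivative_linear[OF smooth_on_has_derivative[OF assms(4) seg[OF x that]]] .
    have int: "(\<lambda>t. ?D t b) integrable_on cbox 0 1" for b
      using seg[OF x]
      by (intro integrable_continuous continuous_intros
          continuous_on_compose2[OF smooth_on_continuous[OF smooth_on_frechet_derivative[OF assms(4)]]]) auto
    have "((\<lambda>t. F (p + t *\<^sub>R (x - p))) has_vector_derivative ?D t (x - p)) (at t within {0..1})"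
      if t: "t \<in> {0..1}" for t
    proof -
      have "((\<lambda>t. p + t *\<^sub>R (x - p)) has_derivative (\<lambda>s. s *\<^sub>R (x - p))) (at t within {0..1})"
        by (auto intro!: derivative_eq_intros)
      from has_derivative_compose[OF this smooth_on_has_derivative[OF assms(4) seg[OF x]]] t
      show ?thesis
        using linear_cmul[OF lin, of t] by (auto simp: has_vector_derivative_def)
    qed
    then have "((\<lambda>t. ?D t (x - p)) has_integral F (p + 1 *\<^sub>R (x - p)) - F (p + 0 *\<^sub>R (x - p))) {0..1}"
      by (intro fundamental_theorem_of_calculus) auto
    then have "F x - F p = integral (cbox 0 1) (\<lambda>t. ?D t (x - p))"
      by (simp add: integral_unique)
    also have "\<dots> = integral (cbox 0 1) (\<lambda>t. \<Sum>b\<in>Basis. ((x - p) \<bullet> b) * ?D t b)"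
    proof (rule integral_cong)
      fix t :: real assume "t \<in> cbox 0 1"
      from linear_basis_expansion[OF lin[OF this], of "x - p"]
      show "?D t (x - p) = (\<Sum>b\<in>Basis. ((x - p) \<bullet> b) * ?D t b)" by simp
    qed
    also have "\<dots> = (\<Sum>b\<in>Basis. ((x - p) \<bullet> b) * G b x)"
      using int by (subst integral_sum) (auto simp: G_def intro!: integrable_on_mult_right)
    finally show ?thesis by simp
  qed
  moreover have "G b p = frechet_derivative F (at p) b" for b
    by (simp add: G_def)
  ultimately show ?thesis using that by blast
qed

section \<open>Smooth functions and tangent vectors on a manifold\<close>

lemma sum_fun_apply: "(\<Sum>i\<in>I. F i) x = (\<Sum>i\<in>I. F i x)"
  by (induction I rule: infinite_finite_induct) auto

lemma fun_diff_apply [simp]: "(f - g) x = f x - (g x :: 'a :: ab_group_add)"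
  by (rule fun_diff_def[THEN fun_cong])

lemma fun_uminus_apply [simp]: "(- f) x = - (f x :: 'a :: ab_group_add)"
  by (rule fun_Compl_def[THEN fun_cong])

lemma tscale_apply [simp]: "(c *\<^sub>t v) h = c * v h"
  by (simp add: tscale_def)

lemma vscale_apply [simp]: "(h *\<^sub>v X) p = h p *\<^sub>t X p"
  by (simp add: vscale_def)

locale smanifold =
  fixes M :: "('a, 'e::euclidean_space) manifold"
  assumes smooth_manifold: "smooth_manifold M"
begin

abbreviation "SF \<equiv> smooth_fun M"
abbreviation "VF \<equiv> vector_field M"
abbreviation "TS \<equiv> tangent_space M"
abbreviation "OP \<equiv> openin (mtop M)"
abbreviation "CF \<equiv> coord_field M"

lemma
  assumes "(V, \<phi>) \<in> charts M"
  shows chart_openin: "OP V" and chart_inj: "inj_on \<phi> V"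
    and chart_open_image: "\<And>W. OP W \<Longrightarrow> W \<subseteq> V \<Longrightarrow> open (\<phi> ` W)"
    and chart_open_vimage: "\<And>O'. open O' \<Longrightarrow> OP {p\<in>V. \<phi> p \<in> O'}"
proof -
  from smooth_manifold assms have V: "OP V" and o: "open (\<phi> ` V)"
    and hom: "homeomorphic_map (subtopology (mtop M) V) (top_of_set (\<phi> ` V)) \<phi>"
    unfolding smooth_manifold_def by auto
  have ts: "topspace (subtopology (mtop M) V) = V"
    using openin_subset[OF V] by auto
  show "OP V" by fact
  show "inj_on \<phi> V"
    using homeomorphic_imp_injective_map[OF hom] ts by simp
  show "open (\<phi> ` W)" if "OP W" "W \<subseteq> V" for W
  proof -
    have "openin (subtopology (mtop M) V) W"
      using that by (metis openin_open_subtopology V)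
    with hom have "openin (top_of_set (\<phi> ` V)) (\<phi> ` W)"
      using homeomorphic_imp_open_map open_map_def by blast
    then show ?thesis using o openin_open_trans by blast
  qed
  show "OP {p\<in>V. \<phi> p \<in> O'}" if "open O'" for O'
  proof -
    have "openin (top_of_set (\<phi> ` V)) (\<phi> ` V \<inter> O')" using that by blast
    from openin_continuous_map_preimage[OF homeomorphic_imp_continuous_map[OF hom] this]
    have "openin (subtopology (mtop M) V) {p \<in> V. \<phi> p \<in> \<phi> ` V \<inter> O'}" unfolding ts .
    moreover have "{p \<in> V. \<phi> p \<in> \<phi> ` V \<inter> O'} = {p\<in>V. \<phi> p \<in> O'}" by auto
    ultimately show ?thesis using openin_open_subtopology[OF V] by simp
  qed
qed

lemma chart_cover: "p \<in> points M \<Longrightarrow> \<exists>V \<phi>. (V, \<phi>) \<in> charts M \<and> p \<in> V"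
  using smooth_manifold unfolding smooth_manifold_def by blast

lemma chart_transition:
  assumes "(V, \<phi>) \<in> charts M" "(W, \<psi>) \<in> charts M"
  shows "smooth_on (\<phi> ` (V \<inter> W)) (\<lambda>x. \<psi> (inv_into V \<phi> x))"
  using smooth_manifold assms unfolding smooth_manifold_def by (fastforce simp: o_def)

lemma chart_inv [simp]: "(V, \<phi>) \<in> charts M \<Longrightarrow> p \<in> V \<Longrightarrow> inv_into V \<phi> (\<phi> p) = p"
  using chart_inj inv_into_f_f by metis

lemma OP_Int: "OP U \<Longrightarrow> OP W \<Longrightarrow> OP (U \<inter> W)"
  by (rule openin_Int)

lemma SF_openin: "SF U h \<Longrightarrow> OP U"
  by (simp add: smooth_fun_def)

lemma SF_chart:
  "SF U h \<Longrightarrow> (V, \<phi>) \<in> charts M \<Longrightarrow> smooth_on (\<phi> ` (U \<inter> V)) (\<lambda>x. h (inv_into V \<phi> x))"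
  unfolding smooth_fun_def o_def by blast

lemma chart_open_image_Int: "OP U \<Longrightarrow> (V, \<phi>) \<in> charts M \<Longrightarrow> open (\<phi> ` (U \<inter> V))"
  by (rule chart_open_image) (auto intro: OP_Int chart_openin)

text \<open>Transition maps are smooth, so a single chart containing \<open>W\<close> suffices
  although \<open>smooth_fun\<close> quantifies over all charts.\<close>

lemma SFI_chart:
  assumes c: "(V, \<phi>) \<in> charts M" and W: "OP W" "W \<subseteq> V"
    and s: "smooth_on (\<phi> ` W) (\<lambda>x. h (inv_into V \<phi> x))"
  shows "SF W h"
proof -
  have "smooth_on (\<psi> ` (W \<inter> V')) (\<lambda>x. h (inv_into V' \<psi> x))" if c': "(V', \<psi>) \<in> charts M" for V' \<psi>
  proof -
    let ?T = "\<psi> ` (W \<inter> V')"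
    have T: "open ?T" using chart_open_image_Int[OF W(1) c'] .
    have "smooth_on ?T (\<lambda>x. \<phi> (inv_into V' \<psi> x))"
      by (rule smooth_on_subset[OF chart_transition[OF c' c]]) (use W in auto)
    moreover have "(\<lambda>x. \<phi> (inv_into V' \<psi> x)) ` ?T \<subseteq> \<phi> ` W"
      using c' by auto
    ultimately have "smooth_on ?T (\<lambda>x. h (inv_into V \<phi> (\<phi> (inv_into V' \<psi> x))))"
      by (intro smooth_on_compose[OF T _ s])
    then show "smooth_on ?T (\<lambda>x. h (inv_into V' \<psi> x))"
      by (rule smooth_on_cong[OF T, rotated]) (use c c' W in auto)
  qed
  then show ?thesis
    using W by (auto simp: smooth_fun_def o_def)
qed

lemma SF_subset: "SF U h \<Longrightarrow> OP W \<Longrightarrow> W \<subseteq> U \<Longrightarrow> SF W h"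
  unfolding smooth_fun_def by (blast intro: smooth_on_subset)

lemma SF_local:
  assumes U: "OP U" and "\<And>p. p \<in> U \<Longrightarrow> \<exists>W. p \<in> W \<and> SF W h"
  shows "SF U h"
proof -
  have "smooth_on (\<psi> ` (U \<inter> V)) (\<lambda>x. h (inv_into V \<psi> x))" if c: "(V, \<psi>) \<in> charts M" for V \<psi>
  proof (rule smooth_on_local)
    fix x assume "x \<in> \<psi> ` (U \<inter> V)"
    then obtain q where q: "q \<in> U" "q \<in> V" "x = \<psi> q" by blast
    then obtain W where W: "q \<in> W" "SF W h" using assms(2) by blast
    have "open (\<psi> ` (W \<inter> V))" using chart_open_image_Int[OF SF_openin[OF W(2)] c] .
    then show "\<exists>T. open T \<and> x \<in> T \<and> smooth_on T (\<lambda>x. h (inv_into V \<psi> x))"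
      using SF_chart[OF W(2) c] q W(1) by (intro exI[of _ "\<psi> ` (W \<inter> V)"]) auto
  qed
  then show ?thesis
    using U by (auto simp: smooth_fun_def o_def)
qed

lemma SF_cong:
  assumes "SF U h" "\<And>p. p \<in> U \<Longrightarrow> h p = k p"
  shows "SF U k"
proof -
  have "smooth_on (\<psi> ` (U \<inter> V)) (\<lambda>x. k (inv_into V \<psi> x))" if c: "(V, \<psi>) \<in> charts M" for V \<psi>
    by (rule smooth_on_cong[OF _ _ SF_chart[OF assms(1) c]])
      (use chart_open_image_Int[OF SF_openin[OF assms(1)] c] c assms(2) in auto)
  then show ?thesis
    using SF_openin[OF assms(1)] by (auto simp: smooth_fun_def o_def)
qed

lemma SF_const: "OP U \<Longrightarrow> SF U (\<lambda>p. c)"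
  by (auto simp: smooth_fun_def o_def smooth_on_const)

lemma SF_add: "SF U h \<Longrightarrow> SF U k \<Longrightarrow> SF U (\<lambda>p. h p + k p)"
  unfolding smooth_fun_def o_def by (auto intro!: smooth_on_add chart_open_image_Int)

lemma SF_mult: "SF U h \<Longrightarrow> SF U k \<Longrightarrow> SF U (\<lambda>p. h p * k p)"
  unfolding smooth_fun_def o_def by (auto intro!: smooth_on_mult chart_open_image_Int)

lemma SF_cmult: "SF U h \<Longrightarrow> SF U (\<lambda>p. c * h p)"
  using SF_mult[OF SF_const[OF SF_openin]] by blast

lemma SF_minus: "SF U h \<Longrightarrow> SF U (\<lambda>p. - h p)"
  using SF_cmult[of U h "-1"] by simp

lemma SF_diff: "SF U h \<Longrightarrow> SF U k \<Longrightarrow> SF U (\<lambda>p. h p - k p)"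
  using SF_add[OF _ SF_minus] by fastforce

lemma SF_sum: "OP U \<Longrightarrow> (\<And>i. i \<in> I \<Longrightarrow> SF U (h i)) \<Longrightarrow> SF U (\<lambda>p. \<Sum>i\<in>I. h i p)"
  by (induction I rule: infinite_finite_induct) (auto intro: SF_const SF_add)

lemma SF_inverse: "SF U h \<Longrightarrow> (\<And>p. p \<in> U \<Longrightarrow> h p \<noteq> 0) \<Longrightarrow> SF U (\<lambda>p. inverse (h p))"
  unfolding smooth_fun_def o_def
  by (auto intro!: smooth_on_inverse chart_open_image_Int)

lemma SF_divide: "SF U h \<Longrightarrow> SF U k \<Longrightarrow> (\<And>p. p \<in> U \<Longrightarrow> k p \<noteq> 0) \<Longrightarrow> SF U (\<lambda>p. h p / k p)"
  using SF_mult[OF _ SF_inverse] by (simp add: divide_inverse)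

lemma SF_coord_fun:
  assumes c: "(V, \<phi>) \<in> charts M"
  shows "SF V (coord_fun (V, \<phi>) b)"
proof -
  have o: "open (\<phi> ` V)" using chart_open_image[OF c chart_openin[OF c]] by simp
  have "smooth_on (\<phi> ` V) (\<lambda>x. coord_fun (V, \<phi>) b (inv_into V \<phi> x))"
    by (rule smooth_on_cong[OF o _ smooth_on_linear[OF o bounded_linear_inner_left[of b]]])
      (use c in \<open>auto simp: coord_fun_def\<close>)
  then show ?thesis
    by (rule SFI_chart[OF c chart_openin[OF c] order_refl])
qed

lemma smooth_atI: "p \<in> U \<Longrightarrow> SF U h \<Longrightarrow> smooth_at M p h"
  unfolding smooth_at_def by blast

lemma smooth_atE:
  assumes "smooth_at M p h" "OP U" "p \<in> U"
  obtains W where "p \<in> W" "W \<subseteq> U" "SF W h" "OP W"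
proof -
  from assms(1) obtain W where W: "p \<in> W" "SF W h" unfolding smooth_at_def by blast
  have "OP (W \<inter> U)" using OP_Int[OF SF_openin[OF W(2)] assms(2)] .
  from that[of "W \<inter> U", OF _ _ SF_subset[OF W(2) this] this] W(1) assms(3) show ?thesis by blast
qed

lemma smooth_at_points: "smooth_at M p h \<Longrightarrow> p \<in> points M"
  unfolding smooth_at_def using SF_openin openin_subset by blast

lemma smooth_at_binary:
  assumes "smooth_at M p h" "smooth_at M p k"
  obtains W where "p \<in> W" "OP W" "SF W h" "SF W k"
proof -
  have "OP (points M)" by blast
  then obtain W where W: "p \<in> W" "SF W h" "OP W"
    by (rule smooth_atE[OF assms(1) _ smooth_at_points[OF assms(1)]])
  obtain W' where W': "p \<in> W'" "W' \<subseteq> W" "SF W' k" "OP W'"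
    by (rule smooth_atE[OF assms(2) W(3,1)])
  show ?thesis
    using that[OF W'(1,4) SF_subset[OF W(2) W'(4,2)] W'(3)] .
qed

lemma smooth_at_const: "p \<in> points M \<Longrightarrow> smooth_at M p (\<lambda>q. c)"
  using smooth_atI[of p "points M"] SF_const by auto

lemma smooth_at_add: "smooth_at M p h \<Longrightarrow> smooth_at M p k \<Longrightarrow> smooth_at M p (\<lambda>q. h q + k q)"
  by (erule (1) smooth_at_binary) (blast intro: smooth_atI SF_add)

lemma smooth_at_mult: "smooth_at M p h \<Longrightarrow> smooth_at M p k \<Longrightarrow> smooth_at M p (\<lambda>q. h q * k q)"
  by (erule (1) smooth_at_binary) (blast intro: smooth_atI SF_mult)

lemma smooth_at_cmult: "smooth_at M p h \<Longrightarrow> smooth_at M p (\<lambda>q. c * h q)"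
  using smooth_at_mult[OF smooth_at_const[OF smooth_at_points]] by blast

lemma smooth_at_sum:
  "p \<in> points M \<Longrightarrow> (\<And>i. i \<in> I \<Longrightarrow> smooth_at M p (h i)) \<Longrightarrow> smooth_at M p (\<lambda>q. \<Sum>i\<in>I. h i q)"
  by (induction I rule: infinite_finite_induct) (auto intro: smooth_at_const smooth_at_add)

lemma smooth_at_local:
  assumes "smooth_at M p h" "OP W" "p \<in> W" "\<And>q. q \<in> W \<Longrightarrow> h q = k q"
  shows "smooth_at M p k"
proof -
  obtain U where "p \<in> U" "U \<subseteq> W" "SF U h" by (rule smooth_atE[OF assms(1-3)])
  then show ?thesis using smooth_atI[OF _ SF_cong[of U h k]] assms(4) by blast
qed

section \<open>Tangent vectors as derivations: locality and linearity\<close>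

lemma
  assumes "v \<in> TS p"
  shows TS_nonsmooth: "\<not> smooth_at M p h \<Longrightarrow> v h = 0"
    and TS_add: "smooth_at M p h \<Longrightarrow> smooth_at M p k \<Longrightarrow> v (\<lambda>q. h q + k q) = v h + v k"
    and TS_cmult: "smooth_at M p h \<Longrightarrow> v (\<lambda>q. c * h q) = c * v h"
    and TS_mult: "smooth_at M p h \<Longrightarrow> smooth_at M p k \<Longrightarrow> v (\<lambda>q. h q * k q) = v h * k p + h p * v k"
  using assms unfolding tangent_space_def by blast+

lemma TS_const:
  assumes "v \<in> TS p" "p \<in> points M"
  shows "v (\<lambda>q. c) = 0"
proof -
  have "v (\<lambda>q. 1) = 0"
    using TS_mult[OF assms(1) smooth_at_const[OF assms(2)] smooth_at_const[OF assms(2)], of 1 1] by simp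
  then show ?thesis
    using TS_cmult[OF assms(1) smooth_at_const[OF assms(2)], of c 1] by simp
qed

text \<open>Multiplying by the indicator function of a neighbourhood of \<open>p\<close>, which is smooth at \<open>p\<close>,
  replaces the usual bump functions.\<close>

lemma SF_indicator: "OP W \<Longrightarrow> SF W (\<lambda>q. if q \<in> W then 1 else 0)"
  by (rule SF_cong[OF SF_const[of W 1]]) auto

text \<open>The indicator is idempotent and has value 1 at \<open>p\<close>, so by the Leibniz rule
  its derivative equals twice itself.\<close>

lemma TS_indicator:
  assumes "v \<in> TS p" "OP W" "p \<in> W"
  shows "v (\<lambda>q. if q \<in> W then 1 else 0) = 0"
proof -
  have s: "smooth_at M p (\<lambda>q. if q \<in> W then 1 else 0)"
    using smooth_atI[OF assms(3) SF_indicator[OF assms(2)]] .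
  have "v (\<lambda>q. (if q \<in> W then 1 else 0) * (if q \<in> W then 1 else 0)) = 2 * v (\<lambda>q. if q \<in> W then 1 else 0)"
    using TS_mult[OF assms(1) s s] assms(3) by simp
  moreover have "(\<lambda>q. (if q \<in> W then 1 else 0::real) * (if q \<in> W then 1 else 0)) = (\<lambda>q. if q \<in> W then 1 else 0)"
    by auto
  ultimately show ?thesis by simp
qed

text \<open>After multiplication by the indicator of \<open>W\<close> the two functions agree
  everywhere, and by the Leibniz rule this changes neither derivative. If one function is not smooth
  at \<open>p\<close>, neither is the other, and both values are the default 0.\<close>

lemma TS_local:
  assumes v: "v \<in> TS p" and W: "OP W" "p \<in> W" and eq: "\<And>q. q \<in> W \<Longrightarrow> h q = k q"
  shows "v h = v k"
proof (cases "smooth_at M p h")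
  case True
  then have k: "smooth_at M p k" using smooth_at_local W eq by blast
  let ?\<chi> = "\<lambda>q. if q \<in> W then 1 else 0 :: real"
  have s: "smooth_at M p ?\<chi>"
    using smooth_atI[OF W(2) SF_indicator[OF W(1)]] .
  have "v h = v (\<lambda>q. ?\<chi> q * h q)" "v k = v (\<lambda>q. ?\<chi> q * k q)"
    using TS_mult[OF v s True] TS_mult[OF v s k] TS_indicator[OF v W] W(2) by simp_all
  moreover have "(\<lambda>q. ?\<chi> q * h q) = (\<lambda>q. ?\<chi> q * k q)"
    using eq by auto
  ultimately show ?thesis by metis
next
  case False
  then have "\<not> smooth_at M p k" using smooth_at_local[of p k W h] W eq by metis
  then show ?thesis using False TS_nonsmooth[OF v] by simp
qed

lemma TS_minus: "v \<in> TS p \<Longrightarrow> smooth_at M p h \<Longrightarrow> v (\<lambda>q. - h q) = - v h"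
  using TS_cmult[of v p h "-1"] by simp

lemma smooth_at_minus: "smooth_at M p h \<Longrightarrow> smooth_at M p (\<lambda>q. - h q)"
  using smooth_at_cmult[of p h "-1"] by simp

lemma TS_diff: "v \<in> TS p \<Longrightarrow> smooth_at M p h \<Longrightarrow> smooth_at M p k \<Longrightarrow> v (\<lambda>q. h q - k q) = v h - v k"
  using TS_add[of v p h "\<lambda>q. - k q"] smooth_at_minus TS_minus by simp

lemma TS_sum:
  assumes "v \<in> TS p" "p \<in> points M" "\<And>i. i \<in> I \<Longrightarrow> smooth_at M p (h i)"
  shows "v (\<lambda>q. \<Sum>i\<in>I. h i q) = (\<Sum>i\<in>I. v (h i))"
  using assms(3)
proof (induction I rule: infinite_finite_induct)
  case (insert i I)
  then show ?case
    using TS_add[OF assms(1) _ smooth_at_sum[OF assms(2)], of "h i" I h] by simp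
qed (use TS_const[OF assms(1,2)] in auto)

lemma TS_add_closed: "v \<in> TS p \<Longrightarrow> w \<in> TS p \<Longrightarrow> v + w \<in> TS p"
  unfolding tangent_space_def by (auto simp: algebra_simps)

lemma TS_scale_closed: "v \<in> TS p \<Longrightarrow> c *\<^sub>t v \<in> TS p"
  unfolding tangent_space_def by (auto simp: algebra_simps)

lemma TS_zero_closed: "0 \<in> TS p"
  unfolding tangent_space_def by auto

lemma TS_minus_closed: "v \<in> TS p \<Longrightarrow> - v \<in> TS p"
  unfolding tangent_space_def by (auto simp: algebra_simps)

lemma TS_diff_closed: "v \<in> TS p \<Longrightarrow> w \<in> TS p \<Longrightarrow> v - w \<in> TS p"
  unfolding tangent_space_def by (auto simp: algebra_simps)

lemma TS_sum_closed: "(\<And>i. i \<in> I \<Longrightarrow> v i \<in> TS p) \<Longrightarrow> (\<Sum>i\<in>I. v i) \<in> TS p"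
  by (induction I rule: infinite_finite_induct) (auto intro: TS_zero_closed TS_add_closed)

section \<open>Coordinate vectors and the basis they form\<close>

lemma smooth_at_chart:
  assumes "smooth_at M p h" "(V, \<phi>) \<in> charts M" "p \<in> V"
  obtains r where "r > 0" "ball (\<phi> p) r \<subseteq> \<phi> ` V" "smooth_on (ball (\<phi> p) r) (\<lambda>x. h (inv_into V \<phi> x))"
proof -
  obtain W where W: "p \<in> W" "W \<subseteq> V" "SF W h" "OP W"
    using smooth_atE[OF assms(1) chart_openin[OF assms(2)] assms(3)] .
  have "open (\<phi> ` W)" using chart_open_image[OF assms(2)] W by blast
  then obtain r where r: "r > 0" "ball (\<phi> p) r \<subseteq> \<phi> ` W"
    using W(1) open_contains_ball by blast
  have "smooth_on (ball (\<phi> p) r) (\<lambda>x. h (inv_into V \<phi> x))"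
    by (rule smooth_on_subset[OF SF_chart[OF W(3) assms(2)]]) (use r W in blast)
  then show ?thesis using that r W(2) by blast
qed

lemma coord_field_apply:
  "smooth_at M p h \<Longrightarrow> CF (V, \<phi>) b p h = frechet_derivative (\<lambda>x. h (inv_into V \<phi> x)) (at (\<phi> p)) b"
  by (simp add: coord_field_def o_def)

lemma smooth_at_chart_derivative:
  assumes "smooth_at M p h" "(V, \<phi>) \<in> charts M" "p \<in> V"
  shows "((\<lambda>x. h (inv_into V \<phi> x)) has_derivative (\<lambda>b. CF (V, \<phi>) b p h)) (at (\<phi> p))"
proof -
  obtain r where "r > 0" "smooth_on (ball (\<phi> p) r) (\<lambda>x. h (inv_into V \<phi> x))"
    by (rule smooth_at_chart[OF assms])
  then show ?thesis
    unfolding coord_field_apply[OF assms(1)]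
    using smooth_on_has_derivative[of "ball (\<phi> p) r" _ "\<phi> p"] by simp
qed

lemma coord_field_eqI:
  assumes "smooth_at M p h" "((\<lambda>x. h (inv_into V \<phi> x)) has_derivative D) (at (\<phi> p))"
  shows "CF (V, \<phi>) b p h = D b"
  using coord_field_apply[OF assms(1), of V \<phi> b] frechet_derivative_at[OF assms(2)] by simp

lemma coord_field_TS:
  assumes c: "(V, \<phi>) \<in> charts M" and p: "p \<in> V"
  shows "CF (V, \<phi>) b p \<in> TS p"
  unfolding tangent_space_def
proof (intro CollectI conjI allI impI)
  fix h k a
  show "CF (V, \<phi>) b p h = 0" if "\<not> smooth_at M p h"
    using that by (simp add: coord_field_def)
  show "CF (V, \<phi>) b p (\<lambda>q. a * h q) = a * CF (V, \<phi>) b p h" if h: "smooth_at M p h"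
    by (rule coord_field_eqI[OF smooth_at_cmult[OF h]])
      (rule has_derivative_mult_right[OF smooth_at_chart_derivative[OF h c p]])
  assume "smooth_at M p h \<and> smooth_at M p k"
  then have h: "smooth_at M p h" and k: "smooth_at M p k" by auto
  show "CF (V, \<phi>) b p (\<lambda>q. h q + k q) = CF (V, \<phi>) b p h + CF (V, \<phi>) b p k"
    by (rule coord_field_eqI[OF smooth_at_add[OF h k]])
      (rule has_derivative_add[OF smooth_at_chart_derivative[OF h c p] smooth_at_chart_derivative[OF k c p]])
  have "((\<lambda>x. h (inv_into V \<phi> x) * k (inv_into V \<phi> x)) has_derivative
    (\<lambda>b. h (inv_into V \<phi> (\<phi> p)) * CF (V, \<phi>) b p k + CF (V, \<phi>) b p h * k (inv_into V \<phi> (\<phi> p)))) (at (\<phi> p))"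
    by (rule has_derivative_mult[OF smooth_at_chart_derivative[OF h c p] smooth_at_chart_derivative[OF k c p]])
  from coord_field_eqI[OF smooth_at_mult[OF h k] this, of b]
  show "CF (V, \<phi>) b p (\<lambda>q. h q * k q) = CF (V, \<phi>) b p h * k p + h p * CF (V, \<phi>) b p k"
    using c p by simp
qed

lemma smooth_at_coord_fun:
  assumes c: "(V, \<phi>) \<in> charts M" and p: "p \<in> V"
  shows "smooth_at M p (coord_fun (V, \<phi>) b)"
  using smooth_atI[OF p SF_coord_fun[OF c]] .

lemma coord_field_coord_fun:
  assumes c: "(V, \<phi>) \<in> charts M" and p: "p \<in> V" and "a \<in> Basis" "b \<in> Basis"
  shows "CF (V, \<phi>) a p (coord_fun (V, \<phi>) b) = (if a = b then 1 else 0)"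
proof -
  have o: "open (\<phi> ` V)" using chart_open_image[OF c chart_openin[OF c]] by simp
  have "((\<lambda>x. coord_fun (V, \<phi>) b (inv_into V \<phi> x)) has_derivative (\<lambda>a. a \<bullet> b)) (at (\<phi> p))"
    by (rule has_derivative_transform_within_open[OF
          bounded_linear_imp_has_derivative[OF bounded_linear_inner_left] o])
      (use c p in \<open>auto simp: coord_fun_def\<close>)
  from coord_field_eqI[OF smooth_at_coord_fun[OF c p] this, of a] show ?thesis
    using assms(3,4) by (simp add: inner_Basis)
qed

text \<open>Hadamard's lemma writes \<open>h\<close> near \<open>p\<close> as its value plus a sum
  of products of \<open>x\<^sup>b - x\<^sup>b(p)\<close> with smooth factors. The first factors
  vanish at \<open>p\<close>, so the Leibniz rule keeps only the values of the second ones at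
  \<open>p\<close>, which are the partial derivatives of \<open>h\<close>.\<close>

lemma TS_expand_apply:
  assumes v: "v \<in> TS p" and c: "(V, \<phi>) \<in> charts M" and p: "p \<in> V" and h: "smooth_at M p h"
  shows "v h = (\<Sum>b\<in>Basis. v (coord_fun (V, \<phi>) b) * CF (V, \<phi>) b p h)"
proof -
  let ?F = "\<lambda>x. h (inv_into V \<phi> x)"
  have pM: "p \<in> points M" using smooth_at_points[OF h] .
  obtain r where r: "r > 0" "ball (\<phi> p) r \<subseteq> \<phi> ` V" "smooth_on (ball (\<phi> p) r) ?F"
    using smooth_at_chart[OF h c p] .
  let ?B = "ball (\<phi> p) r"
  have cp: "\<phi> p \<in> ?B" using r(1) by simp
  obtain G where G: "\<And>b. smooth_on ?B (G b)"
    "\<And>x. x \<in> ?B \<Longrightarrow> ?F x = ?F (\<phi> p) + (\<Sum>b\<in>Basis. ((x - \<phi> p) \<bullet> b) * G b x)"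
    "\<And>b. G b (\<phi> p) = frechet_derivative ?F (at (\<phi> p)) b"
    using hadamard[OF open_ball convex_ball cp r(3)] by blast
  define W where "W = {q\<in>V. \<phi> q \<in> ?B}"
  have W: "OP W" "p \<in> W" "W \<subseteq> V"
    using chart_open_vimage[OF c open_ball] r(1) p by (auto simp: W_def)
  have im: "\<phi> ` W = ?B" using r(2) by (auto simp: W_def)
  have SG: "SF W (\<lambda>q. G b (\<phi> q))" for b
  proof (rule SFI_chart[OF c W(1,3)])
    show "smooth_on (\<phi> ` W) (\<lambda>x. G b (\<phi> (inv_into V \<phi> x)))"
      unfolding im
      by (rule smooth_on_cong[OF open_ball _ G(1)[of b]])
        (use r(2) in \<open>auto simp: f_inv_into_f subset_iff\<close>)
  qed
  let ?x = "\<lambda>b. coord_fun (V, \<phi>) b"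
  have sx: "smooth_at M p (\<lambda>q. ?x b q - ?x b p)" for b
    using smooth_at_add[OF smooth_at_coord_fun[OF c p] smooth_at_const[OF pM, of "- ?x b p"], of b] by simp
  have vx: "v (\<lambda>q. ?x b q - ?x b p) = v (?x b)" for b
    using TS_diff[OF v smooth_at_coord_fun[OF c p] smooth_at_const[OF pM]] TS_const[OF v pM] by simp
  have sG: "smooth_at M p (\<lambda>q. G b (\<phi> q))" for b
    using smooth_atI[OF W(2) SG] .
  let ?e = "\<lambda>b q. (?x b q - ?x b p) * G b (\<phi> q)"
  have se: "smooth_at M p (?e b)" for b
    using smooth_at_mult[OF sx sG] .
  have "v h = v (\<lambda>q. h p + (\<Sum>b\<in>Basis. (?x b q - ?x b p) * G b (\<phi> q)))"
  proof (rule TS_local[OF v W(1,2)])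
    fix q assume "q \<in> W"
    then have "q \<in> V" "\<phi> q \<in> ?B" by (auto simp: W_def)
    with G(2)[of "\<phi> q"] c p show "h q = h p + (\<Sum>b\<in>Basis. (?x b q - ?x b p) * G b (\<phi> q))"
      by (simp add: coord_fun_def inner_diff_left)
  qed
  also have "\<dots> = (\<Sum>b\<in>Basis. v (\<lambda>q. (?x b q - ?x b p) * G b (\<phi> q)))"
    using TS_add[OF v smooth_at_const[OF pM] smooth_at_sum[OF pM, where I = Basis and h = ?e, OF se]]
      TS_const[OF v pM] TS_sum[OF v pM, where I = Basis and h = ?e, OF se] by simp
  also have "\<dots> = (\<Sum>b\<in>Basis. v (?x b) * CF (V, \<phi>) b p h)"
    using TS_mult[OF v sx sG] vx G(3) coord_field_apply[OF h] by simp
  finally show ?thesis .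
qed

lemma TS_expand:
  assumes v: "v \<in> TS p" and c: "(V, \<phi>) \<in> charts M" and p: "p \<in> V"
  shows "v = (\<Sum>b\<in>Basis. v (coord_fun (V, \<phi>) b) *\<^sub>t CF (V, \<phi>) b p)"
proof
  fix h
  show "v h = (\<Sum>b\<in>Basis. v (coord_fun (V, \<phi>) b) *\<^sub>t CF (V, \<phi>) b p) h"
    using TS_expand_apply[OF assms, of h] TS_nonsmooth[OF v, of h]
      TS_nonsmooth[OF coord_field_TS[OF c p], of h]
    by (cases "smooth_at M p h") (simp_all add: sum_fun_apply)
qed

lemma TS_eqI:
  assumes "v \<in> TS p" "w \<in> TS p" "(V, \<phi>) \<in> charts M" "p \<in> V"
    "\<And>b. b \<in> Basis \<Longrightarrow> v (coord_fun (V, \<phi>) b) = w (coord_fun (V, \<phi>) b)"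
  shows "v = w"
  using TS_expand[OF assms(1,3,4)] TS_expand[OF assms(2,3,4)] assms(5) by simp

lemma coord_field_SF:
  assumes c: "(V, \<phi>) \<in> charts M" and W: "SF W h" "W \<subseteq> V"
  shows "SF W (\<lambda>p. CF (V, \<phi>) b p h)"
proof (rule SFI_chart[OF c SF_openin[OF W(1)] W(2)])
  have o: "open (\<phi> ` W)" using chart_open_image[OF c SF_openin[OF W(1)] W(2)] .
  have "W \<inter> V = W" using W(2) by blast
  then have "smooth_on (\<phi> ` W) (\<lambda>x. frechet_derivative (\<lambda>x. h (inv_into V \<phi> x)) (at x) b)"
    using smooth_on_frechet_derivative[OF SF_chart[OF W(1) c]] by simp
  then show "smooth_on (\<phi> ` W) (\<lambda>x. CF (V, \<phi>) b (inv_into V \<phi> x) h)"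
    by (rule smooth_on_cong[OF o, rotated])
      (use c W(2) coord_field_apply[OF smooth_atI[OF _ W(1)], of _ V \<phi> b] in \<open>auto simp: subset_iff\<close>)
qed

end

section \<open>Vector fields\<close>

context smanifold
begin

lemma
  assumes "VF U X"
  shows VF_openin: "OP U" and VF_TS: "\<And>p. p \<in> U \<Longrightarrow> X p \<in> TS p"
    and VF_SF: "\<And>W h. SF W h \<Longrightarrow> W \<subseteq> U \<Longrightarrow> SF W (\<lambda>p. X p h)"
  using assms unfolding vector_field_def by blast+

lemma VF_subset: "VF U X \<Longrightarrow> OP W \<Longrightarrow> W \<subseteq> U \<Longrightarrow> VF W X"
  unfolding vector_field_def by blast

lemma VF_local:
  assumes "OP U" "\<And>p. p \<in> U \<Longrightarrow> \<exists>W. p \<in> W \<and> VF W X"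
  shows "VF U X"
  unfolding vector_field_def
proof (intro conjI ballI allI impI)
  show "OP U" by fact
  show "X p \<in> TS p" if "p \<in> U" for p
    using assms(2)[OF that] VF_TS by blast
  fix W h assume W: "W \<subseteq> U \<and> SF W h"
  show "SF W (\<lambda>p. X p h)"
  proof (rule SF_local)
    show "OP W" using W SF_openin by blast
    fix p assume "p \<in> W"
    with W assms(2) obtain W' where W': "p \<in> W'" "VF W' X" by blast
    have "OP (W \<inter> W')" using OP_Int SF_openin VF_openin W W' by blast
    then have "SF (W \<inter> W') (\<lambda>p. X p h)"
      using VF_SF[OF W'(2)] SF_subset[of W h "W \<inter> W'"] W by blast
    then show "\<exists>W. p \<in> W \<and> SF W (\<lambda>p. X p h)" using \<open>p \<in> W\<close> W'(1) by blast
  qed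
qed

lemma VF_add: "VF U X \<Longrightarrow> VF U Y \<Longrightarrow> VF U (X + Y)"
  unfolding vector_field_def by (simp add: TS_add_closed SF_add)

lemma VF_scale: "SF U h \<Longrightarrow> VF U X \<Longrightarrow> VF U (h *\<^sub>v X)"
  unfolding vector_field_def
  by (auto simp: TS_scale_closed intro!: SF_mult) (metis SF_openin SF_subset)

lemma VF_diff: "VF U X \<Longrightarrow> VF U Y \<Longrightarrow> VF U (X - Y)"
  unfolding vector_field_def by (simp add: TS_diff_closed SF_diff)

lemma VF_zero: "OP U \<Longrightarrow> VF U 0"
  unfolding vector_field_def by (auto simp: TS_zero_closed intro: SF_const dest: SF_openin)

lemma VF_sum: "OP U \<Longrightarrow> (\<And>i. i \<in> I \<Longrightarrow> VF U (X i)) \<Longrightarrow> VF U (\<Sum>i\<in>I. X i)"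
  by (induction I rule: infinite_finite_induct) (auto intro: VF_zero VF_add)

text \<open>By the basis expansion \<open>X h\<close> is a combination of the coordinate components
  of \<open>X\<close> and the partial derivatives of \<open>h\<close>, so smooth components
  suffice.\<close>

lemma VF_chartI:
  assumes c: "(V, \<phi>) \<in> charts M" and U: "OP U" "U \<subseteq> V"
    and X: "\<And>p. p \<in> U \<Longrightarrow> X p \<in> TS p" "\<And>b. b \<in> Basis \<Longrightarrow> SF U (\<lambda>p. X p (coord_fun (V, \<phi>) b))"
  shows "VF U X"
  unfolding vector_field_def
proof (intro conjI ballI allI impI)
  show "OP U" "p \<in> U \<Longrightarrow> X p \<in> TS p" for p by fact+
  fix W h assume W: "W \<subseteq> U \<and> SF W h"
  then have o: "OP W" using SF_openin by blast
  have "SF W (\<lambda>p. \<Sum>b\<in>Basis. X p (coord_fun (V, \<phi>) b) * CF (V, \<phi>) b p h)"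
    using W U by (intro SF_sum o SF_mult SF_subset[OF X(2)] coord_field_SF[OF c]) auto
  then show "SF W (\<lambda>p. X p h)"
    by (rule SF_cong)
      (use W U TS_expand_apply[OF X(1) c, of _ h] smooth_atI in \<open>auto simp: subset_iff\<close>)
qed

lemma VF_coord_field: "(V, \<phi>) \<in> charts M \<Longrightarrow> VF V (CF (V, \<phi>) b)"
  unfolding vector_field_def
  using chart_openin coord_field_TS coord_field_SF by blast

lemma VF_apply_coord_fun:
  "VF U X \<Longrightarrow> (V, \<phi>) \<in> charts M \<Longrightarrow> U \<subseteq> V \<Longrightarrow> SF U (\<lambda>p. X p (coord_fun (V, \<phi>) b))"
  using VF_SF SF_subset[OF SF_coord_fun] VF_openin by blast

text \<open>A combination of coordinate fields with constant coefficients. It is used near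
  \<open>p\<close> only, which is enough because connections act on fields over arbitrary open
  sets.\<close>

lemma VF_extend:
  assumes "v \<in> TS p" "p \<in> U" "OP U"
  obtains W X where "VF W X" "p \<in> W" "W \<subseteq> U" "X p = v"
proof -
  obtain V \<phi> where c: "(V, \<phi>) \<in> charts M" "p \<in> V"
    using chart_cover assms openin_subset by blast
  let ?X = "\<Sum>b\<in>Basis. (\<lambda>q. v (coord_fun (V, \<phi>) b)) *\<^sub>v CF (V, \<phi>) b"
  have o: "OP (U \<inter> V)" using OP_Int[OF assms(3) chart_openin[OF c(1)]] .
  have "VF V ?X"
    by (intro VF_sum VF_scale SF_const chart_openin[OF c(1)] VF_coord_field[OF c(1)])
  moreover have "?X p = v"
    using TS_expand[OF assms(1) c] by (simp add: sum_fun_apply)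
  ultimately show ?thesis
    using that[of "U \<inter> V" ?X] VF_subset[of V ?X "U \<inter> V"] o assms(2) c(2) by blast
qed

section \<open>Lie brackets, and expansion of tensors in a chart\<close>

abbreviation "LB \<equiv> lie_bracket M"

lemma lie_bracket_apply: "p \<in> W \<Longrightarrow> SF W h \<Longrightarrow> LB X Y p h = X p (\<lambda>q. Y q h) - Y p (\<lambda>q. X q h)"
  using smooth_atI[of p W h] by (simp add: lie_bracket_def)

lemma lie_bracket_anti: "LB X Y = - LB Y X"
  by (auto simp: lie_bracket_def fun_eq_iff)

lemma TS_eqI_SF:
  assumes "v \<in> TS p" "w \<in> TS p" "OP U" "p \<in> U"
    and "\<And>W h. p \<in> W \<Longrightarrow> W \<subseteq> U \<Longrightarrow> SF W h \<Longrightarrow> v h = w h"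
  shows "v = w"
proof
  fix h
  show "v h = w h"
  proof (cases "smooth_at M p h")
    case True
    obtain W where "p \<in> W" "W \<subseteq> U" "SF W h" "OP W"
      by (rule smooth_atE[OF True assms(3,4)])
    then show ?thesis using assms(5) by blast
  next
    case False
    then show ?thesis using TS_nonsmooth assms(1,2) by metis
  qed
qed

lemma VF_smooth_at: "VF U X \<Longrightarrow> p \<in> U \<Longrightarrow> smooth_at M p h \<Longrightarrow> smooth_at M p (\<lambda>q. X q h)"
  by (erule (1) smooth_atE[OF _ VF_openin]) (auto intro: smooth_atI VF_SF)

text \<open>A commutator of derivations is a derivation: in the Leibniz rule the mixed products such
  as \<open>X h * Y k\<close> occur in both orders and cancel. The rules for the inner derivations
  hold at points of \<open>U\<close> only, hence the repeated passage to a neighbourhood by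
  \<open>TS_local\<close>.\<close>

lemma VF_lie_bracket:
  assumes X: "VF U X" and Y: "VF U Y"
  shows "VF U (LB X Y)"
  unfolding vector_field_def
proof (intro conjI ballI allI impI)
  show U: "OP U" using VF_openin[OF X] .
  show "SF W (\<lambda>p. LB X Y p h)" if "W \<subseteq> U \<and> SF W h" for W h
  proof (rule SF_cong[OF SF_diff])
    show "SF W (\<lambda>p. X p (\<lambda>q. Y q h))" "SF W (\<lambda>p. Y p (\<lambda>q. X q h))"
      using that by (auto intro!: VF_SF[OF X] VF_SF[OF Y])
  qed (use that in \<open>simp add: lie_bracket_apply\<close>)
  fix p assume p: "p \<in> U"
  note Xp = VF_TS[OF X p] and Yp = VF_TS[OF Y p]
  note sX = VF_smooth_at[OF X p] and sY = VF_smooth_at[OF Y p]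
  show "LB X Y p \<in> TS p"
    unfolding tangent_space_def
  proof (intro CollectI conjI allI impI)
    show "LB X Y p h = 0" if "\<not> smooth_at M p h" for h
      using that by (simp add: lie_bracket_def)
    show "LB X Y p (\<lambda>q. c * h q) = c * LB X Y p h" if h: "smooth_at M p h" for c h
    proof -
      obtain W where W: "p \<in> W" "W \<subseteq> U" "SF W h" "OP W" by (rule smooth_atE[OF h U p])
      have "X p (\<lambda>q. Y q (\<lambda>q. c * h q)) = X p (\<lambda>q. c * Y q h)"
        using W by (intro TS_local[OF Xp W(4,1)] TS_cmult[OF VF_TS[OF Y]] smooth_atI) auto
      moreover have "Y p (\<lambda>q. X q (\<lambda>q. c * h q)) = Y p (\<lambda>q. c * X q h)"
        using W by (intro TS_local[OF Yp W(4,1)] TS_cmult[OF VF_TS[OF X]] smooth_atI) auto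
      ultimately show ?thesis
        using TS_cmult[OF Xp sY[OF h]] TS_cmult[OF Yp sX[OF h]] h smooth_at_cmult[OF h]
        by (simp add: lie_bracket_def algebra_simps)
    qed
    fix h k assume "smooth_at M p h \<and> smooth_at M p k"
    then have h: "smooth_at M p h" and k: "smooth_at M p k" by auto
    obtain W0 where W0: "p \<in> W0" "OP W0" "SF W0 h" "SF W0 k" by (rule smooth_at_binary[OF h k])
    define W where "W = W0 \<inter> U"
    have W: "p \<in> W" "OP W" "SF W h" "SF W k" "W \<subseteq> U"
      using W0 p OP_Int[OF W0(2) U] SF_subset[OF W0(3)] SF_subset[OF W0(4)] by (auto simp: W_def)
    have s: "smooth_at M q h" "smooth_at M q k" if "q \<in> W" for q
      using that W smooth_atI by blast+
    have WU: "q \<in> U" if "q \<in> W" for q using W that by blast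
    have "X p (\<lambda>q. Y q (\<lambda>q. h q + k q)) = X p (\<lambda>q. Y q h + Y q k)"
      "Y p (\<lambda>q. X q (\<lambda>q. h q + k q)) = Y p (\<lambda>q. X q h + X q k)"
      by (intro TS_local[OF Xp W(2,1)] TS_local[OF Yp W(2,1)] TS_add[OF VF_TS[OF Y]] TS_add[OF VF_TS[OF X]] s WU,
          assumption+)+
    then show "LB X Y p (\<lambda>q. h q + k q) = LB X Y p h + LB X Y p k"
      using TS_add[OF Xp sY[OF h] sY[OF k]] TS_add[OF Yp sX[OF h] sX[OF k]] h k smooth_at_add[OF h k]
      by (simp add: lie_bracket_def)
    have "X p (\<lambda>q. Y q (\<lambda>q. h q * k q)) = X p (\<lambda>q. Y q h * k q + h q * Y q k)"
      "Y p (\<lambda>q. X q (\<lambda>q. h q * k q)) = Y p (\<lambda>q. X q h * k q + h q * X q k)"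
      by (intro TS_local[OF Xp W(2,1)] TS_local[OF Yp W(2,1)] TS_mult[OF VF_TS[OF Y]] TS_mult[OF VF_TS[OF X]] s WU,
          assumption+)+
    then show "LB X Y p (\<lambda>q. h q * k q) = LB X Y p h * k p + h p * LB X Y p k"
      using TS_add[OF Xp smooth_at_mult[OF sY[OF h] k] smooth_at_mult[OF h sY[OF k]]]
        TS_add[OF Yp smooth_at_mult[OF sX[OF h] k] smooth_at_mult[OF h sX[OF k]]]
        TS_mult[OF Xp sY[OF h] k] TS_mult[OF Xp h sY[OF k]] TS_mult[OF Yp sX[OF h] k] TS_mult[OF Yp h sX[OF k]]
        h k smooth_at_mult[OF h k]
      by (simp add: lie_bracket_def algebra_simps)
  qed
qed

lemma lie_bracket_add_left:
  assumes "VF U X" "VF U X'" "VF U Y" "p \<in> U"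
  shows "LB (X + X') Y p = LB X Y p + LB X' Y p"
proof (rule TS_eqI_SF[OF _ _ VF_openin[OF assms(1)] assms(4)])
  show "LB (X + X') Y p \<in> TS p" "LB X Y p + LB X' Y p \<in> TS p"
    using assms by (auto intro!: TS_add_closed VF_TS[OF VF_lie_bracket] VF_add)
  fix W h assume W: "p \<in> W" "W \<subseteq> U" "SF W h"
  have "Y p (\<lambda>q. X q h + X' q h) = Y p (\<lambda>q. X q h) + Y p (\<lambda>q. X' q h)"
    by (rule TS_add[OF VF_TS[OF assms(3,4)]])
      (use VF_smooth_at assms smooth_atI W in blast)+
  then show "LB (X + X') Y p h = (LB X Y p + LB X' Y p) h"
    by (simp add: lie_bracket_apply[OF W(1,3)])
qed

lemma lie_bracket_scale_left:
  assumes "SF U h" "VF U X" "VF U Y" "p \<in> U"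
  shows "LB (h *\<^sub>v X) Y p = h p *\<^sub>t LB X Y p - Y p h *\<^sub>t X p"
proof (rule TS_eqI_SF[OF _ _ VF_openin[OF assms(2)] assms(4)])
  show "LB (h *\<^sub>v X) Y p \<in> TS p" "h p *\<^sub>t LB X Y p - Y p h *\<^sub>t X p \<in> TS p"
    by (rule VF_TS[OF VF_lie_bracket[OF VF_scale[OF assms(1,2)] assms(3)] assms(4)])
      (intro TS_diff_closed TS_scale_closed VF_TS[OF VF_lie_bracket[OF assms(2,3)]] VF_TS[OF assms(2)] assms(4))
  fix W k assume W: "p \<in> W" "W \<subseteq> U" "SF W k"
  have "Y p (\<lambda>q. h q * X q k) = Y p h * X p k + h p * Y p (\<lambda>q. X q k)"
    by (rule TS_mult[OF VF_TS[OF assms(3,4)]])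
      (use VF_smooth_at assms smooth_atI W in blast)+
  then show "LB (h *\<^sub>v X) Y p k = (h p *\<^sub>t LB X Y p - Y p h *\<^sub>t X p) k"
    by (simp add: lie_bracket_apply[OF W(1,3)] algebra_simps)
qed

text \<open>A tangent vector is determined by its values on the coordinate functions; the coordinate
  fields have constant values on these, so both iterated derivatives vanish.\<close>

lemma lie_bracket_coord_fields:
  assumes c: "(V, \<phi>) \<in> charts M" and p: "p \<in> V" and ab: "a \<in> Basis" "b \<in> Basis"
  shows "LB (CF (V, \<phi>) a) (CF (V, \<phi>) b) p = 0"
proof (rule TS_eqI[OF _ _ c p])
  show "LB (CF (V, \<phi>) a) (CF (V, \<phi>) b) p \<in> TS p" "0 \<in> TS p"
    using VF_TS[OF VF_lie_bracket[OF VF_coord_field[OF c] VF_coord_field[OF c]] p] TS_zero_closed by auto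
  fix d :: 'e assume d: "d \<in> Basis"
  have pM: "p \<in> points M" using chart_openin[OF c] openin_subset p by blast
  have "CF (V, \<phi>) a p (\<lambda>q. CF (V, \<phi>) b q (coord_fun (V, \<phi>) d)) = 0" if "a \<in> Basis" "b \<in> Basis" for a b
  proof -
    have "CF (V, \<phi>) a p (\<lambda>q. CF (V, \<phi>) b q (coord_fun (V, \<phi>) d)) = CF (V, \<phi>) a p (\<lambda>q. if b = d then 1 else 0)"
      using coord_field_coord_fun[OF c _ that(2) d]
      by (intro TS_local[OF coord_field_TS[OF c p] chart_openin[OF c] p]) auto
    then show ?thesis using TS_const[OF coord_field_TS[OF c p] pM] by metis
  qed
  with ab show "LB (CF (V, \<phi>) a) (CF (V, \<phi>) b) p (coord_fun (V, \<phi>) d) = 0 (coord_fun (V, \<phi>) d)"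
    by (simp add: lie_bracket_apply[OF p SF_coord_fun[OF c]])
qed

text \<open>Locality of a tensor comes for free, by scaling with indicator functions.\<close>

lemma tensor_local:
  fixes T :: "'a vfield \<Rightarrow> real"
  assumes scale: "\<And>h X. SF W h \<Longrightarrow> VF W X \<Longrightarrow> T (h *\<^sub>v X) = h p * T X"
    and "p \<in> W" "VF W X" "VF W Y" "\<And>q. q \<in> W \<Longrightarrow> X q = Y q"
  shows "T X = T Y"
proof -
  let ?\<chi> = "\<lambda>q. if q \<in> W then 1 else 0 :: real"
  have "?\<chi> *\<^sub>v X = ?\<chi> *\<^sub>v Y"
    using assms(5) by (auto simp: vscale_def tscale_def fun_eq_iff)
  then show ?thesis
    using scale[OF SF_indicator[OF VF_openin[OF assms(3)]] assms(3)]
      scale[OF SF_indicator[OF VF_openin[OF assms(3)]] assms(4)] assms(2) by simp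
qed

text \<open>The expansion of \<open>X\<close> is valid on \<open>U \<inter> V\<close> only, hence
  linearity is required for fields on smaller neighbourhoods of \<open>p\<close>. As a consequence,
  a function-linear \<open>T\<close> depends on \<open>X p\<close> alone.\<close>

lemma tensor_expand:
  fixes T :: "'a vfield \<Rightarrow> real"
  assumes add: "\<And>W X Y. p \<in> W \<Longrightarrow> W \<subseteq> U \<Longrightarrow> VF W X \<Longrightarrow> VF W Y \<Longrightarrow> T (X + Y) = T X + T Y"
    and scale: "\<And>W h X. p \<in> W \<Longrightarrow> W \<subseteq> U \<Longrightarrow> SF W h \<Longrightarrow> VF W X \<Longrightarrow> T (h *\<^sub>v X) = h p * T X"
    and X: "VF U X" "p \<in> U" and c: "(V, \<phi>) \<in> charts M" "p \<in> V"
  shows "T X = (\<Sum>b\<in>Basis. X p (coord_fun (V, \<phi>) b) * T (CF (V, \<phi>) b))"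
proof -
  define W where "W = U \<inter> V"
  have W: "OP W" "p \<in> W" "W \<subseteq> U" "W \<subseteq> V"
    using OP_Int[OF VF_openin[OF X(1)] chart_openin[OF c(1)]] X c by (auto simp: W_def)
  have XW: "VF W X" using VF_subset[OF X(1) W(1,3)] .
  define Y where "Y b = (\<lambda>q. X q (coord_fun (V, \<phi>) b)) *\<^sub>v CF (V, \<phi>) b" for b
  have cW: "VF W (CF (V, \<phi>) b)" for b
    using VF_subset[OF VF_coord_field[OF c(1)] W(1,4)] .
  have xW: "SF W (\<lambda>q. X q (coord_fun (V, \<phi>) b))" for b
    using VF_apply_coord_fun[OF XW c(1) W(4)] .
  have Y: "VF W (Y b)" for b
    unfolding Y_def by (rule VF_scale[OF xW cW])
  have T0: "T 0 = 0"
    using add[OF W(2,3) VF_zero[OF W(1)] VF_zero[OF W(1)]] by simp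
  have Ts: "finite I \<Longrightarrow> T (sum Y I) = (\<Sum>b\<in>I. T (Y b))" for I
  proof (induction I rule: finite_induct)
    case (insert i I)
    have "T (sum Y (insert i I)) = T (Y i + sum Y I)"
      by (rule arg_cong[of _ _ T, OF sum.insert[OF insert.hyps]])
    also have "\<dots> = T (Y i) + T (sum Y I)"
      by (rule add[OF W(2,3) Y VF_sum[OF W(1) Y]])
    finally show ?case
      unfolding insert.IH sum.insert[OF insert.hyps] .
  qed (simp only: T0 sum.empty)
  have "T X = T (\<Sum>b\<in>Basis. Y b)"
  proof (rule tensor_local[of W T p])
    show "VF W X" "VF W (\<Sum>b\<in>Basis. Y b)" by (fact XW) (intro VF_sum W(1) Y)
    show "X q = (\<Sum>b\<in>Basis. Y b) q" if "q \<in> W" for q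
      using TS_expand[OF VF_TS[OF XW that] c(1)] that W(4) by (simp add: sum_fun_apply subset_iff Y_def)
  qed (use scale[OF W(2,3)] W(2) in auto)
  then show ?thesis
    using Ts[OF finite_Basis] scale[OF W(2,3) xW cW] by (simp add: Y_def)
qed

end

section \<open>Smooth dependence of the solution of a linear system\<close>

text \<open>Formally differentiating \<open>A x (c x) = w x\<close> gives the equation for
  \<open>c'\<close>; the point is that \<open>c\<close> is differentiable at all. The lower bound of
  the injective \<open>A x0\<close> survives, halved, for \<open>A x\<close> near \<open>x0\<close>
  and turns errors in the image into errors of \<open>c\<close>.\<close>

lemma linear_solve_has_derivative:
  fixes A :: "'e::euclidean_space \<Rightarrow> 'n::euclidean_space \<Rightarrow> 'n"
  assumes S: "open S" "x0 \<in> S"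
    and lin: "\<And>x. x \<in> S \<Longrightarrow> linear (A x)"
    and inj: "\<And>v. A x0 v = 0 \<Longrightarrow> v = 0"
    and dA: "\<And>v. ((\<lambda>x. A x v) has_derivative A' v) (at x0)"
    and dw: "(w has_derivative w') (at x0)"
    and eq: "\<And>x. x \<in> S \<Longrightarrow> A x (c x) = w x"
  obtains c' where "(c has_derivative c') (at x0)" "\<And>v. A x0 (c' v) = w' v - A' (c x0) v"
proof -
  have lin0: "linear (A x0)" using lin S by blast
  have "inj (A x0)" using linear_injective_0[OF lin0] inj by blast
  then obtain m where m: "m > 0" "\<And>v. m * norm v \<le> norm (A x0 v)"
    using linear_inj_bounded_below_pos[OF lin0] by blast
  obtain L where L: "linear L" "\<And>y. A x0 (L y) = y"
    using linear_surjective_right_inverse[OF lin0 linear_injective_imp_surjective[OF lin0 \<open>inj (A x0)\<close>]]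
    by (auto simp: fun_eq_iff)
  define r where "r x = w x - A x (c x0)" for x
  define r' where "r' v = w' v - A' (c x0) v" for v
  have dr: "(r has_derivative r') (at x0)"
    unfolding r_def[abs_def] r'_def[abs_def] by (intro has_derivative_diff dw dA)
  define c' where "c' v = L (r' v)" for v
  have blc': "bounded_linear c'"
    unfolding c'_def[abs_def]
    using bounded_linear_compose[OF linear_conv_bounded_linear[THEN iffD1, OF L(1)]
        has_derivative_bounded_linear[OF dr]] .
  define N where "N x = (\<Sum>b\<in>Basis. norm (A x b - A x0 b))" for x
  have N: "norm (A x v - A x0 v) \<le> N x * norm v" if "x \<in> S" for x v
  proof -
    have "A x v - A x0 v = (\<Sum>b\<in>Basis. (v \<bullet> b) *\<^sub>R (A x b - A x0 b))"
      using linear_basis_expansion[OF lin[OF that], of v] linear_basis_expansion[OF lin0, of v]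
      by (simp add: scaleR_diff_right sum_subtractf)
    also have "norm \<dots> \<le> (\<Sum>b\<in>Basis. norm (A x b - A x0 b) * norm v)"
      by (rule sum_norm_le) (simp add: mult.commute mult_right_mono Basis_le_norm)
    finally show ?thesis by (simp add: N_def sum_distrib_right)
  qed
  have "((\<lambda>x. A x b) \<longlongrightarrow> A x0 b) (at x0)" for b
    using has_derivative_continuous[OF dA] by (simp add: continuous_at)
  then have "(N \<longlongrightarrow> (\<Sum>b\<in>(Basis::'n set). norm (A x0 b - A x0 b))) (at x0)"
    unfolding N_def[abs_def] by (intro tendsto_intros)
  then have N0: "(N \<longlongrightarrow> 0) (at x0)" by simp
  have evS: "\<forall>\<^sub>F x in at x0. x \<in> S"
    using S eventually_at_in_open' by blast
  have "\<forall>\<^sub>F x in at x0. N x < m / 2"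
    using order_tendstoD(2)[OF N0, of "m / 2"] m(1) by simp
  then have ev: "\<forall>\<^sub>F x in at x0. norm ((c x - c x0 - c' (x - x0)) /\<^sub>R norm (x - x0)) \<le>
      2 / m * (norm ((r x - r x0 - r' (x - x0)) /\<^sub>R norm (x - x0)) + N x * onorm c')"
    using evS
  proof eventually_elim
    case (elim x)
    let ?h = "x - x0" and ?d = "c x - c x0 - c' (x - x0)"
    have lx: "linear (A x)" using lin elim by blast
    \<comment> \<open>The lower bound is moved from \<open>A x0\<close> to \<open>A x\<close>; the
      price is at most \<open>m / 2\<close> times the same norm and is absorbed on the left.\<close>
    have "m * norm ?d \<le> norm (A x0 ?d)" by (rule m(2))
    also have "\<dots> \<le> norm (A x ?d) + norm (A x ?d - A x0 ?d)"
      by (metis norm_minus_commute norm_triangle_sub)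
    also have "\<dots> \<le> norm (A x ?d) + m / 2 * norm ?d"
      using N[of x ?d] elim mult_right_mono[of "N x" "m / 2" "norm ?d"] by simp
    finally have 1: "m / 2 * norm ?d \<le> norm (A x ?d)" by simp
    have "r x0 = 0" using eq[OF S(2)] by (simp add: r_def)
    then have "A x ?d = (r x - r x0 - r' ?h) - (A x (c' ?h) - A x0 (c' ?h))"
      using eq[OF elim(2)] L(2) by (simp add: linear_diff[OF lx] r_def c'_def)
    then have "norm (A x ?d) \<le> norm (r x - r x0 - r' ?h) + N x * norm (c' ?h)"
      using norm_triangle_ineq4[of "r x - r x0 - r' ?h" "A x (c' ?h) - A x0 (c' ?h)"] N[OF elim(2), of "c' ?h"]
      by simp
    also have "N x * norm (c' ?h) \<le> N x * (onorm c' * norm ?h)"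
      by (intro mult_left_mono onorm[OF blc']) (simp add: N_def sum_nonneg)
    finally have 2: "norm (A x ?d) \<le> norm (r x - r x0 - r' ?h) + N x * onorm c' * norm ?h" by (simp add: mult.assoc)
    have "m / 2 * norm ?d \<le> norm (r x - r x0 - r' ?h) + N x * onorm c' * norm ?h" using 1 2 by linarith
    then have "norm ?d \<le> 2 / m * (norm (r x - r x0 - r' ?h) + N x * onorm c' * norm ?h)"
      using m(1) by (simp add: field_simps)
    then have "norm ?d / norm ?h \<le> 2 / m * (norm (r x - r x0 - r' ?h) + N x * onorm c' * norm ?h) / norm ?h"
      by (intro divide_right_mono) auto
    also have "\<dots> \<le> 2 / m * (norm (r x - r x0 - r' ?h) / norm ?h + N x * onorm c')"
    proof (cases "?h = 0")
      case True
      then show ?thesis using m(1) onorm_pos_le[OF blc'] by (simp add: N_def sum_nonneg)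
    next
      case False
      then show ?thesis by (simp add: field_simps)
    qed
    finally show ?case by (simp add: divide_inverse_commute)
  qed
  have "((\<lambda>x. norm ((r x - r x0 - r' (x - x0)) /\<^sub>R norm (x - x0))) \<longlongrightarrow> 0) (at x0)"
    using dr by (intro tendsto_norm_zero) (simp add: has_derivative_def Lim_ident_at)
  then have "((\<lambda>x. 2 / m * (norm ((r x - r x0 - r' (x - x0)) /\<^sub>R norm (x - x0)) + N x * onorm c')) \<longlongrightarrow>
      2 / m * (0 + 0 * onorm c')) (at x0)"
    by (intro tendsto_intros N0)
  then have "((\<lambda>x. (c x - c x0 - c' (x - x0)) /\<^sub>R norm (x - x0)) \<longlongrightarrow> 0) (at x0)"
    by (intro Lim_null_comparison[OF ev]) simp
  then have "(c has_derivative c') (at x0)"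
    using blc' by (simp add: has_derivative_def Lim_ident_at)
  then show ?thesis
    using that L(2) by (simp add: c'_def r'_def)
qed

text \<open>The columns \<open>u j\<close> of the inverse matrix satisfy a differential equation:
  their derivatives are polynomial in the \<open>u j\<close> and the derivatives of
  \<open>A\<close>. So each order of differentiability yields the next, without
  determinants.\<close>

lemma smooth_on_linear_solve:
  fixes A :: "'e::euclidean_space \<Rightarrow> 'n::euclidean_space \<Rightarrow> 'n"
  assumes S: "open S"
    and lin: "\<And>x. x \<in> S \<Longrightarrow> linear (A x)"
    and inj: "\<And>x v. x \<in> S \<Longrightarrow> A x v = 0 \<Longrightarrow> v = 0"
    and sA: "\<And>v. smooth_on S (\<lambda>x. A x v)" and sw: "smooth_on S w"
    and eq: "\<And>x. x \<in> S \<Longrightarrow> A x (c x) = w x"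
  shows "smooth_on S c"
proof -
  define u where "u i x = inv (A x) i" for i x
  have bij: "bij (A x)" if "x \<in> S" for x
    using linear_injective_0[OF lin[OF that]] inj[OF that] linear_injective_imp_surjective[OF lin[OF that]]
    by (auto simp: bij_def)
  have Au: "A x (u i x) = i" if "x \<in> S" for i x
    unfolding u_def using bij[OF that] by (simp add: bij_is_surj surj_f_inv_f)
  have sol: "y = (\<Sum>j\<in>Basis. (z \<bullet> j) *\<^sub>R u j x)" if "x \<in> S" "A x y = z" for x y z
  proof -
    have "A x (\<Sum>j\<in>Basis. (z \<bullet> j) *\<^sub>R u j x) = z"
      using Au[OF that(1)] lin[OF that(1)] by (simp add: linear_sum linear_cmul euclidean_representation)
    then show ?thesis using that bij[OF that(1)] by (metis bij_is_inj injD)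
  qed
  let ?A' = "\<lambda>l x v. frechet_derivative (\<lambda>x. A x l) (at x) v"
  have du: "(u i has_derivative (\<lambda>v. \<Sum>j\<in>Basis. (- (\<Sum>l\<in>Basis. (u i x \<bullet> l) *\<^sub>R ?A' l x v) \<bullet> j) *\<^sub>R u j x)) (at x)"
    if x: "x \<in> S" for i x
  proof -
    have dA: "((\<lambda>x. A x y) has_derivative (\<lambda>v. \<Sum>l\<in>Basis. (y \<bullet> l) *\<^sub>R ?A' l x v)) (at x)" for y
    proof (rule has_derivative_transform_within_open[OF _ S x])
      show "((\<lambda>x. \<Sum>l\<in>Basis. (y \<bullet> l) *\<^sub>R A x l) has_derivative (\<lambda>v. \<Sum>l\<in>Basis. (y \<bullet> l) *\<^sub>R ?A' l x v)) (at x)"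
        by (intro has_derivative_sum has_derivative_scaleR_right smooth_on_has_derivative[OF sA x])
      show "(\<Sum>l\<in>Basis. (y \<bullet> l) *\<^sub>R A x l) = A x y" if "x \<in> S" for x
        using linear_basis_expansion[OF lin[OF that], of y] by simp
    qed
    obtain c' where c': "(u i has_derivative c') (at x)"
      "\<And>v. A x (c' v) = 0 - (\<Sum>l\<in>Basis. (u i x \<bullet> l) *\<^sub>R ?A' l x v)"
      using linear_solve_has_derivative[where A = A and w = "\<lambda>x. i" and c = "u i",
          OF S x lin inj[OF x] dA has_derivative_const Au] by blast
    then have "c' = (\<lambda>v. \<Sum>j\<in>Basis. (- (\<Sum>l\<in>Basis. (u i x \<bullet> l) *\<^sub>R ?A' l x v) \<bullet> j) *\<^sub>R u j x)"
      by (intro ext sol[OF x]) simp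
    with c'(1) show ?thesis by (simp only:)
  qed
  have "Ck_on k S (u i)" for k i
  proof (induction k arbitrary: i)
    case 0
    have "isCont (u i) x" if "x \<in> S" for x
      using has_derivative_continuous[OF du[OF that]] .
    then show ?case by (simp add: continuous_at_imp_continuous_on)
  next
    case (Suc k)
    have sA': "Ck_on k S (\<lambda>x. ?A' l x v)" for l v
      using smooth_on_frechet_derivative[OF sA] by (simp add: smooth_on_def)
    show ?case
      by (rule Ck_on_SucI[OF S du], assumption)
        (intro Ck_on_sum S Ck_on_bilinear[OF S bounded_bilinear_scaleR] Suc sA'
          Ck_on_linear_comp[OF S bounded_linear_inner_left]
          Ck_on_linear_comp[OF S bounded_linear_minus[OF bounded_linear_ident]])
  qed
  then have "smooth_on S (\<lambda>x. \<Sum>j\<in>Basis. (w x \<bullet> j) *\<^sub>R u j x)"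
    using sw unfolding smooth_on_def
    by (intro allI Ck_on_sum S Ck_on_bilinear[OF S bounded_bilinear_scaleR]
        Ck_on_linear_comp[OF S bounded_linear_inner_left]) auto
  then show ?thesis
    by (rule smooth_on_cong[OF S, rotated]) (rule sol[OF _ eq, symmetric])
qed

text \<open>Restricted to the type of vector fields, so that unfolding stops at sums of tangent
  vectors instead of evaluating them on functions.\<close>

lemma vfield_add_apply: "(X + Y) p = X p + Y p" for X Y :: "'a vfield"
  by (rule plus_fun_apply)

section \<open>The Levi-Civita connection\<close>

locale psriem = smanifold M for M :: "('a, 'e::euclidean_space) manifold" +
  fixes g :: "'a metric_tensor"
  assumes metric: "pseudo_riemannian_metric M g"
begin

lemma
  assumes "p \<in> points M"
  shows g_sym: "u \<in> TS p \<Longrightarrow> v \<in> TS p \<Longrightarrow> g p u v = g p v u"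
    and g_add_left: "u \<in> TS p \<Longrightarrow> v \<in> TS p \<Longrightarrow> w \<in> TS p \<Longrightarrow> g p (u + v) w = g p u w + g p v w"
    and g_scale_left: "u \<in> TS p \<Longrightarrow> v \<in> TS p \<Longrightarrow> g p (c *\<^sub>t u) v = c * g p u v"
    and g_nondegenerate: "u \<in> TS p \<Longrightarrow> (\<And>v. v \<in> TS p \<Longrightarrow> g p u v = 0) \<Longrightarrow> u = 0"
proof -
  note m = bspec[OF conjunct1[OF metric[unfolded pseudo_riemannian_metric_def]] assms]
  show "u \<in> TS p \<Longrightarrow> v \<in> TS p \<Longrightarrow> g p u v = g p v u"
    using conjunct1[OF m] by simp
  show "u \<in> TS p \<Longrightarrow> v \<in> TS p \<Longrightarrow> w \<in> TS p \<Longrightarrow> g p (u + v) w = g p u w + g p v w"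
    using conjunct1[OF conjunct2[OF m]] by simp
  show "u \<in> TS p \<Longrightarrow> v \<in> TS p \<Longrightarrow> g p (c *\<^sub>t u) v = c * g p u v"
    using conjunct1[OF conjunct2[OF conjunct2[OF m]]] by simp
  show "u \<in> TS p \<Longrightarrow> (\<And>v. v \<in> TS p \<Longrightarrow> g p u v = 0) \<Longrightarrow> u = 0"
    using conjunct2[OF conjunct2[OF conjunct2[OF m]]] by blast
qed

lemma SF_g: "VF U X \<Longrightarrow> VF U Y \<Longrightarrow> SF U (\<lambda>p. g p (X p) (Y p))"
  using conjunct2[OF metric[unfolded pseudo_riemannian_metric_def]] by blast

lemma
  assumes "p \<in> points M"
  shows g_add_right: "u \<in> TS p \<Longrightarrow> v \<in> TS p \<Longrightarrow> w \<in> TS p \<Longrightarrow> g p w (u + v) = g p w u + g p w v"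
    and g_scale_right: "u \<in> TS p \<Longrightarrow> v \<in> TS p \<Longrightarrow> g p v (c *\<^sub>t u) = c * g p v u"
  using g_sym[OF assms] g_add_left[OF assms] g_scale_left[OF assms] TS_add_closed TS_scale_closed by metis+

lemma tscale_minus_one: "(-1) *\<^sub>t v = - v"
  by (auto simp: tscale_def fun_eq_iff)

lemma g_minus_left: "p \<in> points M \<Longrightarrow> u \<in> TS p \<Longrightarrow> v \<in> TS p \<Longrightarrow> g p (- u) v = - g p u v"
  using g_scale_left[of p u v "-1"] by (simp add: tscale_minus_one)

lemma g_minus_right: "p \<in> points M \<Longrightarrow> u \<in> TS p \<Longrightarrow> v \<in> TS p \<Longrightarrow> g p u (- v) = - g p u v"
  using g_scale_right[of p v u "-1"] by (simp add: tscale_minus_one)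

lemma g_diff_left:
  "p \<in> points M \<Longrightarrow> u \<in> TS p \<Longrightarrow> v \<in> TS p \<Longrightarrow> w \<in> TS p \<Longrightarrow> g p (u - v) w = g p u w - g p v w"
  using g_add_left[of p u "- v" w] g_minus_left[of p v w] TS_minus_closed by simp

lemma g_sum_left:
  assumes "p \<in> points M" "finite I" "\<And>i. i \<in> I \<Longrightarrow> v i \<in> TS p" "w \<in> TS p"
  shows "g p (\<Sum>i\<in>I. v i) w = (\<Sum>i\<in>I. g p (v i) w)"
  using assms(2,3)
proof (induction I rule: finite_induct)
  case empty
  have "g p 0 w = 0" using g_minus_left[OF assms(1) TS_zero_closed assms(4)] by simp
  then show ?case by (simp only: sum.empty)
next
  case (insert i I)
  have "g p (\<Sum>i\<in>insert i I. v i) w = g p (v i + (\<Sum>i\<in>I. v i)) w"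
    unfolding sum.insert[OF insert.hyps] ..
  also have "\<dots> = g p (v i) w + g p (\<Sum>i\<in>I. v i) w"
    using insert.prems assms(1,4) by (intro g_add_left TS_sum_closed) auto
  also have "\<dots> = g p (v i) w + (\<Sum>i\<in>I. g p (v i) w)"
    using insert by simp
  also have "\<dots> = (\<Sum>i\<in>insert i I. g p (v i) w)"
    by (rule sum.insert[OF insert.hyps, symmetric])
  finally show ?case .
qed

lemma g_eqI:
  assumes "p \<in> points M" "u \<in> TS p" "v \<in> TS p" "\<And>w. w \<in> TS p \<Longrightarrow> g p u w = g p v w"
  shows "u = v"
proof -
  have "u - v = 0"
    using assms by (intro g_nondegenerate[OF assms(1)] TS_diff_closed) (simp_all only: g_diff_left diff_self)
  then show ?thesis by simp
qed

lemma g_eqI_VF: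
  assumes "OP U" "p \<in> U" "u \<in> TS p" "v \<in> TS p"
    and "\<And>W Z. p \<in> W \<Longrightarrow> W \<subseteq> U \<Longrightarrow> VF W Z \<Longrightarrow> g p u (Z p) = g p v (Z p)"
  shows "u = v"
proof (rule g_eqI[OF _ assms(3,4)])
  show "p \<in> points M" using assms(1,2) openin_subset by blast
  fix w assume "w \<in> TS p"
  then obtain W Z where "VF W Z" "p \<in> W" "W \<subseteq> U" "Z p = w"
    by (rule VF_extend[OF _ assms(2,1)])
  then show "g p u w = g p v w" using assms(5) by blast
qed

section \<open>The Gram matrix and Riesz representation\<close>

lemma coord_combination_apply:
  assumes "(V, \<phi>) \<in> charts M" "p \<in> V" "a \<in> Basis"
  shows "(\<Sum>b\<in>Basis. (x \<bullet> b) *\<^sub>t CF (V, \<phi>) b p) (coord_fun (V, \<phi>) a) = x \<bullet> a"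
  using assms(3) coord_field_coord_fun[OF assms(1,2)]
  by (simp add: sum_fun_apply if_distrib[of "(*) _"] cong: if_cong)

text \<open>The metric as a linear map of the model space, sending the coordinates of
  \<open>v\<close> to the numbers \<open>g(v, \<partial>\<^sub>a)\<close>; this is the form that
  \<open>smooth_on_linear_solve\<close> works with.\<close>

definition gram :: "('a, 'e) chart \<Rightarrow> 'a \<Rightarrow> 'e \<Rightarrow> 'e" where
  "gram c p x = (\<Sum>a\<in>Basis. (\<Sum>b\<in>Basis. (x \<bullet> b) * g p (CF c b p) (CF c a p)) *\<^sub>R a)"

lemma linear_gram: "linear (gram c p)"
  unfolding gram_def[abs_def]
  by (rule linearI) (simp_all add: inner_add_left algebra_simps sum.distrib scaleR_add_left sum_distrib_left scaleR_sum_right)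

lemma gram_eq:
  assumes c: "(V, \<phi>) \<in> charts M" "p \<in> V" and v: "v \<in> TS p"
  shows "gram (V, \<phi>) p (\<Sum>b\<in>Basis. v (coord_fun (V, \<phi>) b) *\<^sub>R b) =
    (\<Sum>a\<in>Basis. g p v (CF (V, \<phi>) a p) *\<^sub>R a)"
proof -
  have pM: "p \<in> points M" using chart_openin[OF c(1)] c(2) openin_subset by blast
  note T = coord_field_TS[OF c]
  have "g p v (CF (V, \<phi>) a p) = (\<Sum>b\<in>Basis. v (coord_fun (V, \<phi>) b) * g p (CF (V, \<phi>) b p) (CF (V, \<phi>) a p))" for a
  proof -
    have "g p v (CF (V, \<phi>) a p) = g p (\<Sum>b\<in>Basis. v (coord_fun (V, \<phi>) b) *\<^sub>t CF (V, \<phi>) b p) (CF (V, \<phi>) a p)"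
      using TS_expand[OF v c] by (simp only:)
    also have "\<dots> = (\<Sum>b\<in>Basis. g p (v (coord_fun (V, \<phi>) b) *\<^sub>t CF (V, \<phi>) b p) (CF (V, \<phi>) a p))"
      by (intro g_sum_left pM finite_Basis TS_scale_closed T)
    finally show ?thesis by (simp only: g_scale_left[OF pM T T])
  qed
  then show ?thesis
    by (simp add: gram_def inner_sum_left inner_Basis if_distrib[of "(*) _"] cong: if_cong)
qed

lemma coord_combination_TS:
  "(V, \<phi>) \<in> charts M \<Longrightarrow> p \<in> V \<Longrightarrow> (\<Sum>b\<in>Basis. (x \<bullet> b) *\<^sub>t CF (V, \<phi>) b p) \<in> TS p"
  by (intro TS_sum_closed TS_scale_closed coord_field_TS)

lemma gram_combination:
  assumes c: "(V, \<phi>) \<in> charts M" "p \<in> V"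
  shows "gram (V, \<phi>) p x = (\<Sum>a\<in>Basis. g p (\<Sum>b\<in>Basis. (x \<bullet> b) *\<^sub>t CF (V, \<phi>) b p) (CF (V, \<phi>) a p) *\<^sub>R a)"
  using gram_eq[OF c coord_combination_TS[OF c]] coord_combination_apply[OF c]
  by (simp add: euclidean_representation)

lemma g_eqI_chart:
  assumes c: "(V, \<phi>) \<in> charts M" "p \<in> V" and u: "u \<in> TS p" "v \<in> TS p"
    and eq: "\<And>b. b \<in> Basis \<Longrightarrow> g p u (CF (V, \<phi>) b p) = g p v (CF (V, \<phi>) b p)"
  shows "u = v"
proof -
  have pM: "p \<in> points M" using chart_openin[OF c(1)] c(2) openin_subset by blast
  have T: "CF (V, \<phi>) b p \<in> TS p" for b using coord_field_TS[OF c] .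
  have "g p x w = (\<Sum>b\<in>Basis. w (coord_fun (V, \<phi>) b) * g p x (CF (V, \<phi>) b p))" if w: "w \<in> TS p" and x: "x \<in> TS p" for x w
  proof -
    have "g p x w = g p (\<Sum>b\<in>Basis. w (coord_fun (V, \<phi>) b) *\<^sub>t CF (V, \<phi>) b p) x"
      using TS_expand[OF w c] g_sym[OF pM x w] by (simp only:)
    also have "\<dots> = (\<Sum>b\<in>Basis. g p (w (coord_fun (V, \<phi>) b) *\<^sub>t CF (V, \<phi>) b p) x)"
      by (intro g_sum_left pM finite_Basis TS_scale_closed T x)
    finally show ?thesis by (simp only: g_scale_left[OF pM T x] g_sym[OF pM T x])
  qed
  then show ?thesis
    using eq u by (intro g_eqI[OF pM u]) (simp cong: sum.cong)
qed

text \<open>Nondegeneracy of \<open>g\<close>: a kernel vector yields a tangent vector orthogonal to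
  all coordinate vectors, hence 0.\<close>

lemma gram_inj:
  assumes c: "(V, \<phi>) \<in> charts M" "p \<in> V" and x: "gram (V, \<phi>) p x = 0"
  shows "x = 0"
proof -
  let ?v = "\<Sum>b\<in>Basis. (x \<bullet> b) *\<^sub>t CF (V, \<phi>) b p"
  have pM: "p \<in> points M" using chart_openin[OF c(1)] c(2) openin_subset by blast
  have "g p ?v (CF (V, \<phi>) a p) = gram (V, \<phi>) p x \<bullet> a" if "a \<in> Basis" for a
    unfolding gram_combination[OF c] using that
    by (simp only: inner_sum_left_Basis)
  then have "g p ?v (CF (V, \<phi>) a p) = g p 0 (CF (V, \<phi>) a p)" if "a \<in> Basis" for a
    using that x g_minus_left[OF pM TS_zero_closed coord_field_TS[OF c, of a]] by (simp only: inner_zero_left) simp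
  then have v0: "?v = 0"
    by (rule g_eqI_chart[OF c coord_combination_TS[OF c] TS_zero_closed])
  have "x \<bullet> a = 0 \<bullet> a" if "a \<in> Basis" for a
    using coord_combination_apply[OF c that, of x] unfolding v0 by simp
  then show "x = 0" by (rule euclidean_eqI)
qed

text \<open>In finite dimension the injective Gram map is also surjective, which gives the
  coordinates of the representing vector. Gradients and the connection are both obtained in this
  way.\<close>

lemma riesz:
  assumes pM: "p \<in> points M"
    and add: "\<And>u v. u \<in> TS p \<Longrightarrow> v \<in> TS p \<Longrightarrow> \<omega> (u + v) = \<omega> u + \<omega> v"
    and scale: "\<And>c v. v \<in> TS p \<Longrightarrow> \<omega> (c *\<^sub>t v) = c * \<omega> v"
  shows "\<exists>!v. v \<in> TS p \<and> (\<forall>w\<in>TS p. g p v w = \<omega> w)"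
proof (rule ex_ex1I)
  obtain V \<phi> where c: "(V, \<phi>) \<in> charts M" "p \<in> V" using chart_cover[OF pM] by blast
  have T: "CF (V, \<phi>) b p \<in> TS p" for b using coord_field_TS[OF c] .
  have "inj (gram (V, \<phi>) p)"
    using linear_injective_0[OF linear_gram] gram_inj[OF c] by blast
  then have "surj (gram (V, \<phi>) p)"
    using linear_injective_imp_surjective[OF linear_gram] by blast
  then obtain x where x: "gram (V, \<phi>) p x = (\<Sum>a\<in>Basis. \<omega> (CF (V, \<phi>) a p) *\<^sub>R a)" by (metis surjD)
  let ?v = "\<Sum>b\<in>Basis. (x \<bullet> b) *\<^sub>t CF (V, \<phi>) b p"
  have vT: "?v \<in> TS p" using coord_combination_TS[OF c] .
  have vg: "g p ?v (CF (V, \<phi>) a p) = \<omega> (CF (V, \<phi>) a p)" if "a \<in> Basis" for a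
    using arg_cong[OF x, of "\<lambda>y. y \<bullet> a"] that unfolding gram_combination[OF c]
    by (simp only: inner_sum_left_Basis)
  have \<omega>s: "\<omega> (\<Sum>b\<in>I. y b *\<^sub>t CF (V, \<phi>) b p) = (\<Sum>b\<in>I. y b * \<omega> (CF (V, \<phi>) b p))" if "finite I" for y and I :: "'e set"
    using that
  proof (induction I rule: finite_induct)
    case empty
    have "\<omega> (0 + 0) = \<omega> 0 + \<omega> 0" by (intro add TS_zero_closed)
    then have "\<omega> 0 = 0" by simp
    then show ?case by (simp only: sum.empty)
  next
    case (insert i I)
    have "\<omega> (y i *\<^sub>t CF (V, \<phi>) i p + (\<Sum>b\<in>I. y b *\<^sub>t CF (V, \<phi>) b p)) =
        \<omega> (y i *\<^sub>t CF (V, \<phi>) i p) + \<omega> (\<Sum>b\<in>I. y b *\<^sub>t CF (V, \<phi>) b p)"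
      by (intro add TS_sum_closed TS_scale_closed T)
    then show ?case
      using insert.IH scale[OF T]
      unfolding sum.insert[OF insert.hyps] by (simp only:)
  qed
  have "g p ?v w = \<omega> w" if w: "w \<in> TS p" for w
  proof -
    let ?w = "\<Sum>b\<in>Basis. w (coord_fun (V, \<phi>) b) *\<^sub>t CF (V, \<phi>) b p"
    have "g p ?v w = g p ?w ?v"
      using TS_expand[OF w c] g_sym[OF pM vT w] by (simp only:)
    also have "\<dots> = (\<Sum>b\<in>Basis. g p (w (coord_fun (V, \<phi>) b) *\<^sub>t CF (V, \<phi>) b p) ?v)"
      by (intro g_sum_left pM finite_Basis TS_scale_closed T vT)
    also have "\<dots> = (\<Sum>b\<in>Basis. w (coord_fun (V, \<phi>) b) * \<omega> (CF (V, \<phi>) b p))"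
      by (rule sum.cong) (simp_all only: g_scale_left[OF pM T vT] g_sym[OF pM T vT] vg)
    also have "\<dots> = \<omega> ?w" by (rule \<omega>s[OF finite_Basis, symmetric])
    also have "\<dots> = \<omega> w" using TS_expand[OF w c] by (simp only:)
    finally show ?thesis .
  qed
  with vT show "\<exists>v. v \<in> TS p \<and> (\<forall>w\<in>TS p. g p v w = \<omega> w)" by blast
  show "v = v'" if "v \<in> TS p \<and> (\<forall>w\<in>TS p. g p v w = \<omega> w)" "v' \<in> TS p \<and> (\<forall>w\<in>TS p. g p v' w = \<omega> w)" for v v'
    using that by (intro g_eqI[OF pM]) auto
qed

text \<open>The coordinates of \<open>X\<close> solve the Gram system with smooth right hand side,
  so \<open>smooth_on_linear_solve\<close> applies. This is how a field known only through its
  products with other fields is seen to be smooth.\<close>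

lemma VF_riesz:
  assumes U: "OP U" and X: "\<And>p. p \<in> U \<Longrightarrow> X p \<in> TS p"
    and s: "\<And>W Z. W \<subseteq> U \<Longrightarrow> VF W Z \<Longrightarrow> SF W (\<lambda>p. g p (X p) (Z p))"
  shows "VF U X"
proof (rule VF_local[OF U])
  fix p assume p: "p \<in> U"
  then obtain V \<phi> where c: "(V, \<phi>) \<in> charts M" "p \<in> V" using chart_cover openin_subset[OF U] by blast
  define W where "W = U \<inter> V"
  have W: "OP W" "W \<subseteq> U" "W \<subseteq> V" "p \<in> W"
    using OP_Int[OF U chart_openin[OF c(1)]] p c by (auto simp: W_def)
  have WV: "q \<in> V" if "q \<in> W" for q using W that by blast
  have WU: "q \<in> U" if "q \<in> W" for q using W that by blast
  have WM: "q \<in> points M" if "q \<in> W" for q using openin_subset[OF W(1)] that by blast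
  have CW: "VF W (CF (V, \<phi>) b)" for b using VF_subset[OF VF_coord_field[OF c(1)] W(1,3)] .
  have o: "open (\<phi> ` W)" using chart_open_image[OF c(1) W(1,3)] .
  have to_chart: "smooth_on (\<phi> ` W) (\<lambda>x. h (inv_into V \<phi> x))" if "SF W h" for h
    using SF_chart[OF that c(1)] W(3) by (simp add: Int_absorb2)
  let ?c = "\<lambda>x. \<Sum>b\<in>Basis. X (inv_into V \<phi> x) (coord_fun (V, \<phi>) b) *\<^sub>R b"
  have sc: "smooth_on (\<phi> ` W) ?c"
  proof (rule smooth_on_linear_solve[OF o, where A = "\<lambda>x. gram (V, \<phi>) (inv_into V \<phi> x)"
        and w = "\<lambda>x. \<Sum>a\<in>Basis. g (inv_into V \<phi> x) (X (inv_into V \<phi> x)) (CF (V, \<phi>) a (inv_into V \<phi> x)) *\<^sub>R a"])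
    show "linear (gram (V, \<phi>) (inv_into V \<phi> x))" for x by (rule linear_gram)
    show "v = 0" if "x \<in> \<phi> ` W" "gram (V, \<phi>) (inv_into V \<phi> x) v = 0" for x v
      using that gram_inj[OF c(1) WV] c(1) WV by (auto simp only: chart_inv)
    show "smooth_on (\<phi> ` W) (\<lambda>x. gram (V, \<phi>) (inv_into V \<phi> x) v)" for v
      unfolding gram_def
      by (intro smooth_on_sum o smooth_on_linear_comp[OF o bounded_linear_scaleR_left] smooth_on_mult
          smooth_on_const to_chart SF_g CW)
    show "smooth_on (\<phi> ` W) (\<lambda>x. \<Sum>a\<in>Basis. g (inv_into V \<phi> x) (X (inv_into V \<phi> x)) (CF (V, \<phi>) a (inv_into V \<phi> x)) *\<^sub>R a)"
      by (intro smooth_on_sum o smooth_on_linear_comp[OF o bounded_linear_scaleR_left] to_chart s[OF W(2) CW])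
    show "gram (V, \<phi>) (inv_into V \<phi> x) (?c x) =
        (\<Sum>a\<in>Basis. g (inv_into V \<phi> x) (X (inv_into V \<phi> x)) (CF (V, \<phi>) a (inv_into V \<phi> x)) *\<^sub>R a)" if x: "x \<in> \<phi> ` W" for x
    proof -
      obtain q where q: "q \<in> W" "x = \<phi> q" using x by blast
      have "inv_into V \<phi> x = q" unfolding q(2) by (rule chart_inv[OF c(1) WV[OF q(1)]])
      note q = q(1) this
      show ?thesis unfolding q(2) by (rule gram_eq[OF c(1) WV[OF q(1)] X[OF WU[OF q(1)]]])
    qed
  qed
  have "VF W X"
  proof (rule VF_chartI[OF c(1) W(1,3)])
    show "X q \<in> TS q" if "q \<in> W" for q using X[OF WU[OF that]] .
    fix a :: 'e assume a: "a \<in> Basis"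
    have "smooth_on (\<phi> ` W) (\<lambda>x. ?c x \<bullet> a)"
      by (rule smooth_on_linear_comp[OF o bounded_linear_inner_left sc])
    then have "smooth_on (\<phi> ` W) (\<lambda>x. X (inv_into V \<phi> x) (coord_fun (V, \<phi>) a))"
      using a by (simp only: inner_sum_left_Basis)
    then show "SF W (\<lambda>p. X p (coord_fun (V, \<phi>) a))"
      by (rule SFI_chart[OF c(1) W(1,3)])
  qed
  with W show "\<exists>W. p \<in> W \<and> VF W X" by blast
qed

section \<open>Construction of a connection from Koszul's formula\<close>

lemma VF_points: "VF U X \<Longrightarrow> p \<in> U \<Longrightarrow> p \<in> points M"
  using VF_openin openin_subset by blast

lemma deriv_g_sym:
  assumes "v \<in> TS p" "p \<in> U" "VF U Y" "VF U Z"
  shows "v (\<lambda>q. g q (Y q) (Z q)) = v (\<lambda>q. g q (Z q) (Y q))"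
  using assms
  by (intro TS_local[OF assms(1) VF_openin[OF assms(3)] assms(2)] g_sym VF_points VF_TS)

lemma deriv_g_add:
  assumes "v \<in> TS p" "p \<in> U" "VF U Y" "VF U Y'" "VF U Z"
  shows "v (\<lambda>q. g q ((Y + Y') q) (Z q)) = v (\<lambda>q. g q (Y q) (Z q)) + v (\<lambda>q. g q (Y' q) (Z q))"
proof -
  have "v (\<lambda>q. g q ((Y + Y') q) (Z q)) = v (\<lambda>q. g q (Y q) (Z q) + g q (Y' q) (Z q))"
    unfolding vfield_add_apply
    using assms
    by (intro TS_local[OF assms(1) VF_openin[OF assms(3)] assms(2)] g_add_left VF_points VF_TS)
  also have "\<dots> = v (\<lambda>q. g q (Y q) (Z q)) + v (\<lambda>q. g q (Y' q) (Z q))"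
    by (intro TS_add[OF assms(1)] smooth_atI[OF assms(2)] SF_g assms)
  finally show ?thesis .
qed

lemma deriv_g_scale:
  assumes "v \<in> TS p" "p \<in> U" "VF U Y" "VF U Z" "SF U h"
  shows "v (\<lambda>q. g q ((h *\<^sub>v Y) q) (Z q)) = v h * g p (Y p) (Z p) + h p * v (\<lambda>q. g q (Y q) (Z q))"
proof -
  have "v (\<lambda>q. g q ((h *\<^sub>v Y) q) (Z q)) = v (\<lambda>q. h q * g q (Y q) (Z q))"
    unfolding vscale_apply
    using assms
    by (intro TS_local[OF assms(1) VF_openin[OF assms(3)] assms(2)] g_scale_left VF_points VF_TS)
  also have "\<dots> = v h * g p (Y p) (Z p) + h p * v (\<lambda>q. g q (Y q) (Z q))"
    by (intro TS_mult[OF assms(1)] smooth_atI[OF assms(2)] SF_g assms)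
  finally show ?thesis .
qed

text \<open>The right hand side of Koszul's formula: the only possible value of
  \<open>2 * g p (D X Y p) (Z p)\<close> for a Levi-Civita connection \<open>D\<close>.\<close>

definition koszul :: "'a vfield \<Rightarrow> 'a vfield \<Rightarrow> 'a vfield \<Rightarrow> 'a \<Rightarrow> real" where
  "koszul X Y Z p = X p (\<lambda>q. g q (Y q) (Z q)) + Y p (\<lambda>q. g q (X q) (Z q)) - Z p (\<lambda>q. g q (X q) (Y q)) +
     g p (LB X Y p) (Z p) - g p (LB X Z p) (Y p) - g p (LB Y Z p) (X p)"

lemma lie_bracket_anti_apply: "LB X Y p = - LB Y X p"
  by (subst lie_bracket_anti) (rule fun_uminus_apply)

text \<open>The part symmetric in \<open>Y\<close> and \<open>Z\<close> encodes compatibility with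
  the metric, the part antisymmetric in \<open>X\<close> and \<open>Y\<close>, in the next lemma,
  vanishing torsion. Both are recorded for the bare expression, before any connection is
  available.\<close>

lemma koszul_sym_right:
  assumes "VF U X" "VF U Y" "VF U Z" "p \<in> U"
  shows "koszul X Y Z p + koszul X Z Y p = 2 * X p (\<lambda>q. g q (Y q) (Z q))"
proof -
  have pM: "p \<in> points M" using VF_points assms by blast
  show ?thesis
    unfolding koszul_def
    using deriv_g_sym[OF VF_TS[OF assms(1,4)] assms(4,2,3)] lie_bracket_anti_apply[of Z Y p]
      g_minus_left[OF pM VF_TS[OF VF_lie_bracket[OF assms(2,3)] assms(4)] VF_TS[OF assms(1,4)]]
    by simp
qed

lemma koszul_sym_left:
  assumes "VF U X" "VF U Y" "VF U Z" "p \<in> U"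
  shows "koszul X Y Z p - koszul Y X Z p = 2 * g p (LB X Y p) (Z p)"
proof -
  have pM: "p \<in> points M" using VF_points assms by blast
  show ?thesis
    unfolding koszul_def
    using deriv_g_sym[OF VF_TS[OF assms(3,4)] assms(4,1,2)] lie_bracket_anti_apply[of Y X p]
      g_minus_left[OF pM VF_TS[OF VF_lie_bracket[OF assms(1,2)] assms(4)] VF_TS[OF assms(3,4)]]
    by simp
qed

lemma koszul_add:
  assumes "VF U X" "VF U Y" "VF U Z" "VF U Z'" "p \<in> U"
  shows "koszul X Y (Z + Z') p = koszul X Y Z p + koszul X Y Z' p"
proof -
  have pM: "p \<in> points M" using VF_points assms by blast
  note T = VF_TS[OF assms(1,5)] VF_TS[OF assms(2,5)] VF_TS[OF assms(3,5)] VF_TS[OF assms(4,5)]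
  have L: "LB A (Z + Z') p = LB A Z p + LB A Z' p" if "VF U A" for A
    using lie_bracket_add_left[OF assms(3,4) that assms(5)] lie_bracket_anti_apply[of A _ p]
    by simp
  have d: "v (\<lambda>q. g q (A q) ((Z + Z') q)) = v (\<lambda>q. g q (A q) (Z q)) + v (\<lambda>q. g q (A q) (Z' q))"
    if "v \<in> TS p" "VF U A" for A v
    using deriv_g_add[OF that(1) assms(5,3,4) that(2)]
    by (simp only: deriv_g_sym[OF that(1) assms(5) that(2)] VF_add[OF assms(3,4)] assms(3,4))
  have 1: "g p (LB A (Z + Z') p) (B p) = g p (LB A Z p) (B p) + g p (LB A Z' p) (B p)" if "VF U A" "VF U B" for A B
    unfolding L[OF that(1)]
    by (intro g_add_left pM VF_TS[OF VF_lie_bracket[OF that(1) assms(3)] assms(5)]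
        VF_TS[OF VF_lie_bracket[OF that(1) assms(4)] assms(5)] VF_TS[OF that(2) assms(5)])
  have 2: "g p (LB X Y p) ((Z + Z') p) = g p (LB X Y p) (Z p) + g p (LB X Y p) (Z' p)"
    unfolding vfield_add_apply by (intro g_add_right pM VF_TS[OF VF_lie_bracket[OF assms(1,2)] assms(5)] T)
  show ?thesis
    unfolding koszul_def d[OF T(1) assms(2)] d[OF T(2) assms(1)] 1[OF assms(1,2)] 1[OF assms(2,1)] 2
    by simp
qed

text \<open>The derivatives of \<open>h\<close> that come from differentiating \<open>g\<close>
  cancel against those from the brackets. This makes \<open>Z\<close> a tensor argument, so that
  Riesz representation applies.\<close>

lemma koszul_scale:
  assumes "VF U X" "VF U Y" "VF U Z" "SF U h" "p \<in> U"
  shows "koszul X Y (h *\<^sub>v Z) p = h p * koszul X Y Z p"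
proof -
  have pM: "p \<in> points M" using VF_points assms by blast
  note T = VF_TS[OF assms(1,5)] VF_TS[OF assms(2,5)] VF_TS[OF assms(3,5)]
  have L: "LB A (h *\<^sub>v Z) p = h p *\<^sub>t LB A Z p + A p h *\<^sub>t Z p" if "VF U A" for A
    using lie_bracket_scale_left[OF assms(4,3) that assms(5)] lie_bracket_anti_apply[of A _ p]
    by (simp add: fun_eq_iff)
  have d: "v (\<lambda>q. g q (A q) ((h *\<^sub>v Z) q)) = v h * g p (A p) (Z p) + h p * v (\<lambda>q. g q (A q) (Z q))"
    if "v \<in> TS p" "VF U A" for A v
    using deriv_g_scale[OF that(1) assms(5,3) that(2) assms(4)]
    by (simp only: deriv_g_sym[OF that(1) assms(5) that(2)] VF_scale[OF assms(4,3)] assms(3)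
        g_sym[OF pM T(3) VF_TS[OF that(2) assms(5)]])
  have 1: "g p (LB A (h *\<^sub>v Z) p) (B p) = h p * g p (LB A Z p) (B p) + A p h * g p (B p) (Z p)"
    if "VF U A" "VF U B" for A B
  proof -
    note TL = VF_TS[OF VF_lie_bracket[OF that(1) assms(3)] assms(5)] and TB = VF_TS[OF that(2) assms(5)]
    have "g p (LB A (h *\<^sub>v Z) p) (B p) = g p (h p *\<^sub>t LB A Z p) (B p) + g p (A p h *\<^sub>t Z p) (B p)"
      unfolding L[OF that(1)] by (intro g_add_left pM TS_scale_closed TL TB T)
    then show ?thesis
      using g_scale_left[OF pM TL TB] g_scale_left[OF pM T(3) TB] g_sym[OF pM T(3) TB] by simp
  qed
  have 2: "g p (LB X Y p) ((h *\<^sub>v Z) p) = h p * g p (LB X Y p) (Z p)"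
    unfolding vscale_apply
    by (intro g_scale_right pM VF_TS[OF VF_lie_bracket[OF assms(1,2)] assms(5)] T)
  show ?thesis
    unfolding koszul_def d[OF T(1) assms(2)] d[OF T(2) assms(1)] 1[OF assms(1,2)] 1[OF assms(2,1)] 2
    unfolding vscale_apply
    by (simp add: algebra_simps)
qed

lemma koszul_value_at:
  assumes "VF U X" "VF U Y" "p \<in> U" "VF U Z" "VF U Z'" "Z p = Z' p"
  shows "koszul X Y Z p = koszul X Y Z' p"
proof -
  obtain V \<phi> where c: "(V, \<phi>) \<in> charts M" "p \<in> V" using chart_cover VF_points assms by blast
  have "koszul X Y A p = (\<Sum>b\<in>Basis. A p (coord_fun (V, \<phi>) b) * koszul X Y (CF (V, \<phi>) b) p)" if A: "VF U A" for A
  proof (rule tensor_expand[OF _ _ A assms(3) c])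
    fix W B C assume W: "p \<in> W" "W \<subseteq> U" "VF W B"
    note XY = VF_subset[OF assms(1) VF_openin[OF W(3)] W(2)] VF_subset[OF assms(2) VF_openin[OF W(3)] W(2)]
    show "koszul X Y (B + C) p = koszul X Y B p + koszul X Y C p" if "VF W C"
      by (rule koszul_add[OF XY W(3) that W(1)])
    show "koszul X Y (h *\<^sub>v B) p = h p * koszul X Y B p" if "SF W h" for h
      by (rule koszul_scale[OF XY W(3) that W(1)])
  qed
  then show ?thesis using assms(4-6) by simp
qed

text \<open>The test fields range over all neighbourhoods of \<open>p\<close>, so that the
  definition need not mention a common domain of \<open>X\<close> and \<open>Y\<close>.\<close>

definition lc :: "'a connection" where
  "lc X Y p = (THE v. v \<in> TS p \<and> (\<forall>W Z. p \<in> W \<and> VF W Z \<longrightarrow> 2 * g p v (Z p) = koszul X Y Z p))"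

lemma koszul_pointwise:
  assumes "VF U X" "VF U Y" "p \<in> U" "VF W Z" "p \<in> W" "VF W' Z'" "p \<in> W'" "Z p = Z' p"
  shows "koszul X Y Z p = koszul X Y Z' p"
proof -
  have o: "OP (U \<inter> W \<inter> W')" using VF_openin assms OP_Int by metis
  show ?thesis
    by (rule koszul_value_at[of "U \<inter> W \<inter> W'"])
      (use assms in \<open>auto intro: VF_subset[OF _ o]\<close>)
qed

lemma
  assumes X: "VF U X" and Y: "VF U Y" and p: "p \<in> U"
  shows lc_TS: "lc X Y p \<in> TS p"
    and lc_koszul: "\<And>W Z. p \<in> W \<Longrightarrow> VF W Z \<Longrightarrow> 2 * g p (lc X Y p) (Z p) = koszul X Y Z p"
proof -
  have pM: "p \<in> points M" using VF_points[OF X p] .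
  \<comment> \<open>Koszul's expression as a function of the vector \<open>w\<close>: all fields
    through \<open>w\<close> give the same value by \<open>koszul_pointwise\<close>, so an arbitrary
    one is chosen.\<close>
  define \<omega> where "\<omega> w = koszul X Y (SOME Z. \<exists>W. p \<in> W \<and> VF W Z \<and> Z p = w) p / 2" for w
  have \<omega>: "\<omega> (Z p) = koszul X Y Z p / 2" if "p \<in> W" "VF W Z" for W Z
  proof -
    let ?Z = "SOME Z'. \<exists>W. p \<in> W \<and> VF W Z' \<and> Z' p = Z p"
    have "\<exists>W. p \<in> W \<and> VF W ?Z \<and> ?Z p = Z p"
      by (rule someI[of "\<lambda>Z'. \<exists>W. p \<in> W \<and> VF W Z' \<and> Z' p = Z p" Z]) (use that in blast)
    then obtain W' where "p \<in> W'" "VF W' ?Z" "?Z p = Z p" by blast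
    then have "koszul X Y ?Z p = koszul X Y Z p"
      by (intro koszul_pointwise[OF X Y p _ _ that(2,1)])
    then show ?thesis
      unfolding \<omega>_def by simp
  qed
  have ext: "\<exists>W Z. VF W Z \<and> p \<in> W \<and> W \<subseteq> U \<and> Z p = w" if "w \<in> TS p" for w
    using VF_extend[OF that p VF_openin[OF X]] by metis
  have "\<exists>!v. v \<in> TS p \<and> (\<forall>w\<in>TS p. g p v w = \<omega> w)"
  proof (rule riesz[OF pM])
    fix u v assume "u \<in> TS p" "v \<in> TS p"
    then obtain W Z W' Z' where W: "VF W Z" "p \<in> W" "W \<subseteq> U" "Z p = u" "VF W' Z'" "p \<in> W'" "Z' p = v"
      using ext by metis
    have o: "OP (W \<inter> W')" using OP_Int[OF VF_openin[OF W(1)] VF_openin[OF W(5)]] .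
    have V: "VF (W \<inter> W') Z" "VF (W \<inter> W') Z'" "VF (W \<inter> W') X" "VF (W \<inter> W') Y" "p \<in> W \<inter> W'"
      using VF_subset[OF W(1) o] VF_subset[OF W(5) o] VF_subset[OF X o] VF_subset[OF Y o] W by auto
    have "\<omega> (u + v) = koszul X Y (Z + Z') p / 2"
      using \<omega>[OF V(5) VF_add[OF V(1,2)]] W(4,7) by simp
    also have "\<dots> = \<omega> u + \<omega> v"
      using koszul_add[OF V(3,4,1,2,5)] \<omega>[OF V(5,1)] \<omega>[OF V(5,2)] W(4,7) by (simp add: add_divide_distrib)
    finally show "\<omega> (u + v) = \<omega> u + \<omega> v" .
  next
    fix c v assume "v \<in> TS p"
    then obtain W Z where W: "VF W Z" "p \<in> W" "W \<subseteq> U" "Z p = v"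
      using ext by metis
    note o = VF_openin[OF W(1)]
    note XY = VF_subset[OF X o W(3)] VF_subset[OF Y o W(3)]
    have "\<omega> (c *\<^sub>t v) = koszul X Y ((\<lambda>q. c) *\<^sub>v Z) p / 2"
      using \<omega>[OF W(2) VF_scale[OF SF_const[OF o] W(1)]] W(4) by simp
    also have "\<dots> = c * \<omega> v"
      using koszul_scale[OF XY W(1) SF_const[OF o] W(2)] \<omega>[OF W(2,1)] W(4) by simp
    finally show "\<omega> (c *\<^sub>t v) = c * \<omega> v" .
  qed
  then obtain v where v: "v \<in> TS p" "\<And>w. w \<in> TS p \<Longrightarrow> g p v w = \<omega> w" by blast
  have "lc X Y p \<in> TS p \<and> (\<forall>W Z. p \<in> W \<and> VF W Z \<longrightarrow> 2 * g p (lc X Y p) (Z p) = koszul X Y Z p)"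
    unfolding lc_def
  proof (rule theI[of _ v])
    show "v \<in> TS p \<and> (\<forall>W Z. p \<in> W \<and> VF W Z \<longrightarrow> 2 * g p v (Z p) = koszul X Y Z p)"
      using v \<omega> VF_TS by fastforce
    fix v' assume v': "v' \<in> TS p \<and> (\<forall>W Z. p \<in> W \<and> VF W Z \<longrightarrow> 2 * g p v' (Z p) = koszul X Y Z p)"
    show "v' = v"
    proof (rule g_eqI_VF[OF VF_openin[OF X] p])
      show "v' \<in> TS p" "v \<in> TS p" using v' v by auto
      show "g p v' (Z p) = g p v (Z p)" if "p \<in> W" "VF W Z" for W Z
        using v' that \<omega>[OF that] v(2)[OF VF_TS[OF that(2,1)]] by fastforce
    qed
  qed
  then show "lc X Y p \<in> TS p" "\<And>W Z. p \<in> W \<Longrightarrow> VF W Z \<Longrightarrow> 2 * g p (lc X Y p) (Z p) = koszul X Y Z p"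
    by auto
qed

lemma SF_koszul:
  assumes "VF U X" "VF U Y" "VF U Z"
  shows "SF U (koszul X Y Z)"
proof -
  have d: "SF U (\<lambda>p. A p (\<lambda>q. g q (B q) (C q)))" if "VF U A" "VF U B" "VF U C" for A B C
    by (rule VF_SF[OF that(1) SF_g[OF that(2,3)] order_refl])
  have l: "SF U (\<lambda>p. g p (LB A B p) (C p))" if "VF U A" "VF U B" "VF U C" for A B C
    by (rule SF_g[OF VF_lie_bracket[OF that(1,2)] that(3)])
  show ?thesis
    unfolding koszul_def[abs_def]
    by (intro SF_add SF_diff) (rule d l; rule assms)+
qed

lemma VF_lc:
  assumes "VF U X" "VF U Y"
  shows "VF U (lc X Y)"
proof (rule VF_riesz[OF VF_openin[OF assms(1)]])
  show "lc X Y p \<in> TS p" if "p \<in> U" for p using lc_TS[OF assms that] .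
  fix W Z assume W: "W \<subseteq> U" "VF W Z"
  note o = VF_openin[OF W(2)]
  have "SF W (\<lambda>p. (1/2) * koszul X Y Z p)"
    by (intro SF_cmult SF_koszul VF_subset[OF assms(1) o W(1)] VF_subset[OF assms(2) o W(1)] W(2))
  then show "SF W (\<lambda>p. g p (lc X Y p) (Z p))"
  proof (rule SF_cong)
    fix p assume p: "p \<in> W"
    then have "p \<in> U" using W(1) by blast
    from lc_koszul[OF assms this p W(2)] show "1/2 * koszul X Y Z p = g p (lc X Y p) (Z p)" by simp
  qed
qed

text \<open>Linearity in the first two arguments is not computed from the definition of
  \<open>koszul\<close>: the two symmetries move \<open>Y\<close>, and then \<open>X\<close>, into
  the last slot, where linearity is known.\<close>

lemma affine_connection_lc: "affine_connection M lc"
proof -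
  have eqI: "u = v" if "VF U X" "p \<in> U" "u \<in> TS p" "v \<in> TS p"
    "\<And>W Z. p \<in> W \<Longrightarrow> W \<subseteq> U \<Longrightarrow> VF W Z \<Longrightarrow> 2 * g p u (Z p) = 2 * g p v (Z p)" for U X p u v
    by (rule g_eqI_VF[OF VF_openin[OF that(1)] that(2-4)]) (use that(5) in fastforce)
  have KsR: "koszul A B C p = 2 * A p (\<lambda>q. g q (B q) (C q)) - koszul A C B p"
    if "VF W A" "VF W B" "VF W C" "p \<in> W" for W A B C p
    using koszul_sym_right[OF that] by simp
  have KsL: "koszul A B C p = koszul B A C p + 2 * g p (LB A B p) (C p)"
    if "VF W A" "VF W B" "VF W C" "p \<in> W" for W A B C p
    using koszul_sym_left[OF that] by simp
  have K2add: "koszul X (Y + Y') Z p = koszul X Y Z p + koszul X Y' Z p"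
    if "VF W X" "VF W Y" "VF W Y'" "VF W Z" "p \<in> W" for W X Y Y' Z p
    using KsR[OF that(1) VF_add[OF that(2,3)] that(4,5)] KsR[OF that(1,2,4,5)] KsR[OF that(1,3,4,5)]
      koszul_add[OF that(1,4,2,3,5)] deriv_g_add[OF VF_TS[OF that(1,5)] that(5,2,3,4)] by simp
  \<comment> \<open>The Leibniz term comes solely from differentiating \<open>g(Y, Z)\<close> in
    \<open>koszul_sym_right\<close>; its coefficient 2 matches the 2 on the left of Koszul's
    formula.\<close>
  have K2scale: "koszul X (h *\<^sub>v Y) Z p = 2 * X p h * g p (Y p) (Z p) + h p * koszul X Y Z p"
    if "VF W X" "VF W Y" "SF W h" "VF W Z" "p \<in> W" for W X Y h Z p
  proof -
    have "h p * (koszul X Y Z p + koszul X Z Y p) = h p * (2 * X p (\<lambda>q. g q (Y q) (Z q)))"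
      unfolding koszul_sym_right[OF that(1,2,4,5)] ..
    then show ?thesis
      unfolding KsR[OF that(1) VF_scale[OF that(3,2)] that(4,5)] koszul_scale[OF that(1,4,2,3,5)]
        deriv_g_scale[OF VF_TS[OF that(1,5)] that(5,2,4,3)]
      by (simp add: algebra_simps)
  qed
  have K1add: "koszul (X + X') Y Z p = koszul X Y Z p + koszul X' Y Z p"
    if "VF W X" "VF W X'" "VF W Y" "VF W Z" "p \<in> W" for W X X' Y Z p
  proof -
    have "g p (LB (X + X') Y p) (Z p) = g p (LB X Y p) (Z p) + g p (LB X' Y p) (Z p)"
      unfolding lie_bracket_add_left[OF that(1,2,3,5)]
      by (intro g_add_left VF_points[OF that(1,5)] VF_TS[OF VF_lie_bracket[OF that(1,3)] that(5)]
          VF_TS[OF VF_lie_bracket[OF that(2,3)] that(5)] VF_TS[OF that(4,5)])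
    then show ?thesis
      using KsL[OF VF_add[OF that(1,2)] that(3-5)] KsL[OF that(1,3-5)] KsL[OF that(2-5)]
        K2add[OF that(3,1,2,4,5)] by simp
  qed
  have K1scale: "koszul (h *\<^sub>v X) Y Z p = h p * koszul X Y Z p"
    if "VF W X" "SF W h" "VF W Y" "VF W Z" "p \<in> W" for W X h Y Z p
  proof -
    note pM = VF_points[OF that(1,5)]
    note TL = VF_TS[OF VF_lie_bracket[OF that(1,3)] that(5)] and TX = VF_TS[OF that(1,5)] and TZ = VF_TS[OF that(4,5)]
    have "g p (LB (h *\<^sub>v X) Y p) (Z p) = g p (h p *\<^sub>t LB X Y p) (Z p) - g p (Y p h *\<^sub>t X p) (Z p)"
      unfolding lie_bracket_scale_left[OF that(2,1,3,5)]
      by (intro g_diff_left pM TS_scale_closed TL TX TZ)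
    then have "g p (LB (h *\<^sub>v X) Y p) (Z p) = h p * g p (LB X Y p) (Z p) - Y p h * g p (X p) (Z p)"
      by (simp only: g_scale_left[OF pM TL TZ] g_scale_left[OF pM TX TZ])
    then show ?thesis
      using KsL[OF VF_scale[OF that(2,1)] that(3-5)] KsL[OF that(1,3-5)]
        K2scale[OF that(3,1,2,4,5)] by (simp add: algebra_simps)
  qed
  show ?thesis
    unfolding affine_connection_def
  proof (intro conjI allI impI ballI)
    show "VF U (lc X Y)" if "VF U X \<and> VF U Y" for U X Y using that VF_lc by blast
  next
    fix U X X' Y p assume a: "VF U X \<and> VF U X' \<and> VF U Y" and p: "p \<in> U"
    then have X: "VF U X" and X': "VF U X'" and Y: "VF U Y" by auto
    show "lc (X + X') Y p = lc X Y p + lc X' Y p"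
    proof (rule eqI[OF X p])
      show "lc (X + X') Y p \<in> TS p" "lc X Y p + lc X' Y p \<in> TS p"
        by (intro lc_TS[OF VF_add[OF X X'] Y p]) (intro TS_add_closed lc_TS[OF X Y p] lc_TS[OF X' Y p])
      fix W Z assume W: "p \<in> W" "W \<subseteq> U" "VF W Z"
      note r = VF_subset[OF _ VF_openin[OF W(3)] W(2)]
      have "g p (lc X Y p + lc X' Y p) (Z p) = g p (lc X Y p) (Z p) + g p (lc X' Y p) (Z p)"
        by (intro g_add_left VF_points[OF X p] lc_TS[OF X Y p] lc_TS[OF X' Y p] VF_TS[OF W(3,1)])
      then show "2 * g p (lc (X + X') Y p) (Z p) = 2 * g p (lc X Y p + lc X' Y p) (Z p)"
        using lc_koszul[OF VF_add[OF X X'] Y p W(1,3)] lc_koszul[OF X Y p W(1,3)] lc_koszul[OF X' Y p W(1,3)]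
          K1add[OF r[OF X] r[OF X'] r[OF Y] W(3,1)] by simp
    qed
  next
    fix U h X Y p assume a: "SF U h \<and> VF U X \<and> VF U Y" and p: "p \<in> U"
    then have h: "SF U h" and X: "VF U X" and Y: "VF U Y" by auto
    show "lc (h *\<^sub>v X) Y p = h p *\<^sub>t lc X Y p"
    proof (rule eqI[OF X p])
      show "lc (h *\<^sub>v X) Y p \<in> TS p" "h p *\<^sub>t lc X Y p \<in> TS p"
        by (intro lc_TS[OF VF_scale[OF h X] Y p]) (intro TS_scale_closed lc_TS[OF X Y p])
      fix W Z assume W: "p \<in> W" "W \<subseteq> U" "VF W Z"
      note r = VF_subset[OF _ VF_openin[OF W(3)] W(2)]
      have "g p (h p *\<^sub>t lc X Y p) (Z p) = h p * g p (lc X Y p) (Z p)"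
        by (intro g_scale_left VF_points[OF X p] lc_TS[OF X Y p] VF_TS[OF W(3,1)])
      then show "2 * g p (lc (h *\<^sub>v X) Y p) (Z p) = 2 * g p (h p *\<^sub>t lc X Y p) (Z p)"
        using lc_koszul[OF VF_scale[OF h X] Y p W(1,3)] lc_koszul[OF X Y p W(1,3)]
          K1scale[OF r[OF X] SF_subset[OF h VF_openin[OF W(3)] W(2)] r[OF Y] W(3,1)] by simp
    qed
  next
    fix U X Y Y' p assume a: "VF U X \<and> VF U Y \<and> VF U Y'" and p: "p \<in> U"
    then have X: "VF U X" and Y': "VF U Y'" and Y: "VF U Y" by auto
    show "lc X (Y + Y') p = lc X Y p + lc X Y' p"
    proof (rule eqI[OF X p])
      show "lc X (Y + Y') p \<in> TS p" "lc X Y p + lc X Y' p \<in> TS p"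
        by (intro lc_TS[OF X VF_add[OF Y Y'] p]) (intro TS_add_closed lc_TS[OF X Y p] lc_TS[OF X Y' p])
      fix W Z assume W: "p \<in> W" "W \<subseteq> U" "VF W Z"
      note r = VF_subset[OF _ VF_openin[OF W(3)] W(2)]
      have "g p (lc X Y p + lc X Y' p) (Z p) = g p (lc X Y p) (Z p) + g p (lc X Y' p) (Z p)"
        by (intro g_add_left VF_points[OF X p] lc_TS[OF X Y p] lc_TS[OF X Y' p] VF_TS[OF W(3,1)])
      then show "2 * g p (lc X (Y + Y') p) (Z p) = 2 * g p (lc X Y p + lc X Y' p) (Z p)"
        using lc_koszul[OF X VF_add[OF Y Y'] p W(1,3)] lc_koszul[OF X Y p W(1,3)] lc_koszul[OF X Y' p W(1,3)]
          K2add[OF r[OF X] r[OF Y] r[OF Y'] W(3,1)] by simp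
    qed
  next
    fix U h X Y p assume a: "SF U h \<and> VF U X \<and> VF U Y" and p: "p \<in> U"
    then have h: "SF U h" and X: "VF U X" and Y: "VF U Y" by auto
    note pM = VF_points[OF X p]
    show "lc X (h *\<^sub>v Y) p = X p h *\<^sub>t Y p + h p *\<^sub>t lc X Y p"
    proof (rule eqI[OF X p])
      note T = lc_TS[OF X Y p] VF_TS[OF Y p]
      show "lc X (h *\<^sub>v Y) p \<in> TS p" "X p h *\<^sub>t Y p + h p *\<^sub>t lc X Y p \<in> TS p"
        by (intro lc_TS[OF X VF_scale[OF h Y] p]) (intro TS_add_closed TS_scale_closed T)
      fix W Z assume W: "p \<in> W" "W \<subseteq> U" "VF W Z"
      note r = VF_subset[OF _ VF_openin[OF W(3)] W(2)]
      note TZ = VF_TS[OF W(3,1)]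
      have "g p (X p h *\<^sub>t Y p + h p *\<^sub>t lc X Y p) (Z p) = g p (X p h *\<^sub>t Y p) (Z p) + g p (h p *\<^sub>t lc X Y p) (Z p)"
        by (intro g_add_left pM TS_scale_closed T TZ)
      also have "\<dots> = X p h * g p (Y p) (Z p) + h p * g p (lc X Y p) (Z p)"
        by (simp only: g_scale_left[OF pM T(1) TZ] g_scale_left[OF pM T(2) TZ])
      finally show "2 * g p (lc X (h *\<^sub>v Y) p) (Z p) = 2 * g p (X p h *\<^sub>t Y p + h p *\<^sub>t lc X Y p) (Z p)"
        using lc_koszul[OF X VF_scale[OF h Y] p W(1,3)] lc_koszul[OF X Y p W(1,3)]
          K2scale[OF r[OF X] r[OF Y] SF_subset[OF h VF_openin[OF W(3)] W(2)] W(3,1)] by simp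
    qed
  qed
qed

lemma is_levi_civita_lc: "is_levi_civita M g lc"
  unfolding is_levi_civita_def
proof (intro conjI allI impI ballI)
  show "affine_connection M lc" by (rule affine_connection_lc)
next
  fix U X Y p assume a: "VF U X \<and> VF U Y" and p: "p \<in> U"
  then have X: "VF U X" and Y: "VF U Y" by auto
  note pM = VF_points[OF X p]
  show "lc X Y p - lc Y X p = LB X Y p"
  proof (rule g_eqI_VF[OF VF_openin[OF X] p])
    show "lc X Y p - lc Y X p \<in> TS p" "LB X Y p \<in> TS p"
      by (intro TS_diff_closed lc_TS[OF X Y p] lc_TS[OF Y X p]) (rule VF_TS[OF VF_lie_bracket[OF X Y] p])
    fix W Z assume W: "p \<in> W" "W \<subseteq> U" "VF W Z"
    note r = VF_subset[OF _ VF_openin[OF W(3)] W(2)]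
    show "g p (lc X Y p - lc Y X p) (Z p) = g p (LB X Y p) (Z p)"
      using lc_koszul[OF X Y p W(1,3)] lc_koszul[OF Y X p W(1,3)]
        koszul_sym_left[OF r[OF X] r[OF Y] W(3,1)]
        g_diff_left[OF pM lc_TS[OF X Y p] lc_TS[OF Y X p] VF_TS[OF W(3,1)]] by simp
  qed
next
  fix U X Y Z p assume a: "VF U X \<and> VF U Y \<and> VF U Z" and p: "p \<in> U"
  then have X: "VF U X" and Y: "VF U Y" and Z: "VF U Z" by auto
  show "X p (\<lambda>q. g q (Y q) (Z q)) = g p (lc X Y p) (Z p) + g p (Y p) (lc X Z p)"
    using lc_koszul[OF X Y p p Z] lc_koszul[OF X Z p p Y] koszul_sym_right[OF X Y Z p]
      g_sym[OF VF_points[OF X p] VF_TS[OF Y p] lc_TS[OF X Z p]] by simp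
qed

section \<open>Properties of the Levi-Civita connection\<close>

abbreviation "D \<equiv> levi_civita M g"

text \<open>The existence of \<open>lc\<close> makes the choice in \<open>levi_civita\<close>
  meaningful; from here on \<open>D\<close> is handled through its axioms only.\<close>

lemma is_levi_civita: "is_levi_civita M g D"
  unfolding levi_civita_def by (rule someI[of _ lc]) (rule is_levi_civita_lc)

lemma affine_connection: "affine_connection M D"
  using is_levi_civita[unfolded is_levi_civita_def, THEN conjunct1] .

lemma VF_D: "VF U X \<Longrightarrow> VF U Y \<Longrightarrow> VF U (D X Y)"
  using affine_connection[unfolded affine_connection_def, THEN conjunct1] by blast

lemma
  assumes "VF U X" "VF U Y" "p \<in> U"
  shows D_add_left: "VF U X' \<Longrightarrow> D (X + X') Y p = D X Y p + D X' Y p"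
    and D_add_right: "VF U Y' \<Longrightarrow> D X (Y + Y') p = D X Y p + D X Y' p"
    and D_scale_left: "SF U h \<Longrightarrow> D (h *\<^sub>v X) Y p = h p *\<^sub>t D X Y p"
    and D_scale_right: "SF U h \<Longrightarrow> D X (h *\<^sub>v Y) p = X p h *\<^sub>t Y p + h p *\<^sub>t D X Y p"
proof -
  note a = affine_connection[unfolded affine_connection_def, THEN conjunct2]
  show "VF U X' \<Longrightarrow> D (X + X') Y p = D X Y p + D X' Y p"
    using a[THEN conjunct1] assms by blast
  show "SF U h \<Longrightarrow> D (h *\<^sub>v X) Y p = h p *\<^sub>t D X Y p"
    using a[THEN conjunct2, THEN conjunct1] assms by blast
  show "VF U Y' \<Longrightarrow> D X (Y + Y') p = D X Y p + D X Y' p"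
    using a[THEN conjunct2, THEN conjunct2, THEN conjunct1] assms by blast
  show "SF U h \<Longrightarrow> D X (h *\<^sub>v Y) p = X p h *\<^sub>t Y p + h p *\<^sub>t D X Y p"
    using a[THEN conjunct2, THEN conjunct2, THEN conjunct2] assms by blast
qed

lemma
  assumes "VF U X" "VF U Y" "p \<in> U"
  shows D_torsion: "D X Y p - D Y X p = LB X Y p"
    and D_metric: "VF U Z \<Longrightarrow> X p (\<lambda>q. g q (Y q) (Z q)) = g p (D X Y p) (Z p) + g p (Y p) (D X Z p)"
proof -
  note a = is_levi_civita[unfolded is_levi_civita_def, THEN conjunct2]
  show "D X Y p - D Y X p = LB X Y p"
    using a[THEN conjunct1] assms by blast
  show "VF U Z \<Longrightarrow> X p (\<lambda>q. g q (Y q) (Z q)) = g p (D X Y p) (Z p) + g p (Y p) (D X Z p)"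
    using a[THEN conjunct2] assms by blast
qed

text \<open>Torsion and metric compatibility alone force the value, hence uniqueness. This is the
  identity by which the connection of the warped product is evaluated.\<close>

lemma D_koszul:
  assumes X: "VF U X" and Y: "VF U Y" and Z: "VF U Z" and p: "p \<in> U"
  shows "2 * g p (D X Y p) (Z p) = koszul X Y Z p"
proof -
  note pM = VF_points[OF X p]
  note T = VF_TS[OF X p] VF_TS[OF Y p] VF_TS[OF Z p]
  have TD: "D A B p \<in> TS p" if "VF U A" "VF U B" for A B using VF_TS[OF VF_D[OF that] p] .
  have L: "g p (LB A B p) (C p) = g p (D A B p) (C p) - g p (D B A p) (C p)" if "VF U A" "VF U B" "VF U C" for A B C
    unfolding D_torsion[OF that(1,2) p, symmetric]
    by (intro g_diff_left pM TD that VF_TS[OF that(3) p])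
  show ?thesis
    unfolding koszul_def L[OF X Y Z] L[OF X Z Y] L[OF Y Z X]
      D_metric[OF X Y p Z] D_metric[OF Y X p Z] D_metric[OF Z X p Y]
    using g_sym[OF pM T(1) TD[OF Y Z]] g_sym[OF pM T(1) TD[OF Z Y]] g_sym[OF pM T(2) TD[OF X Z]] by simp
qed

lemma D_local_left:
  assumes "VF U X" "VF U X'" "VF U Y" "p \<in> U" "\<And>q. q \<in> U \<Longrightarrow> X q = X' q"
  shows "D X Y p = D X' Y p"
proof
  fix h
  show "D X Y p h = D X' Y p h"
    by (rule tensor_local[OF _ assms(4,1,2,5)]) (simp only: D_scale_left[OF _ assms(3,4)] tscale_apply)
qed

text \<open>\<open>D X\<close> is not function-linear in \<open>Y\<close>, but the extra Leibniz
  term of an indicator function vanishes at \<open>p\<close>, so the argument used for tensors still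
  works.\<close>

lemma D_local_right:
  assumes "VF U X" "VF U Y" "VF U Y'" "p \<in> U" "\<And>q. q \<in> U \<Longrightarrow> Y q = Y' q"
  shows "D X Y p = D X Y' p"
proof -
  let ?\<chi> = "\<lambda>q. if q \<in> U then 1 else 0 :: real"
  have s: "SF U ?\<chi>" using SF_indicator[OF VF_openin[OF assms(1)]] .
  have "?\<chi> *\<^sub>v Y = ?\<chi> *\<^sub>v Y'"
    using assms(5) by (auto simp: vscale_def tscale_def fun_eq_iff)
  moreover have "D X (?\<chi> *\<^sub>v Z) p = D X Z p" if "VF U Z" for Z
    unfolding D_scale_right[OF assms(1) that assms(4) s]
      TS_indicator[OF VF_TS[OF assms(1,4)] VF_openin[OF assms(1)] assms(4)]
    using assms(4) by (simp add: fun_eq_iff)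
  ultimately show ?thesis using assms by metis
qed

end

lemma vfield_diff_apply: "(X - Y) p = X p - Y p" for X Y :: "'a vfield"
  by (rule fun_diff_apply)

lemma vfield_minus_conv: "- X = (\<lambda>p. -1) *\<^sub>v X" for X :: "'a vfield"
  by (auto simp: fun_eq_iff)

lemma vfield_diff_conv: "X - Y = X + (\<lambda>p. -1) *\<^sub>v Y" for X Y :: "'a vfield"
  by (auto simp: fun_eq_iff)

text \<open>\<open>m\<close> and \<open>n\<close> stand for the two Jacobian matrices of a change of
  chart, inverse to each other by \<open>mn\<close>, so that the trace of \<open>F\<close> is
  preserved.\<close>

lemma trace_change_basis:
  fixes F :: "'i \<Rightarrow> 'i \<Rightarrow> real"
  assumes "finite I"
    and F': "\<And>b. b \<in> I \<Longrightarrow> F' b = (\<Sum>k\<in>I. \<Sum>d\<in>I. m k b * n b d * F k d)"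
    and mn: "\<And>k d. k \<in> I \<Longrightarrow> d \<in> I \<Longrightarrow> (\<Sum>b\<in>I. m k b * n b d) = (if k = d then 1 else 0)"
  shows "(\<Sum>b\<in>I. F' b) = (\<Sum>k\<in>I. F k k)"
proof -
  have "(\<Sum>b\<in>I. F' b) = (\<Sum>b\<in>I. \<Sum>k\<in>I. \<Sum>d\<in>I. m k b * n b d * F k d)"
    using F' by (rule sum.cong[OF refl])
  also have "\<dots> = (\<Sum>k\<in>I. \<Sum>b\<in>I. \<Sum>d\<in>I. m k b * n b d * F k d)"
    by (rule sum.swap)
  also have "\<dots> = (\<Sum>k\<in>I. \<Sum>d\<in>I. (\<Sum>b\<in>I. m k b * n b d) * F k d)"
    unfolding sum_distrib_right by (intro sum.cong refl sum.swap)
  also have "\<dots> = (\<Sum>k\<in>I. \<Sum>d\<in>I. (if k = d then 1 else 0) * F k d)"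
    using mn by (intro sum.cong refl) simp
  also have "\<dots> = (\<Sum>k\<in>I. F k k)"
    using assms(1) by (simp add: if_distrib[of "\<lambda>x. x * _"] cong: if_cong)
  finally show ?thesis .
qed

section \<open>The curvature tensor\<close>

context psriem
begin

abbreviation "R \<equiv> riemann M g"

lemma
  assumes "VF U X" "VF U Y" "p \<in> U"
  shows D_minus_left: "D (- X) Y p = - D X Y p"
    and D_diff_left: "VF U X' \<Longrightarrow> D (X - X') Y p = D X Y p - D X' Y p"
    and D_diff_right: "VF U Y' \<Longrightarrow> D X (Y - Y') p = D X Y p - D X Y' p"
proof -
  note c = SF_const[OF VF_openin[OF assms(1)], of "-1"]
  show "D (- X) Y p = - D X Y p"
    unfolding vfield_minus_conv D_scale_left[OF assms c] by (rule tscale_minus_one)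
  have x1: "X p (\<lambda>q. -1) = 0"
    by (rule TS_const[OF VF_TS[OF assms(1,3)] VF_points[OF assms(1,3)]])
  show "D (X - X') Y p = D X Y p - D X' Y p" if "VF U X'"
    unfolding vfield_diff_conv D_add_left[OF assms VF_scale[OF c that]] D_scale_left[OF that assms(2,3) c]
    by (simp add: fun_eq_iff)
  show "D X (Y - Y') p = D X Y p - D X Y' p" if "VF U Y'"
    unfolding vfield_diff_conv D_add_right[OF assms VF_scale[OF c that]]
      D_scale_right[OF assms(1) that assms(3) c] x1
    by (simp add: fun_eq_iff)
qed

lemma riemann_apply: "R X Y Z p = D Y (D X Z) p - D X (D Y Z) p + D (LB X Y) Z p"
  unfolding riemann_def Let_def vfield_add_apply vfield_diff_apply ..

lemma VF_riemann: "VF U X \<Longrightarrow> VF U Y \<Longrightarrow> VF U Z \<Longrightarrow> VF U (R X Y Z)"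
  unfolding riemann_def Let_def by (intro VF_add VF_diff VF_D VF_lie_bracket)

context
  fixes U X Y Z p
  assumes X: "VF U X" and Y: "VF U Y" and Z: "VF U Z" and p: "p \<in> U"
begin

lemma riemann_anti: "R X Y Z p = - R Y X Z p"
  unfolding riemann_apply lie_bracket_anti[of X Y] D_minus_left[OF VF_lie_bracket[OF Y X] Z p] by simp

lemma riemann_add_left:
  assumes X': "VF U X'"
  shows "R (X + X') Y Z p = R X Y Z p + R X' Y Z p"
proof -
  have 1: "D Y (D (X + X') Z) p = D Y (D X Z) p + D Y (D X' Z) p"
  proof -
    have "D Y (D (X + X') Z) p = D Y (D X Z + D X' Z) p"
      by (rule D_local_right[OF Y VF_D[OF VF_add[OF X X'] Z] VF_add[OF VF_D[OF X Z] VF_D[OF X' Z]] p])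
        (simp only: vfield_add_apply D_add_left[OF X Z _ X'])
    then show ?thesis
      by (simp only: D_add_right[OF Y VF_D[OF X Z] p VF_D[OF X' Z]])
  qed
  have 2: "D (LB (X + X') Y) Z p = D (LB X Y) Z p + D (LB X' Y) Z p"
  proof -
    have "D (LB (X + X') Y) Z p = D (LB X Y + LB X' Y) Z p"
      by (rule D_local_left[OF VF_lie_bracket[OF VF_add[OF X X'] Y]
            VF_add[OF VF_lie_bracket[OF X Y] VF_lie_bracket[OF X' Y]] Z p])
        (simp only: vfield_add_apply lie_bracket_add_left[OF X X' Y])
    then show ?thesis
      by (simp only: D_add_left[OF VF_lie_bracket[OF X Y] Z p VF_lie_bracket[OF X' Y]])
  qed
  show ?thesis
    unfolding riemann_apply 1 2 D_add_left[OF X VF_D[OF Y Z] p X'] by simp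
qed

text \<open>Differentiating \<open>h\<close> along \<open>Y\<close> produces the term
  \<open>(Y h) D X Z\<close> once in the second derivative and once, with the opposite sign, in the
  bracket of \<open>h X\<close> with \<open>Y\<close>.\<close>

lemma riemann_scale_left:
  assumes h: "SF U h"
  shows "R (h *\<^sub>v X) Y Z p = h p *\<^sub>t R X Y Z p"
proof -
  have 1: "D Y (D (h *\<^sub>v X) Z) p = Y p h *\<^sub>t D X Z p + h p *\<^sub>t D Y (D X Z) p"
  proof -
    have "D Y (D (h *\<^sub>v X) Z) p = D Y (h *\<^sub>v D X Z) p"
      by (rule D_local_right[OF Y VF_D[OF VF_scale[OF h X] Z] VF_scale[OF h VF_D[OF X Z]] p])
        (simp only: vscale_apply D_scale_left[OF X Z _ h])
    then show ?thesis
      by (simp only: D_scale_right[OF Y VF_D[OF X Z] p h])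
  qed
  have s: "SF U (\<lambda>q. Y q h)" using VF_SF[OF Y h order_refl] .
  have 2: "D (LB (h *\<^sub>v X) Y) Z p = h p *\<^sub>t D (LB X Y) Z p - Y p h *\<^sub>t D X Z p"
  proof -
    have "D (LB (h *\<^sub>v X) Y) Z p = D (h *\<^sub>v LB X Y - (\<lambda>q. Y q h) *\<^sub>v X) Z p"
      by (rule D_local_left[OF VF_lie_bracket[OF VF_scale[OF h X] Y]
            VF_diff[OF VF_scale[OF h VF_lie_bracket[OF X Y]] VF_scale[OF s X]] Z p])
        (simp only: vfield_diff_apply vscale_apply lie_bracket_scale_left[OF h X Y])
    then show ?thesis
      by (simp only: D_diff_left[OF VF_scale[OF h VF_lie_bracket[OF X Y]] Z p VF_scale[OF s X]]
          D_scale_left[OF VF_lie_bracket[OF X Y] Z p h] D_scale_left[OF X Z p s])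
  qed
  show ?thesis
    unfolding riemann_apply 1 2 D_scale_left[OF X VF_D[OF Y Z] p h] by (simp add: fun_eq_iff algebra_simps)
qed

lemma riemann_add_right:
  assumes Z': "VF U Z'"
  shows "R X Y (Z + Z') p = R X Y Z p + R X Y Z' p"
proof -
  have 1: "D B (D A (Z + Z')) p = D B (D A Z) p + D B (D A Z') p" if A: "VF U A" and B: "VF U B" for A B
  proof -
    have "D B (D A (Z + Z')) p = D B (D A Z + D A Z') p"
      by (rule D_local_right[OF B VF_D[OF A VF_add[OF Z Z']] VF_add[OF VF_D[OF A Z] VF_D[OF A Z']] p])
        (simp only: vfield_add_apply D_add_right[OF A Z _ Z'])
    then show ?thesis
      by (simp only: D_add_right[OF B VF_D[OF A Z] p VF_D[OF A Z']])
  qed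
  show ?thesis
    unfolding riemann_apply 1[OF X Y] 1[OF Y X] D_add_right[OF VF_lie_bracket[OF X Y] Z p Z'] by simp
qed

text \<open>The second derivatives of \<open>h\<close> from the two orders of differentiation differ
  by \<open>[X, Y] h\<close>, which the bracket term of the curvature removes; the first-order terms
  are symmetric in \<open>X\<close> and \<open>Y\<close>.\<close>

lemma riemann_scale_right:
  assumes h: "SF U h"
  shows "R X Y (h *\<^sub>v Z) p = h p *\<^sub>t R X Y Z p"
proof -
  have 1: "D B (D A (h *\<^sub>v Z)) p = B p (\<lambda>q. A q h) *\<^sub>t Z p + A p h *\<^sub>t D B Z p +
      (B p h *\<^sub>t D A Z p + h p *\<^sub>t D B (D A Z) p)" if A: "VF U A" and B: "VF U B" for A B
  proof -
    have s: "SF U (\<lambda>q. A q h)" using VF_SF[OF A h order_refl] .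
    have "D B (D A (h *\<^sub>v Z)) p = D B ((\<lambda>q. A q h) *\<^sub>v Z + h *\<^sub>v D A Z) p"
      by (rule D_local_right[OF B VF_D[OF A VF_scale[OF h Z]] VF_add[OF VF_scale[OF s Z] VF_scale[OF h VF_D[OF A Z]]] p])
        (simp only: vfield_add_apply vscale_apply D_scale_right[OF A Z _ h])
    then show ?thesis
      by (simp only: D_add_right[OF B VF_scale[OF s Z] p VF_scale[OF h VF_D[OF A Z]]]
          D_scale_right[OF B Z p s] D_scale_right[OF B VF_D[OF A Z] p h])
  qed
  show ?thesis
    unfolding riemann_apply 1[OF X Y] 1[OF Y X] D_scale_right[OF VF_lie_bracket[OF X Y] Z p h]
      lie_bracket_apply[OF p h]
    by (simp add: fun_eq_iff algebra_simps)
qed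

end

lemma riemann_expand_left:
  assumes "VF U X" "VF U Y" "VF U Z" "p \<in> U" and c: "(V, \<phi>) \<in> charts M" "p \<in> V"
  shows "R X Y Z p h = (\<Sum>b\<in>Basis. X p (coord_fun (V, \<phi>) b) * R (CF (V, \<phi>) b) Y Z p h)"
proof (rule tensor_expand[OF _ _ assms(1,4) c])
  fix W A B k assume W: "p \<in> W" "W \<subseteq> U" and A: "VF W A"
  note r = VF_subset[OF _ VF_openin[OF A] W(2)]
  show "R (A + B) Y Z p h = R A Y Z p h + R B Y Z p h" if "VF W B"
    unfolding riemann_add_left[OF A r[OF assms(2)] r[OF assms(3)] W(1) that] by (rule plus_fun_apply)
  show "R (k *\<^sub>v A) Y Z p h = k p * R A Y Z p h" if "SF W k"
    unfolding riemann_scale_left[OF A r[OF assms(2)] r[OF assms(3)] W(1) that] by (rule tscale_apply)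
qed

lemma riemann_expand_middle:
  assumes "VF U X" "VF U Y" "VF U Z" "p \<in> U" and c: "(V, \<phi>) \<in> charts M" "p \<in> V"
  shows "R X Y Z p h = (\<Sum>b\<in>Basis. Y p (coord_fun (V, \<phi>) b) * R X (CF (V, \<phi>) b) Z p h)"
proof -
  define W where "W = U \<inter> V"
  have W: "OP W" "p \<in> W" "W \<subseteq> U" "W \<subseteq> V"
    using OP_Int[OF VF_openin[OF assms(1)] chart_openin[OF c(1)]] assms(4) c by (auto simp: W_def)
  note r = VF_subset[OF _ W(1,3)] and CW = VF_subset[OF VF_coord_field[OF c(1)] W(1,4)]
  have e: "- R (CF (V, \<phi>) b) X Z p h = R X (CF (V, \<phi>) b) Z p h" for b
    unfolding riemann_anti[OF r[OF assms(1)] CW r[OF assms(3)] W(2)] by simp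
  have "R X Y Z p h = - R Y X Z p h"
    unfolding riemann_anti[OF assms(1-4)] by simp
  also have "\<dots> = (\<Sum>b\<in>Basis. Y p (coord_fun (V, \<phi>) b) * - R (CF (V, \<phi>) b) X Z p h)"
    unfolding riemann_expand_left[OF assms(2,1,3,4) c, of h] by (simp add: sum_negf)
  finally show ?thesis
    unfolding e .
qed

lemma riemann_expand_right:
  assumes "VF U X" "VF U Y" "VF U Z" "p \<in> U" and c: "(V, \<phi>) \<in> charts M" "p \<in> V"
  shows "R X Y Z p h = (\<Sum>b\<in>Basis. Z p (coord_fun (V, \<phi>) b) * R X Y (CF (V, \<phi>) b) p h)"
proof (rule tensor_expand[OF _ _ assms(3,4) c])
  fix W A B k assume W: "p \<in> W" "W \<subseteq> U" and A: "VF W A"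
  note r = VF_subset[OF _ VF_openin[OF A] W(2)]
  show "R X Y (A + B) p h = R X Y A p h + R X Y B p h" if "VF W B"
    unfolding riemann_add_right[OF r[OF assms(1)] r[OF assms(2)] A W(1) that] by (rule plus_fun_apply)
  show "R X Y (k *\<^sub>v A) p h = k p * R X Y A p h" if "SF W k"
    unfolding riemann_scale_right[OF r[OF assms(1)] r[OF assms(2)] A W(1) that] by (rule tscale_apply)
qed

text \<open>Expansion of the three slots one after the other. It allows a covariant derivative
  inside the curvature to be replaced by a field known to agree with it at \<open>p\<close>
  only.\<close>

lemma riemann_pointwise:
  assumes "VF U X" "VF U Y" "VF U Z" "VF U X'" "VF U Y'" "VF U Z'" "p \<in> U"
    and "X p = X' p" "Y p = Y' p" "Z p = Z' p"
  shows "R X Y Z p = R X' Y' Z' p"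
proof
  fix h
  obtain V \<phi> where c: "(V, \<phi>) \<in> charts M" "p \<in> V" using chart_cover VF_points[OF assms(1,7)] by blast
  show "R X Y Z p h = R X' Y' Z' p h"
    using riemann_expand_left[OF assms(1-3,7) c, of h] riemann_expand_left[OF assms(4,2,3,7) c, of h]
      riemann_expand_middle[OF assms(4,2,3,7) c, of h] riemann_expand_middle[OF assms(4,5,3,7) c, of h]
      riemann_expand_right[OF assms(4,5,3,7) c, of h] riemann_expand_right[OF assms(4,5,6,7) c, of h]
      assms(8-10) by (simp only:)
qed

section \<open>Gradient and scalar curvature\<close>

lemma
  assumes f: "smooth_at M p f"
  shows grad_TS: "grad M g f p \<in> TS p" and g_grad: "\<And>w. w \<in> TS p \<Longrightarrow> g p (grad M g f p) w = w f"
proof -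
  have "\<exists>!v. v \<in> TS p \<and> (\<forall>w\<in>TS p. g p v w = w f)"
    by (rule riesz[OF smooth_at_points[OF f]]) simp_all
  from theI'[OF this] show "grad M g f p \<in> TS p" "\<And>w. w \<in> TS p \<Longrightarrow> g p (grad M g f p) w = w f"
    unfolding grad_def by blast+
qed

lemma VF_grad:
  assumes "SF U f"
  shows "VF U (grad M g f)"
proof (rule VF_riesz[OF SF_openin[OF assms]])
  show "grad M g f p \<in> TS p" if "p \<in> U" for p using grad_TS[OF smooth_atI[OF that assms]] .
  fix W Z assume W: "W \<subseteq> U" "VF W Z"
  have "SF W (\<lambda>p. Z p f)"
    by (rule VF_SF[OF W(2) SF_subset[OF assms VF_openin[OF W(2)] W(1)] order_refl])
  then show "SF W (\<lambda>p. g p (grad M g f p) (Z p))"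
    by (rule SF_cong) (use W g_grad[OF smooth_atI[OF _ assms] VF_TS[OF W(2)]] in auto)
qed

text \<open>Both sides are the inverse metric applied to the two differentials; for coordinate
  functions this is the symmetry of \<open>g\<^sup>a\<^sup>b\<close>.\<close>

lemma grad_apply_sym:
  assumes "smooth_at M p f" "smooth_at M p h"
  shows "grad M g f p h = grad M g h p f"
  using g_grad[OF assms(1) grad_TS[OF assms(2)]] g_grad[OF assms(2) grad_TS[OF assms(1)]]
    g_sym[OF smooth_at_points[OF assms(1)] grad_TS[OF assms(1)] grad_TS[OF assms(2)]] by simp

text \<open>\<open>ricci\<close> takes its trace in the chart chosen by \<open>chart_at\<close>,
  which may jump from point to point. With the chart as a parameter, smoothness can be seen in a
  fixed chart.\<close>

definition chart_ricci :: "('a, 'e) chart \<Rightarrow> 'a vfield \<Rightarrow> 'a vfield \<Rightarrow> 'a \<Rightarrow> real" where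
  "chart_ricci c X Z p = (\<Sum>a\<in>Basis. R X (CF c a) Z p (coord_fun c a))"

definition chart_scal :: "('a, 'e) chart \<Rightarrow> 'a \<Rightarrow> real" where
  "chart_scal c p = (\<Sum>b\<in>Basis. chart_ricci c (grad M g (coord_fun c b)) (CF c b) p)"

lemma scalar_curvature_eq: "scalar_curvature M g p = chart_scal (chart_at M p) p"
  by (simp add: scalar_curvature_def chart_scal_def ricci_def chart_ricci_def Let_def)

lemma coord_change_inverse:
  assumes c: "(V, \<phi>) \<in> charts M" "p \<in> V" and c': "(V', \<phi>') \<in> charts M" "p \<in> V'"
    and kd: "k \<in> Basis" "d \<in> Basis"
  shows "(\<Sum>b\<in>Basis. CF (V, \<phi>) k p (coord_fun (V', \<phi>') b) * CF (V', \<phi>') b p (coord_fun (V, \<phi>) d)) =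
    (if k = d then 1 else 0)"
  using TS_expand_apply[OF coord_field_TS[OF c] c' smooth_at_coord_fun[OF c], of k d]
    coord_field_coord_fun[OF c kd] by simp

lemma chart_ricci_independent:
  assumes X: "VF U X" "VF U Z" "p \<in> U" and c: "(V, \<phi>) \<in> charts M" "p \<in> V"
    and c': "(V', \<phi>') \<in> charts M" "p \<in> V'"
  shows "chart_ricci (V', \<phi>') X Z p = chart_ricci (V, \<phi>) X Z p"
proof -
  define W where "W = U \<inter> V \<inter> V'"
  have W: "OP W" "p \<in> W" "W \<subseteq> U" "W \<subseteq> V" "W \<subseteq> V'"
    using OP_Int[OF OP_Int[OF VF_openin[OF X(1)] chart_openin[OF c(1)]] chart_openin[OF c'(1)]] X c c'
    by (auto simp: W_def)
  note XW = VF_subset[OF X(1) W(1,3)] VF_subset[OF X(2) W(1,3)]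
    and CW = VF_subset[OF VF_coord_field[OF c(1)] W(1,4)] VF_subset[OF VF_coord_field[OF c'(1)] W(1,5)]
  let ?m = "\<lambda>k b. CF (V, \<phi>) k p (coord_fun (V', \<phi>') b)" and ?n = "\<lambda>b d. CF (V', \<phi>') b p (coord_fun (V, \<phi>) d)"
  show ?thesis
    unfolding chart_ricci_def
  proof (rule trace_change_basis[where m = ?m and n = ?n and F = "\<lambda>k d. R X (CF (V, \<phi>) d) Z p (coord_fun (V, \<phi>) k)"])
    fix b :: 'e assume "b \<in> Basis"
    have "R X (CF (V', \<phi>') b) Z p (coord_fun (V', \<phi>') b) =
       (\<Sum>k\<in>Basis. R X (CF (V', \<phi>') b) Z p (coord_fun (V, \<phi>) k) * ?m k b)"
      by (rule TS_expand_apply[OF VF_TS[OF VF_riemann[OF XW(1) CW(2) XW(2)] W(2)] c smooth_at_coord_fun[OF c']])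
    also have "\<dots> = (\<Sum>k\<in>Basis. (\<Sum>d\<in>Basis. ?n b d * R X (CF (V, \<phi>) d) Z p (coord_fun (V, \<phi>) k)) * ?m k b)"
      by (simp only: riemann_expand_middle[OF XW(1) CW(2) XW(2) W(2) c])
    finally show "R X (CF (V', \<phi>') b) Z p (coord_fun (V', \<phi>') b) =
       (\<Sum>k\<in>Basis. \<Sum>d\<in>Basis. ?m k b * ?n b d * R X (CF (V, \<phi>) d) Z p (coord_fun (V, \<phi>) k))"
      by (simp add: sum_distrib_left sum_distrib_right mult_ac)
  qed (simp_all add: coord_change_inverse[OF c c'])
qed

lemma chart_ricci_expand_left:
  assumes "VF U X" "VF U Z" "p \<in> U" and c: "(V, \<phi>) \<in> charts M" "p \<in> V"
  shows "chart_ricci (V, \<phi>) X Z p = (\<Sum>b\<in>Basis. X p (coord_fun (V, \<phi>) b) * chart_ricci (V, \<phi>) (CF (V, \<phi>) b) Z p)"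
proof -
  define W where "W = U \<inter> V"
  have W: "OP W" "p \<in> W" "W \<subseteq> U" "W \<subseteq> V"
    using OP_Int[OF VF_openin[OF assms(1)] chart_openin[OF c(1)]] assms(3) c by (auto simp: W_def)
  note r = VF_subset[OF _ W(1,3)] and CW = VF_subset[OF VF_coord_field[OF c(1)] W(1,4)]
  show ?thesis
    unfolding chart_ricci_def riemann_expand_left[OF r[OF assms(1)] CW r[OF assms(2)] W(2) c]
      sum_distrib_left by (rule sum.swap)
qed

lemma chart_ricci_expand_right:
  assumes "VF U X" "VF U Z" "p \<in> U" and c: "(V, \<phi>) \<in> charts M" "p \<in> V"
  shows "chart_ricci (V, \<phi>) X Z p = (\<Sum>b\<in>Basis. Z p (coord_fun (V, \<phi>) b) * chart_ricci (V, \<phi>) X (CF (V, \<phi>) b) p)"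
proof -
  define W where "W = U \<inter> V"
  have W: "OP W" "p \<in> W" "W \<subseteq> U" "W \<subseteq> V"
    using OP_Int[OF VF_openin[OF assms(1)] chart_openin[OF c(1)]] assms(3) c by (auto simp: W_def)
  note r = VF_subset[OF _ W(1,3)] and CW = VF_subset[OF VF_coord_field[OF c(1)] W(1,4)]
  show ?thesis
    unfolding chart_ricci_def riemann_expand_right[OF r[OF assms(1)] CW r[OF assms(2)] W(2) c]
      sum_distrib_left by (rule sum.swap)
qed

text \<open>The gradients of the coordinates transform by one Jacobian matrix (\<open>r1\<close>)
  and the coordinate fields by its inverse, so the double trace is that of the old chart.\<close>

lemma chart_scal_independent:
  assumes c: "(V, \<phi>) \<in> charts M" "p \<in> V" and c': "(V', \<phi>') \<in> charts M" "p \<in> V'"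
  shows "chart_scal (V', \<phi>') p = chart_scal (V, \<phi>) p"
proof -
  define W where "W = V \<inter> V'"
  have W: "OP W" "p \<in> W" "W \<subseteq> V" "W \<subseteq> V'"
    using OP_Int[OF chart_openin[OF c(1)] chart_openin[OF c'(1)]] c c' by (auto simp: W_def)
  let ?x = "coord_fun (V, \<phi>)" and ?x' = "coord_fun (V', \<phi>')"
  note CW = VF_subset[OF VF_coord_field[OF c(1)] W(1,3)] VF_subset[OF VF_coord_field[OF c'(1)] W(1,4)]
  note GW = VF_subset[OF VF_grad[OF SF_coord_fun[OF c(1)]] W(1,3)]
    VF_subset[OF VF_grad[OF SF_coord_fun[OF c'(1)]] W(1,4)]
  note s = smooth_at_coord_fun[OF c] and s' = smooth_at_coord_fun[OF c']
  let ?m = "\<lambda>k b. CF (V, \<phi>) k p (?x' b)" and ?n = "\<lambda>b d. CF (V', \<phi>') b p (?x d)"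
  let ?ric = "\<lambda>A B. chart_ricci (V, \<phi>) A B p"
  have gx: "grad M g (?x' b) p (?x e) = (\<Sum>k\<in>Basis. ?m k b * grad M g (?x k) p (?x e))" for b e
  proof -
    have "grad M g (?x' b) p (?x e) = grad M g (?x e) p (?x' b)" by (rule grad_apply_sym[OF s' s])
    also have "\<dots> = (\<Sum>k\<in>Basis. grad M g (?x e) p (?x k) * ?m k b)"
      by (rule TS_expand_apply[OF grad_TS[OF s] c s'])
    finally show ?thesis by (simp only: grad_apply_sym[OF s s] mult.commute)
  qed
  have r1: "?ric (grad M g (?x' b)) (CF (V, \<phi>) d) = (\<Sum>k\<in>Basis. ?m k b * ?ric (grad M g (?x k)) (CF (V, \<phi>) d))" for b d
  proof -
    have "?ric (grad M g (?x' b)) (CF (V, \<phi>) d) =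
        (\<Sum>e\<in>Basis. (\<Sum>k\<in>Basis. ?m k b * grad M g (?x k) p (?x e)) * ?ric (CF (V, \<phi>) e) (CF (V, \<phi>) d))"
      unfolding chart_ricci_expand_left[OF GW(2) CW(1) W(2) c] gx ..
    also have "\<dots> = (\<Sum>k\<in>Basis. \<Sum>e\<in>Basis. ?m k b * (grad M g (?x k) p (?x e) * ?ric (CF (V, \<phi>) e) (CF (V, \<phi>) d)))"
      unfolding sum_distrib_right by (subst sum.swap) (simp only: mult.assoc)
    finally show ?thesis
      unfolding chart_ricci_expand_left[OF GW(1) CW(1) W(2) c] sum_distrib_left .
  qed
  have "(\<Sum>b\<in>Basis. ?ric (grad M g (?x' b)) (CF (V', \<phi>') b)) = (\<Sum>k\<in>Basis. ?ric (grad M g (?x k)) (CF (V, \<phi>) k))"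
  proof (rule trace_change_basis[where m = ?m and n = ?n and F = "\<lambda>k d. ?ric (grad M g (?x k)) (CF (V, \<phi>) d)"])
    fix b :: 'e assume "b \<in> Basis"
    have "?ric (grad M g (?x' b)) (CF (V', \<phi>') b) =
       (\<Sum>d\<in>Basis. ?n b d * (\<Sum>k\<in>Basis. ?m k b * ?ric (grad M g (?x k)) (CF (V, \<phi>) d)))"
      unfolding chart_ricci_expand_right[OF GW(2) CW(2) W(2) c] r1 ..
    also have "\<dots> = (\<Sum>d\<in>Basis. \<Sum>k\<in>Basis. ?m k b * ?n b d * ?ric (grad M g (?x k)) (CF (V, \<phi>) d))"
      unfolding sum_distrib_left by (simp only: mult_ac)
    also have "\<dots> = (\<Sum>k\<in>Basis. \<Sum>d\<in>Basis. ?m k b * ?n b d * ?ric (grad M g (?x k)) (CF (V, \<phi>) d))"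
      by (rule sum.swap)
    finally show "?ric (grad M g (?x' b)) (CF (V', \<phi>') b) =
       (\<Sum>k\<in>Basis. \<Sum>d\<in>Basis. ?m k b * ?n b d * ?ric (grad M g (?x k)) (CF (V, \<phi>) d))" .
  qed (simp_all add: coord_change_inverse[OF c c'])
  then show ?thesis
    unfolding chart_scal_def chart_ricci_independent[OF GW(2) CW(2) W(2) c c'] .
qed

text \<open>Near each point the varying chart of \<open>chart_at\<close> is replaced by a fixed one,
  where all ingredients are smooth fields. Smoothness matters because \<open>\<sigma>\<close> is
  going to be differentiated.\<close>

lemma SF_scalar_curvature: "SF (points M) (scalar_curvature M g)"
proof (rule SF_local)
  show "OP (points M)" by blast
  fix p assume "p \<in> points M"
  then obtain V \<phi> where c: "(V, \<phi>) \<in> charts M" "p \<in> V" using chart_cover by blast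
  have "SF V (\<lambda>q. chart_scal (V, \<phi>) q)"
    unfolding chart_scal_def chart_ricci_def
    by (intro SF_sum chart_openin[OF c(1)] VF_apply_coord_fun[OF _ c(1) order_refl]
        VF_riemann VF_grad SF_coord_fun[OF c(1)] VF_coord_field[OF c(1)])
  then have "SF V (scalar_curvature M g)"
  proof (rule SF_cong)
    fix q assume q: "q \<in> V"
    then have "q \<in> points M" using chart_openin[OF c(1)] openin_subset by blast
    then have "chart_at M q \<in> charts M \<and> q \<in> fst (chart_at M q)"
      unfolding chart_at_def using chart_cover by (intro someI_ex[of "\<lambda>c. c \<in> charts M \<and> q \<in> fst c"]) force
    then have "(fst (chart_at M q), snd (chart_at M q)) \<in> charts M" "q \<in> fst (chart_at M q)" by auto
    from chart_scal_independent[OF c(1) q this]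
    show "chart_scal (V, \<phi>) q = scalar_curvature M g q"
      unfolding scalar_curvature_eq by simp
  qed
  with c(2) show "\<exists>W. p \<in> W \<and> SF W (scalar_curvature M g)" by blast
qed

section \<open>Concircular symmetry implies local symmetry\<close>

lemma cov_deriv_13_apply:
  "cov_deriv_13 M g T W X Y Z p = D W (T X Y Z) p - T (D W X) Y Z p - T X (D W Y) Z p - T X Y (D W Z) p"
  unfolding cov_deriv_13_def Let_def vfield_diff_apply ..

text \<open>For commuting fields \<open>R X Y\<close> is the commutator of \<open>D Y\<close> and
  \<open>D X\<close>, so the terms in which \<open>Z\<close> is differentiated three times form the
  Jacobi identity for \<open>D W\<close>, \<open>D X\<close>, \<open>D Y\<close>. The remaining
  terms cancel in pairs, since vanishing torsion gives \<open>D W X p = D X W p\<close>.\<close>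

lemma second_bianchi_coord:
  assumes c: "(V, \<phi>) \<in> charts M" "p \<in> V" and abd: "a \<in> Basis" "b \<in> Basis" "d \<in> Basis"
    and Z: "VF V Z"
  defines "W \<equiv> CF (V, \<phi>) a" and "X \<equiv> CF (V, \<phi>) b" and "Y \<equiv> CF (V, \<phi>) d"
  shows "cov_deriv_13 M g R W X Y Z p + cov_deriv_13 M g R X Y W Z p + cov_deriv_13 M g R Y W X Z p = 0"
proof -
  have comm: "R (CF (V, \<phi>) i) (CF (V, \<phi>) j) A q = D (CF (V, \<phi>) j) (D (CF (V, \<phi>) i) A) q - D (CF (V, \<phi>) i) (D (CF (V, \<phi>) j) A) q"
    if "VF V A" "q \<in> V" "i \<in> Basis" "j \<in> Basis" for i j A q
  proof -
    note C = VF_coord_field[OF c(1)] and o = chart_openin[OF c(1)]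
    have "D (LB (CF (V, \<phi>) i) (CF (V, \<phi>) j)) A q = D ((\<lambda>q. 0) *\<^sub>v A) A q"
      by (rule D_local_left[OF VF_lie_bracket[OF C C] VF_scale[OF SF_const[OF o] that(1)] that(1,2)])
        (simp add: lie_bracket_coord_fields[OF c(1) _ that(3,4)] fun_eq_iff)
    also have "\<dots> = 0"
      unfolding D_scale_left[OF that(1,1,2) SF_const[OF o]] by (simp add: fun_eq_iff)
    finally show ?thesis unfolding riemann_apply by simp
  qed
  note VFs = VF_coord_field[OF c(1), of a, folded W_def] VF_coord_field[OF c(1), of b, folded X_def]
    VF_coord_field[OF c(1), of d, folded Y_def]
  have tor: "D A B p = D B A p" if "VF V A" "VF V B" "LB A B p = 0" for A B
    using D_torsion[OF that(1,2) c(2)] that(3) by simp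
  have L: "LB W X p = 0" "LB X Y p = 0" "LB Y W p = 0"
    unfolding W_def X_def Y_def by (rule lie_bracket_coord_fields[OF c]; fact)+
  have DR: "D A (R (CF (V, \<phi>) i) (CF (V, \<phi>) j) Z) p =
     D A (D (CF (V, \<phi>) j) (D (CF (V, \<phi>) i) Z)) p - D A (D (CF (V, \<phi>) i) (D (CF (V, \<phi>) j) Z)) p"
    if "VF V A" "i \<in> Basis" "j \<in> Basis" for A i j
  proof -
    note C = VF_coord_field[OF c(1)]
    have "D A (R (CF (V, \<phi>) i) (CF (V, \<phi>) j) Z) p =
      D A (D (CF (V, \<phi>) j) (D (CF (V, \<phi>) i) Z) - D (CF (V, \<phi>) i) (D (CF (V, \<phi>) j) Z)) p"
      by (rule D_local_right[OF that(1) VF_riemann[OF C C Z] VF_diff[OF VF_D[OF C VF_D[OF C Z]] VF_D[OF C VF_D[OF C Z]]] c(2)])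
        (simp only: vfield_diff_apply comm[OF Z _ that(2,3)])
    then show ?thesis
      by (simp only: D_diff_right[OF that(1) VF_D[OF C VF_D[OF C Z]] c(2) VF_D[OF C VF_D[OF C Z]]])
  qed
  \<comment> \<open>The pairing of the remaining terms: antisymmetry of the curvature together with
    \<open>D B C p = D C B p\<close>. As the curvature depends on values at \<open>p\<close> only,
    equality of the two derivatives at this point suffices.\<close>
  have sw: "R A (D B C) Z p = - R (D C B) A Z p" if "VF V A" "VF V B" "VF V C" "LB B C p = 0" for A B C
    unfolding riemann_anti[OF that(1) VF_D[OF that(2,3)] Z c(2)]
    by (rule arg_cong[where f = uminus],
        rule riemann_pointwise[OF VF_D[OF that(2,3)] that(1) Z VF_D[OF that(3,2)] that(1) Z c(2)])
      (simp_all only: tor[OF that(2,3,4)])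
  have L': "LB X W p = 0" "LB Y X p = 0" "LB W Y p = 0"
    using L lie_bracket_anti_apply[of X W p] lie_bracket_anti_apply[of Y X p] lie_bracket_anti_apply[of W Y p] by auto
  have DR': "D W (R X Y Z) p = D W (D Y (D X Z)) p - D W (D X (D Y Z)) p"
    "D X (R Y W Z) p = D X (D W (D Y Z)) p - D X (D Y (D W Z)) p"
    "D Y (R W X Z) p = D Y (D X (D W Z)) p - D Y (D W (D X Z)) p"
    using DR abd VFs unfolding W_def X_def Y_def by blast+
  have co: "R X Y (D W Z) p = D Y (D X (D W Z)) p - D X (D Y (D W Z)) p"
    "R Y W (D X Z) p = D W (D Y (D X Z)) p - D Y (D W (D X Z)) p"
    "R W X (D Y Z) p = D X (D W (D Y Z)) p - D W (D X (D Y Z)) p"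
    using comm[OF VF_D[OF VFs(1) Z] c(2) abd(2,3)] comm[OF VF_D[OF VFs(2) Z] c(2) abd(3,1)]
      comm[OF VF_D[OF VFs(3) Z] c(2) abd(1,2)] unfolding W_def X_def Y_def .
  show ?thesis
    unfolding cov_deriv_13_apply DR' co
      sw[OF VFs(2,1,3) L'(3)] sw[OF VFs(3,2,1) L'(1)] sw[OF VFs(1,3,2) L'(2)]
    by (simp add: algebra_simps)
qed

text \<open>The curvature tensor of constant curvature 1 in the present sign convention:
  \<open>R = \<kappa> G\<close> gives sectional curvature \<open>\<kappa>\<close> on every
  nondegenerate plane.\<close>

definition G :: "'a vfield \<Rightarrow> 'a vfield \<Rightarrow> 'a vfield \<Rightarrow> 'a vfield" where
  "G X Y Z = (\<lambda>p. g p (X p) (Z p)) *\<^sub>v Y - (\<lambda>p. g p (Y p) (Z p)) *\<^sub>v X"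

lemma G_apply: "G X Y Z p = g p (X p) (Z p) *\<^sub>t Y p - g p (Y p) (Z p) *\<^sub>t X p"
  unfolding G_def vfield_diff_apply vscale_apply ..

lemma VF_G: "VF U X \<Longrightarrow> VF U Y \<Longrightarrow> VF U Z \<Longrightarrow> VF U (G X Y Z)"
  unfolding G_def by (intro VF_diff VF_scale SF_g)

text \<open>\<open>G\<close> is built from \<open>g\<close> alone, and \<open>g\<close> is parallel
  by metric compatibility.\<close>

lemma cov_deriv_G:
  assumes W: "VF U W" and X: "VF U X" and Y: "VF U Y" and Z: "VF U Z" and p: "p \<in> U"
  shows "cov_deriv_13 M g G W X Y Z p = 0"
proof -
  have "D W (G X Y Z) p = (g p (D W X p) (Z p) + g p (X p) (D W Z p)) *\<^sub>t Y p + g p (X p) (Z p) *\<^sub>t D W Y p -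
     ((g p (D W Y p) (Z p) + g p (Y p) (D W Z p)) *\<^sub>t X p + g p (Y p) (Z p) *\<^sub>t D W X p)"
    unfolding G_def D_diff_right[OF W VF_scale[OF SF_g[OF X Z] Y] p VF_scale[OF SF_g[OF Y Z] X]]
      D_scale_right[OF W Y p SF_g[OF X Z]] D_scale_right[OF W X p SF_g[OF Y Z]]
      D_metric[OF W X p Z] D_metric[OF W Y p Z] ..
  then show ?thesis
    unfolding cov_deriv_13_apply G_apply by (simp add: fun_eq_iff algebra_simps)
qed

text \<open>Normalised such that a space of constant curvature has \<open>\<sigma>\<close> equal to
  that curvature; the concircular tensor is then \<open>R - \<sigma> G\<close>.\<close>

definition \<sigma> :: "'a \<Rightarrow> real" where
  "\<sigma> p = scalar_curvature M g p / (real DIM('e) * (real DIM('e) - 1))"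

lemma SF_\<sigma>: "SF (points M) \<sigma>"
  unfolding \<sigma>_def[abs_def] using SF_cmult[OF SF_scalar_curvature, of "1 / (real DIM('e) * (real DIM('e) - 1))"]
  by simp

lemma concircular_eq: "concircular M g X Y Z = R X Y Z - \<sigma> *\<^sub>v G X Y Z"
  unfolding concircular_def \<sigma>_def[abs_def] G_apply[abs_def] by (auto simp: fun_eq_iff G_apply)

lemma concircularly_symmetric_cov_deriv:
  assumes cs: "concircularly_symmetric M g"
    and W: "VF U W" and X: "VF U X" and Y: "VF U Y" and Z: "VF U Z" and p: "p \<in> U"
  shows "cov_deriv_13 M g R W X Y Z p = W p \<sigma> *\<^sub>t G X Y Z p"
proof -
  have s: "SF U \<sigma>" by (rule SF_subset[OF SF_\<sigma> VF_openin[OF W] openin_subset[OF VF_openin[OF W]]])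
  have "D W (concircular M g X Y Z) p = D W (R X Y Z) p - (W p \<sigma> *\<^sub>t G X Y Z p + \<sigma> p *\<^sub>t D W (G X Y Z) p)"
    unfolding concircular_eq D_diff_right[OF W VF_riemann[OF X Y Z] p VF_scale[OF s VF_G[OF X Y Z]]]
      D_scale_right[OF W VF_G[OF X Y Z] p s] ..
  then have "cov_deriv_13 M g (concircular M g) W X Y Z p =
      cov_deriv_13 M g R W X Y Z p - W p \<sigma> *\<^sub>t G X Y Z p - \<sigma> p *\<^sub>t cov_deriv_13 M g G W X Y Z p"
    unfolding cov_deriv_13_apply concircular_eq vfield_diff_apply vscale_apply
    by (simp add: fun_eq_iff algebra_simps)
  moreover have "cov_deriv_13 M g (concircular M g) W X Y Z p = 0"
    using cs W X Y Z p unfolding concircularly_symmetric_def parallel_13_def by blast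
  ultimately show ?thesis
    unfolding cov_deriv_G[OF W X Y Z p] by (simp add: fun_eq_iff)
qed

lemma concircularly_symmetric_deriv_zero:
  assumes cs: "concircularly_symmetric M g" and dim: "DIM('e) \<ge> 3"
    and c: "(V, \<phi>) \<in> charts M" "p \<in> V" and a: "a \<in> Basis"
  shows "CF (V, \<phi>) a p \<sigma> = 0"
proof -
  \<comment> \<open>Dimension at least 3 enters here: the indices \<open>b\<close> and
    \<open>d\<close> must differ from \<open>a\<close> and from each other.\<close>
  have "\<not> (Basis :: 'e set) \<subseteq> {a}"
    using dim card_mono[of "{a}" "Basis :: 'e set"] by auto
  then obtain b where b: "b \<in> Basis" "b \<noteq> a" by auto
  have "\<not> (Basis :: 'e set) \<subseteq> {a, b}"
    using dim card_mono[of "{a, b}" "Basis :: 'e set"] card_insert_le_m1[of 2 "{b}" a] by auto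
  then obtain d where d: "d \<in> Basis" "d \<noteq> a" "d \<noteq> b" by auto
  define W X Y where WXY: "W = CF (V, \<phi>) a" "X = CF (V, \<phi>) b" "Y = CF (V, \<phi>) d"
  note C = VF_coord_field[OF c(1)]
  have VFs: "VF V W" "VF V X" "VF V Y" unfolding WXY by (rule C)+
  note T = VF_TS[OF VFs(1) c(2)] VF_TS[OF VFs(2) c(2)] VF_TS[OF VFs(3) c(2)]
  have pM: "p \<in> points M" using VF_points[OF VFs(1) c(2)] .
  let ?x = "coord_fun (V, \<phi>)"
  have x: "W p (?x d) = 0" "X p (?x d) = 0" "Y p (?x d) = 1" "W p (?x a) = 1" "X p (?x a) = 0"
    "W p (?x b) = 0" "X p (?x b) = 1"
    unfolding WXY using coord_field_coord_fun[OF c] a b d by auto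
  have eq: "W p \<sigma> * g p (X p) w - X p \<sigma> * g p (W p) w = 0" if w: "w \<in> TS p" for w
  proof -
    \<comment> \<open>A field through \<open>w\<close> on the whole chart domain \<open>V\<close>,
      as \<open>second_bianchi_coord\<close> demands; \<open>VF_extend\<close> would only promise a
      smaller domain.\<close>
    let ?Z = "\<Sum>b\<in>Basis. (\<lambda>q. w (coord_fun (V, \<phi>) b)) *\<^sub>v CF (V, \<phi>) b"
    have VZ: "VF V ?Z"
      by (intro VF_sum VF_scale SF_const chart_openin[OF c(1)] VF_coord_field[OF c(1)])
    have Zp: "?Z p = w"
      using TS_expand[OF w c] by (simp add: sum_fun_apply)
    note nab = concircularly_symmetric_cov_deriv[OF cs _ _ _ VZ c(2)]
    have "W p \<sigma> *\<^sub>t G X Y ?Z p + X p \<sigma> *\<^sub>t G Y W ?Z p + Y p \<sigma> *\<^sub>t G W X ?Z p = 0"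
      using second_bianchi_coord[OF c a b(1) d(1) VZ, folded WXY]
      unfolding nab[OF VFs(1,2,3)] nab[OF VFs(2,3,1)] nab[OF VFs(3,1,2)] .
    \<comment> \<open>Among the three fields only \<open>Y\<close> has a nonzero
      \<open>x\<^sup>d\<close>-component, so just the two terms that carry \<open>Y\<close> as a
      vector remain.\<close>
    from fun_cong[OF this, of "?x d"] show ?thesis
      unfolding G_apply Zp by (simp add: x)
  qed
  \<comment> \<open>As \<open>w\<close> is arbitrary, nondegeneracy turns the scalar identity into a
    vector identity, whose \<open>x\<^sup>b\<close>-component is
    \<open>W \<sigma> = 0\<close>.\<close>
  have "W p \<sigma> *\<^sub>t X p - X p \<sigma> *\<^sub>t W p = 0"
  proof (rule g_nondegenerate[OF pM])
    show "W p \<sigma> *\<^sub>t X p - X p \<sigma> *\<^sub>t W p \<in> TS p" by (intro TS_diff_closed TS_scale_closed T)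
    fix w assume w: "w \<in> TS p"
    have "g p (W p \<sigma> *\<^sub>t X p - X p \<sigma> *\<^sub>t W p) w = g p (W p \<sigma> *\<^sub>t X p) w - g p (X p \<sigma> *\<^sub>t W p) w"
      by (intro g_diff_left pM TS_scale_closed T w)
    then show "g p (W p \<sigma> *\<^sub>t X p - X p \<sigma> *\<^sub>t W p) w = 0"
      using eq[OF w] by (simp only: g_scale_left[OF pM T(1) w] g_scale_left[OF pM T(2) w])
  qed
  from fun_cong[OF this, of "?x b"] have "W p \<sigma> = 0"
    by (simp add: x)
  then show ?thesis unfolding WXY .
qed

theorem concircularly_symmetric_imp_locally_symmetric:
  assumes cs: "concircularly_symmetric M g" and dim: "DIM('e) \<ge> 3"
  shows "locally_symmetric M g"
  unfolding locally_symmetric_def parallel_13_def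
proof (intro allI impI ballI)
  fix U W X Y Z p assume a: "VF U W \<and> VF U X \<and> VF U Y \<and> VF U Z" and p: "p \<in> U"
  then have V: "VF U W" "VF U X" "VF U Y" "VF U Z" by auto
  obtain V \<phi> where c: "(V, \<phi>) \<in> charts M" "p \<in> V" using chart_cover VF_points[OF V(1) p] by blast
  have "smooth_at M p \<sigma>" using smooth_atI[OF VF_points[OF V(1) p] SF_\<sigma>] .
  from TS_expand_apply[OF VF_TS[OF V(1) p] c this]
  have "W p \<sigma> = 0" using concircularly_symmetric_deriv_zero[OF cs dim c] by simp
  then show "cov_deriv_13 M g R W X Y Z p = 0"
    unfolding concircularly_symmetric_cov_deriv[OF cs V p] by (simp add: fun_eq_iff)
qed

end

section \<open>Product manifolds\<close>

lemma smooth_on_Pair: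
  fixes f :: "'e::euclidean_space \<Rightarrow> 'f::euclidean_space" and g :: "'e \<Rightarrow> 'g::euclidean_space"
  assumes "open S" "smooth_on S f" "smooth_on S g"
  shows "smooth_on S (\<lambda>x. (f x, g x))"
proof -
  have "smooth_on S (\<lambda>x. (f x, 0) + (0, g x))"
    by (intro smooth_on_add assms(1)
        smooth_on_linear_comp[OF assms(1) bounded_linear_Pair[OF bounded_linear_ident bounded_linear_zero] assms(2)]
        smooth_on_linear_comp[OF assms(1) bounded_linear_Pair[OF bounded_linear_zero bounded_linear_ident] assms(3)])
  then show ?thesis by simp
qed

lemma smooth_on_fst:
  fixes h :: "'e::euclidean_space \<Rightarrow> 'g::real_normed_vector"
  assumes "open S" "open T" "smooth_on S h"
  shows "smooth_on (S \<times> (T :: 'f::euclidean_space set)) (\<lambda>z. h (fst z))"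
  by (rule smooth_on_compose[OF open_Times[OF assms(1,2)] smooth_on_linear[OF open_Times[OF assms(1,2)] bounded_linear_fst] assms(3)])
    auto

lemma smooth_on_snd:
  fixes h :: "'f::euclidean_space \<Rightarrow> 'g::real_normed_vector"
  assumes "open S" "open T" "smooth_on T h"
  shows "smooth_on ((S :: 'e::euclidean_space set) \<times> T) (\<lambda>z. h (snd z))"
  by (rule smooth_on_compose[OF open_Times[OF assms(1,2)] smooth_on_linear[OF open_Times[OF assms(1,2)] bounded_linear_snd] assms(3)])
    auto

lemma map_prod_image_Times: "map_prod f g ` (A \<times> B) = f ` A \<times> g ` B"
  by force

lemma second_countable_prod_topology:
  assumes "second_countable_space X" "second_countable_space Y"
  shows "second_countable_space (prod_topology X Y)"
proof -
  obtain A B where A: "countable A" "\<And>S. S \<in> A \<Longrightarrow> openin X S"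
      "\<And>U x. openin X U \<Longrightarrow> x \<in> U \<Longrightarrow> \<exists>S\<in>A. x \<in> S \<and> S \<subseteq> U"
    and B: "countable B" "\<And>S. S \<in> B \<Longrightarrow> openin Y S"
      "\<And>U x. openin Y U \<Longrightarrow> x \<in> U \<Longrightarrow> \<exists>S\<in>B. x \<in> S \<and> S \<subseteq> U"
    using assms unfolding second_countable_space_def by metis
  let ?C = "(\<lambda>(S, T). S \<times> T) ` (A \<times> B)"
  have "countable ?C" using A(1) B(1) by blast
  moreover have "openin (prod_topology X Y) S" if "S \<in> ?C" for S
    using that A(2) B(2) by (auto simp: openin_prod_Times_iff)
  moreover have "\<exists>S\<in>?C. z \<in> S \<and> S \<subseteq> U" if "openin (prod_topology X Y) U" "z \<in> U" for U z
  proof -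
    obtain S T where ST: "openin X S" "openin Y T" "fst z \<in> S" "snd z \<in> T" "S \<times> T \<subseteq> U"
      using \<open>openin (prod_topology X Y) U\<close> \<open>z \<in> U\<close> unfolding openin_prod_topology_alt by (metis prod.collapse)
    obtain S' T' where "S' \<in> A" "fst z \<in> S'" "S' \<subseteq> S" "T' \<in> B" "snd z \<in> T'" "T' \<subseteq> T"
      using A(3)[OF ST(1,3)] B(3)[OF ST(2,4)] by blast
    then show ?thesis
      using ST(5) by (intro bexI[of _ "S' \<times> T'"]) (auto simp: mem_Times_iff)
  qed
  ultimately show ?thesis
    unfolding second_countable_space_def by (intro exI[of _ ?C] conjI ballI allI impI) (assumption | elim conjE)+
qed

lemma homeomorphic_map_map_prod:
  assumes "homeomorphic_map X X' f" "homeomorphic_map Y Y' g"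
  shows "homeomorphic_map (prod_topology X Y) (prod_topology X' Y') (map_prod f g)"
proof -
  obtain f' g' where "homeomorphic_maps X X' f f'" "homeomorphic_maps Y Y' g g'"
    using assms by (auto simp: homeomorphic_map_maps)
  then have "homeomorphic_maps (prod_topology X Y) (prod_topology X' Y') (\<lambda>(x,y). (f x, g y)) (\<lambda>(x,y). (f' x, g' y))"
    by (simp add: homeomorphic_maps_prod)
  moreover have "map_prod f g = (\<lambda>(x,y). (f x, g y))" by auto
  ultimately show ?thesis using homeomorphic_maps_imp_map by metis
qed

locale prod_smanifold = M1: smanifold M1 + M2: smanifold M2
  for M1 :: "('a, 'e::euclidean_space) manifold" and M2 :: "('b, 'f::euclidean_space) manifold"
begin

abbreviation "P \<equiv> prod_manifold M1 M2"

lemma mtop_prod [simp]: "mtop P = prod_topology (mtop M1) (mtop M2)"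
  by (simp add: prod_manifold_def)

lemma charts_prodI: "(V, \<phi>) \<in> charts M1 \<Longrightarrow> (W, \<psi>) \<in> charts M2 \<Longrightarrow> (V \<times> W, map_prod \<phi> \<psi>) \<in> charts P"
  unfolding prod_manifold_def by auto

lemma charts_prodE:
  assumes "(B, \<theta>) \<in> charts P"
  obtains V \<phi> W \<psi> where "B = V \<times> W" "\<theta> = map_prod \<phi> \<psi>" "(V, \<phi>) \<in> charts M1" "(W, \<psi>) \<in> charts M2"
  using assms unfolding prod_manifold_def by auto

lemma inv_into_map_prod:
  assumes c: "(V, \<phi>) \<in> charts M1" "(W, \<psi>) \<in> charts M2" and x: "x \<in> \<phi> ` V" "y \<in> \<psi> ` W"
  shows "inv_into (V \<times> W) (map_prod \<phi> \<psi>) (x, y) = (inv_into V \<phi> x, inv_into W \<psi> y)"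
proof -
  have "inj_on (map_prod \<phi> \<psi>) (V \<times> W)"
    using map_prod_inj_on[OF M1.chart_inj[OF c(1)] M2.chart_inj[OF c(2)]] .
  then show ?thesis
    by (rule inv_into_f_eq) (use x in \<open>auto simp: inv_into_into f_inv_into_f\<close>)
qed

lemma inv_map_prod_apply:
  assumes c: "(V, \<phi>) \<in> charts M1" "(W, \<psi>) \<in> charts M2" and "q \<in> V" "r \<in> W"
  shows "inv_into (V \<times> W) (map_prod \<phi> \<psi>) (\<phi> q, \<psi> r) = (q, r)"
  using assms by (simp add: inv_into_map_prod[OF c])

lemma smooth_manifold_prod: "smooth_manifold P"
  unfolding smooth_manifold_def
proof (intro conjI)
  note M1 = M1.smooth_manifold[unfolded smooth_manifold_def] and M2 = M2.smooth_manifold[unfolded smooth_manifold_def]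
  show "points P \<noteq> {}" using M1 M2 by simp
  show "Hausdorff_space (mtop P)" using M1 M2 by (simp add: Hausdorff_space_prod_topology)
  show "second_countable_space (mtop P)" using M1 M2 by (simp add: second_countable_prod_topology)
  show "(\<Union>(V, \<phi>)\<in>charts P. V) = points P"
  proof (intro equalityI subsetI)
    fix p assume "p \<in> points P"
    then have "fst p \<in> points M1" "snd p \<in> points M2" by (auto simp: mem_Times_iff)
    then obtain V \<phi> W \<psi> where c: "(V, \<phi>) \<in> charts M1" "fst p \<in> V" "(W, \<psi>) \<in> charts M2" "snd p \<in> W"
      using M1.chart_cover M2.chart_cover by meson
    show "p \<in> (\<Union>(V, \<phi>)\<in>charts P. V)"
      by (rule UN_I[OF charts_prodI[OF c(1,3)]]) (use c in \<open>simp add: mem_Times_iff\<close>)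
  next
    fix p assume "p \<in> (\<Union>(V, \<phi>)\<in>charts P. V)"
    then obtain B \<theta> where "(B, \<theta>) \<in> charts P" "p \<in> B" by blast
    then obtain V \<phi> W \<psi> where "p \<in> V \<times> W" "(V, \<phi>) \<in> charts M1" "(W, \<psi>) \<in> charts M2"
      by (metis charts_prodE)
    then show "p \<in> points P"
      using openin_subset[OF M1.chart_openin] openin_subset[OF M2.chart_openin]
      by (simp add: mem_Times_iff) blast
  qed
  show "\<forall>(V, \<phi>)\<in>charts P. openin (mtop P) V \<and> open (\<phi> ` V) \<and>
      homeomorphic_map (subtopology (mtop P) V) (top_of_set (\<phi> ` V)) \<phi>"
  proof (clarify elim!: charts_prodE)
    fix V \<phi> W \<psi> assume c: "(V, \<phi>) \<in> charts M1" "(W, \<psi>) \<in> charts M2"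
    have h: "homeomorphic_map (subtopology (mtop M1) V) (top_of_set (\<phi> ` V)) \<phi>"
      "homeomorphic_map (subtopology (mtop M2) W) (top_of_set (\<psi> ` W)) \<psi>"
      using M1 M2 c by auto
    show "openin (mtop P) (V \<times> W) \<and> open (map_prod \<phi> \<psi> ` (V \<times> W)) \<and>
        homeomorphic_map (subtopology (mtop P) (V \<times> W)) (top_of_set (map_prod \<phi> \<psi> ` (V \<times> W))) (map_prod \<phi> \<psi>)"
      using homeomorphic_map_map_prod[OF h] M1.chart_openin[OF c(1)] M2.chart_openin[OF c(2)]
        M1.chart_open_image[OF c(1)] M2.chart_open_image[OF c(2)]
      by (simp add: map_prod_image_Times subtopology_Times openin_prod_Times_iff open_Times)
  qed
  show "\<forall>(V, \<phi>)\<in>charts P. \<forall>(W, \<psi>)\<in>charts P. smooth_on (\<phi> ` (V \<inter> W)) (\<psi> \<circ> inv_into V \<phi>)"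
  proof (clarify elim!: charts_prodE)
    fix V \<phi> W \<psi> V' \<phi>' W' \<psi>'
    assume c: "(V, \<phi>) \<in> charts M1" "(W, \<psi>) \<in> charts M2" and c': "(V', \<phi>') \<in> charts M1" "(W', \<psi>') \<in> charts M2"
    let ?S = "\<phi> ` (V \<inter> V')" and ?T = "\<psi> ` (W \<inter> W')"
    have o: "open ?S" "open ?T"
      using M1.chart_open_image_Int[OF M1.chart_openin[OF c'(1)] c(1)] M2.chart_open_image_Int[OF M2.chart_openin[OF c'(2)] c(2)]
      by (simp_all add: Int_commute)
    have "smooth_on (?S \<times> ?T) (\<lambda>z. (\<phi>' (inv_into V \<phi> (fst z)), \<psi>' (inv_into W \<psi> (snd z))))"
      by (intro smooth_on_Pair open_Times o smooth_on_fst smooth_on_snd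
          M1.chart_transition[OF c(1) c'(1)] M2.chart_transition[OF c(2) c'(2)])
    then have "smooth_on (?S \<times> ?T) (map_prod \<phi>' \<psi>' \<circ> inv_into (V \<times> W) (map_prod \<phi> \<psi>))"
      by (rule smooth_on_cong[OF open_Times[OF o], rotated]) (auto simp: inv_into_map_prod[OF c])
    then show "smooth_on (map_prod \<phi> \<psi> ` (V \<times> W \<inter> V' \<times> W')) (map_prod \<phi>' \<psi>' \<circ> inv_into (V \<times> W) (map_prod \<phi> \<psi>))"
      by (simp add: Times_Int_Times map_prod_image_Times)
  qed
qed

end

sublocale prod_smanifold \<subseteq> P: smanifold "prod_manifold M1 M2"
  by standard (rule smooth_manifold_prod)

context prod_smanifold
begin

lemma OP_box: "M1.OP U \<Longrightarrow> M2.OP W \<Longrightarrow> P.OP (U \<times> W)"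
  by (simp add: openin_prod_Times_iff)

lemma chart_box:
  assumes U: "M1.OP U" "M2.OP W" and p: "p \<in> U \<times> W"
  obtains V \<phi> V' \<psi> A B where "(V, \<phi>) \<in> charts M1" "(V', \<psi>) \<in> charts M2" "M1.OP A" "M2.OP B"
    "A \<subseteq> U \<inter> V" "B \<subseteq> W \<inter> V'" "p \<in> A \<times> B" "P.OP (A \<times> B)"
proof -
  obtain V \<phi> where c: "(V, \<phi>) \<in> charts M1" "fst p \<in> V"
    using M1.chart_cover[of "fst p"] openin_subset[OF U(1)] p by (auto simp only: mem_Times_iff)
  obtain V' \<psi> where c': "(V', \<psi>) \<in> charts M2" "snd p \<in> V'"
    using M2.chart_cover[of "snd p"] openin_subset[OF U(2)] p by (auto simp only: mem_Times_iff)
  have o: "M1.OP (U \<inter> V)" "M2.OP (W \<inter> V')"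
    using M1.OP_Int[OF U(1) M1.chart_openin[OF c(1)]] M2.OP_Int[OF U(2) M2.chart_openin[OF c'(1)]] .
  show ?thesis
    by (rule that[OF c(1) c'(1) o order_refl order_refl _ OP_box[OF o]])
      (use p c c' in \<open>auto simp: mem_Times_iff\<close>)
qed

lemma SF_fst:
  assumes h: "M1.SF U h" and W: "M2.OP W"
  shows "P.SF (U \<times> W) (\<lambda>p. h (fst p))"
proof (rule P.SF_local)
  note U = M1.SF_openin[OF h]
  show "P.OP (U \<times> W)" using OP_box[OF U W] .
  fix p assume "p \<in> U \<times> W"
  then obtain V \<phi> V' \<psi> A B where c: "(V, \<phi>) \<in> charts M1" "(V', \<psi>) \<in> charts M2"
    and A: "M1.OP A" "M2.OP B" "A \<subseteq> U \<inter> V" "B \<subseteq> W \<inter> V'" "p \<in> A \<times> B" "P.OP (A \<times> B)"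
    by (rule chart_box[OF U W])
  have o: "open (\<phi> ` A)" "open (\<psi> ` B)"
    using M1.chart_open_image[OF c(1) A(1)] M2.chart_open_image[OF c(2) A(2)] A by auto
  have "smooth_on (\<phi> ` A) (\<lambda>x. h (inv_into V \<phi> x))"
    by (rule smooth_on_subset[OF M1.SF_chart[OF h c(1)]]) (use A in blast)
  then have "smooth_on (\<phi> ` A \<times> \<psi> ` B) (\<lambda>z. h (inv_into V \<phi> (fst z)))"
    by (rule smooth_on_fst[OF o])
  then have "smooth_on (map_prod \<phi> \<psi> ` (A \<times> B)) (\<lambda>z. h (fst (inv_into (V \<times> V') (map_prod \<phi> \<psi>) z)))"
    unfolding map_prod_image_Times
    by (rule smooth_on_cong[OF open_Times[OF o], rotated])
      (use A c in \<open>auto simp: inv_map_prod_apply[OF c] subset_iff\<close>)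
  moreover have "A \<times> B \<subseteq> V \<times> V'" using A by auto
  ultimately have "P.SF (A \<times> B) (\<lambda>p. h (fst p))"
    by (intro P.SFI_chart[OF charts_prodI[OF c] A(6), where h = "\<lambda>p. h (fst p)"])
  with A(5) show "\<exists>W. p \<in> W \<and> P.SF W (\<lambda>p. h (fst p))"
    by (intro exI[of _ "A \<times> B"] conjI)
qed

lemma SF_snd:
  assumes U: "M1.OP U" and h: "M2.SF W h"
  shows "P.SF (U \<times> W) (\<lambda>p. h (snd p))"
proof (rule P.SF_local)
  note W = M2.SF_openin[OF h]
  show "P.OP (U \<times> W)" using OP_box[OF U W] .
  fix p assume "p \<in> U \<times> W"
  then obtain V \<phi> V' \<psi> A B where c: "(V, \<phi>) \<in> charts M1" "(V', \<psi>) \<in> charts M2"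
    and A: "M1.OP A" "M2.OP B" "A \<subseteq> U \<inter> V" "B \<subseteq> W \<inter> V'" "p \<in> A \<times> B" "P.OP (A \<times> B)"
    by (rule chart_box[OF U W])
  have o: "open (\<phi> ` A)" "open (\<psi> ` B)"
    using M1.chart_open_image[OF c(1) A(1)] M2.chart_open_image[OF c(2) A(2)] A by auto
  have "smooth_on (\<psi> ` B) (\<lambda>x. h (inv_into V' \<psi> x))"
    by (rule smooth_on_subset[OF M2.SF_chart[OF h c(2)]]) (use A in blast)
  then have "smooth_on (\<phi> ` A \<times> \<psi> ` B) (\<lambda>z. h (inv_into V' \<psi> (snd z)))"
    by (rule smooth_on_snd[OF o])
  then have "smooth_on (map_prod \<phi> \<psi> ` (A \<times> B)) (\<lambda>z. h (snd (inv_into (V \<times> V') (map_prod \<phi> \<psi>) z)))"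
    unfolding map_prod_image_Times
    by (rule smooth_on_cong[OF open_Times[OF o], rotated])
      (use A c in \<open>auto simp: inv_map_prod_apply[OF c] subset_iff\<close>)
  moreover have "A \<times> B \<subseteq> V \<times> V'" using A by auto
  ultimately have "P.SF (A \<times> B) (\<lambda>p. h (snd p))"
    by (intro P.SFI_chart[OF charts_prodI[OF c] A(6), where h = "\<lambda>p. h (snd p)"])
  with A(5) show "\<exists>W. p \<in> W \<and> P.SF W (\<lambda>p. h (snd p))"
    by (intro exI[of _ "A \<times> B"] conjI)
qed

lemma smooth_at_fst:
  assumes "smooth_at M1 (fst p) h" "snd p \<in> points M2"
  shows "smooth_at P p (\<lambda>z. h (fst z))"
proof -
  obtain U where "fst p \<in> U" "M1.SF U h" using assms(1) unfolding smooth_at_def by blast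
  then show ?thesis
    using P.smooth_atI[OF _ SF_fst[of U h "points M2"]] assms(2) by (auto simp: mem_Times_iff)
qed

lemma smooth_at_snd:
  assumes "smooth_at M2 (snd p) h" "fst p \<in> points M1"
  shows "smooth_at P p (\<lambda>z. h (snd z))"
proof -
  obtain U where "snd p \<in> U" "M2.SF U h" using assms(1) unfolding smooth_at_def by blast
  then show ?thesis
    using P.smooth_atI[OF _ SF_snd[of "points M1" U h]] assms(2) by (auto simp: mem_Times_iff)
qed

text \<open>Composition with the two slice inclusions through \<open>p\<close>; it is what makes
  their differentials map derivations to derivations.\<close>

lemma
  assumes "smooth_at P p h"
  shows smooth_at_slice1: "smooth_at M1 (fst p) (\<lambda>q. h (q, snd p))"
    and smooth_at_slice2: "smooth_at M2 (snd p) (\<lambda>q. h (fst p, q))"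
proof -
  obtain U where U: "p \<in> U" "P.SF U h" using assms unfolding smooth_at_def by blast
  have "openin (prod_topology (mtop M1) (mtop M2)) U" using P.SF_openin[OF U(2)] by simp
  with U(1) obtain S T where ST: "M1.OP S" "M2.OP T" "p \<in> S \<times> T" "S \<times> T \<subseteq> U"
    unfolding openin_prod_topology_alt by (metis mem_Sigma_iff prod.collapse)
  obtain V \<phi> V' \<psi> A B where c: "(V, \<phi>) \<in> charts M1" "(V', \<psi>) \<in> charts M2"
    and A: "M1.OP A" "M2.OP B" "A \<subseteq> S \<inter> V" "B \<subseteq> T \<inter> V'" "p \<in> A \<times> B" "P.OP (A \<times> B)"
    by (rule chart_box[OF ST(1-3)])
  have o: "open (\<phi> ` A)" "open (\<psi> ` B)"
    using M1.chart_open_image[OF c(1) A(1)] M2.chart_open_image[OF c(2) A(2)] A by auto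
  have "smooth_on (\<phi> ` A \<times> \<psi> ` B) (\<lambda>z. h (inv_into (V \<times> V') (map_prod \<phi> \<psi>) z))"
    using smooth_on_subset[OF P.SF_chart[OF U(2) charts_prodI[OF c]], of "map_prod \<phi> \<psi> ` (A \<times> B)"] A ST(4)
    unfolding map_prod_image_Times[symmetric] by blast
  then have s: "smooth_on (\<phi> ` A \<times> \<psi> ` B) (\<lambda>z. h (inv_into V \<phi> (fst z), inv_into V' \<psi> (snd z)))"
    by (rule smooth_on_cong[OF open_Times[OF o], rotated])
      (use A c in \<open>auto simp: inv_map_prod_apply[OF c] subset_iff\<close>)
  have p: "fst p \<in> A" "snd p \<in> B" using A(5) by (auto simp: mem_Times_iff)
  have q: "inv_into V \<phi> (\<phi> (fst p)) = fst p" "inv_into V' \<psi> (\<psi> (snd p)) = snd p"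
    using p A c by auto
  have "smooth_on (\<phi> ` A) (\<lambda>x. h (inv_into V \<phi> (fst (x, \<psi> (snd p))), inv_into V' \<psi> (snd (x, \<psi> (snd p)))))"
    by (rule smooth_on_compose[OF o(1) smooth_on_Pair[OF o(1) smooth_on_linear[OF o(1) bounded_linear_ident] smooth_on_const] s])
      (use p in auto)
  then have "M1.SF A (\<lambda>q. h (q, snd p))"
    using A q by (intro M1.SFI_chart[OF c(1) A(1)]) auto
  then show "smooth_at M1 (fst p) (\<lambda>q. h (q, snd p))"
    using M1.smooth_atI p by blast
  have "smooth_on (\<psi> ` B) (\<lambda>x. h (inv_into V \<phi> (fst (\<phi> (fst p), x)), inv_into V' \<psi> (snd (\<phi> (fst p), x))))"
    by (rule smooth_on_compose[OF o(2) smooth_on_Pair[OF o(2) smooth_on_const smooth_on_linear[OF o(2) bounded_linear_ident]] s])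
      (use p in auto)
  then have "M2.SF B (\<lambda>q. h (fst p, q))"
    using A q by (intro M2.SFI_chart[OF c(2) A(2)]) auto
  then show "smooth_at M2 (snd p) (\<lambda>q. h (fst p, q))"
    using M2.smooth_atI p by blast
qed

end

section \<open>Splitting of the tangent spaces of a product\<close>

lemma pushforward_add: "pushforward N F p (v + w) = pushforward N F p v + pushforward N F p w"
  by (auto simp: pushforward_def fun_eq_iff)

lemma pushforward_diff: "pushforward N F p (v - w) = pushforward N F p v - pushforward N F p w"
  by (auto simp: pushforward_def fun_eq_iff)

lemma pushforward_zero: "pushforward N F p 0 = 0"
  by (auto simp: pushforward_def fun_eq_iff)

lemma pushforward_scale: "pushforward N F p (c *\<^sub>t v) = c *\<^sub>t pushforward N F p v"
  by (auto simp: pushforward_def fun_eq_iff)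

lemma pushforward_TS:
  assumes M: "smanifold M" and N: "smanifold N" and F: "\<And>h. smooth_at N (F p) h \<Longrightarrow> smooth_at M p (\<lambda>q. h (F q))"
    and v: "v \<in> tangent_space M p"
  shows "pushforward N F p v \<in> tangent_space N (F p)"
proof -
  interpret M: smanifold M by fact
  interpret N: smanifold N by fact
  show ?thesis
    unfolding tangent_space_def
  proof (intro CollectI conjI allI impI)
    show "pushforward N F p v h = 0" if "\<not> smooth_at N (F p) h" for h
      using that by (simp add: pushforward_def)
    show "pushforward N F p v (\<lambda>q. c * h q) = c * pushforward N F p v h" if "smooth_at N (F p) h" for c h
      using that N.smooth_at_cmult[OF that] M.TS_cmult[OF v F[OF that]]
      by (simp add: pushforward_def o_def)
    fix h k assume "smooth_at N (F p) h \<and> smooth_at N (F p) k"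
    then have h: "smooth_at N (F p) h" and k: "smooth_at N (F p) k" by auto
    show "pushforward N F p v (\<lambda>q. h q + k q) = pushforward N F p v h + pushforward N F p v k"
      using h k N.smooth_at_add[OF h k] M.TS_add[OF v F[OF h] F[OF k]]
      by (simp add: pushforward_def o_def)
    show "pushforward N F p v (\<lambda>q. h q * k q) = pushforward N F p v h * k (F p) + h (F p) * pushforward N F p v k"
      using h k N.smooth_at_mult[OF h k] M.TS_mult[OF v F[OF h] F[OF k]]
      by (simp add: pushforward_def o_def)
  qed
qed

context prod_smanifold
begin

text \<open>The splitting of the tangent space at \<open>p\<close>: \<open>push1\<close> and
  \<open>push2\<close> are its projections, \<open>emb1\<close> and \<open>emb2\<close> the
  inclusions given by the slices through \<open>p\<close>. The lifts use at each point the slice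
  through that point, so they are fields on the product.\<close>

definition "push1 p v = pushforward M1 fst p v"
definition "push2 p v = pushforward M2 snd p v"
definition "emb1 p v = pushforward P (\<lambda>q. (q, snd p)) (fst p) v"
definition "emb2 p v = pushforward P (\<lambda>q. (fst p, q)) (snd p) v"
definition "lift1 X = (\<lambda>p. emb1 p (X (fst p)))"
definition "lift2 X = (\<lambda>p. emb2 p (X (snd p)))"

lemma lift1_apply: "lift1 X p = emb1 p (X (fst p))"
  by (simp add: lift1_def)

lemma lift2_apply: "lift2 X p = emb2 p (X (snd p))"
  by (simp add: lift2_def)

lemmas push_simps =
  pushforward_add[of M1 fst, folded push1_def] pushforward_diff[of M1 fst, folded push1_def]
  pushforward_zero[of M1 fst, folded push1_def] pushforward_scale[of M1 fst, folded push1_def]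
  pushforward_add[of M2 snd, folded push2_def] pushforward_diff[of M2 snd, folded push2_def]
  pushforward_zero[of M2 snd, folded push2_def] pushforward_scale[of M2 snd, folded push2_def]

lemma emb_simps:
  "emb1 p (v + w) = emb1 p v + emb1 p w" "emb1 p (v - w) = emb1 p v - emb1 p w"
  "emb1 p 0 = 0" "emb1 p (c *\<^sub>t v) = c *\<^sub>t emb1 p v"
  "emb2 p (v' + w') = emb2 p v' + emb2 p w'" "emb2 p (v' - w') = emb2 p v' - emb2 p w'"
  "emb2 p 0 = 0" "emb2 p (c *\<^sub>t v') = c *\<^sub>t emb2 p v'"
  unfolding emb1_def emb2_def by (rule pushforward_add pushforward_diff pushforward_zero pushforward_scale)+

context
  fixes p assumes p: "p \<in> points P"
begin

lemma fst_snd_points: "fst p \<in> points M1" "snd p \<in> points M2"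
  using p by (auto simp: mem_Times_iff)

lemma push1_TS: "v \<in> P.TS p \<Longrightarrow> push1 p v \<in> M1.TS (fst p)"
  unfolding push1_def
  by (rule pushforward_TS[OF P.smanifold_axioms M1.smanifold_axioms smooth_at_fst[OF _ fst_snd_points(2)]])

lemma push2_TS: "v \<in> P.TS p \<Longrightarrow> push2 p v \<in> M2.TS (snd p)"
  unfolding push2_def
  by (rule pushforward_TS[OF P.smanifold_axioms M2.smanifold_axioms smooth_at_snd[OF _ fst_snd_points(1)]])

lemma emb1_TS: "v \<in> M1.TS (fst p) \<Longrightarrow> emb1 p v \<in> P.TS p"
  using pushforward_TS[OF M1.smanifold_axioms P.smanifold_axioms, of "\<lambda>q. (q, snd p)" "fst p" v]
    smooth_at_slice1 unfolding emb1_def by auto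

lemma emb2_TS: "v \<in> M2.TS (snd p) \<Longrightarrow> emb2 p v \<in> P.TS p"
  using pushforward_TS[OF M2.smanifold_axioms P.smanifold_axioms, of "\<lambda>q. (fst p, q)" "snd p" v]
    smooth_at_slice2 unfolding emb2_def by auto

lemma push1_apply: "smooth_at M1 (fst p) h \<Longrightarrow> push1 p v h = v (\<lambda>z. h (fst z))"
  by (simp add: push1_def pushforward_def o_def)

lemma push2_apply: "smooth_at M2 (snd p) h \<Longrightarrow> push2 p v h = v (\<lambda>z. h (snd z))"
  by (simp add: push2_def pushforward_def o_def)

lemma emb1_fst: "smooth_at M1 (fst p) h \<Longrightarrow> emb1 p v (\<lambda>z. h (fst z)) = v h"
  using smooth_at_fst[OF _ fst_snd_points(2)] by (simp add: emb1_def pushforward_def o_def)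

lemma emb2_snd: "smooth_at M2 (snd p) h \<Longrightarrow> emb2 p v (\<lambda>z. h (snd z)) = v h"
  using smooth_at_snd[OF _ fst_snd_points(1)] by (simp add: emb2_def pushforward_def o_def)

text \<open>A function of the second coordinate is constant along the slice that defines
  \<open>emb1\<close>.\<close>

lemma emb1_snd: "v \<in> M1.TS (fst p) \<Longrightarrow> emb1 p v (\<lambda>z. h (snd z)) = 0"
  using M1.TS_const[OF _ fst_snd_points(1)] by (simp add: emb1_def pushforward_def o_def)

lemma emb2_fst: "v \<in> M2.TS (snd p) \<Longrightarrow> emb2 p v (\<lambda>z. h (fst z)) = 0"
  using M2.TS_const[OF _ fst_snd_points(2)] by (simp add: emb2_def pushforward_def o_def)

lemma push1_emb1: "v \<in> M1.TS (fst p) \<Longrightarrow> push1 p (emb1 p v) = v"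
proof
  fix h assume v: "v \<in> M1.TS (fst p)"
  show "push1 p (emb1 p v) h = v h"
  proof (cases "smooth_at M1 (fst p) h")
    case True
    then show ?thesis by (simp only: push1_apply emb1_fst)
  next
    case False
    then show ?thesis using M1.TS_nonsmooth[OF v False] by (simp add: push1_def pushforward_def)
  qed
qed

lemma push2_emb2: "v \<in> M2.TS (snd p) \<Longrightarrow> push2 p (emb2 p v) = v"
proof
  fix h assume v: "v \<in> M2.TS (snd p)"
  show "push2 p (emb2 p v) h = v h"
  proof (cases "smooth_at M2 (snd p) h")
    case True
    then show ?thesis by (simp only: push2_apply emb2_snd)
  next
    case False
    then show ?thesis using M2.TS_nonsmooth[OF v False] by (simp add: push2_def pushforward_def)
  qed
qed

lemma push2_emb1: "v \<in> M1.TS (fst p) \<Longrightarrow> push2 p (emb1 p v) = 0"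
  using emb1_snd by (auto simp: push2_def pushforward_def o_def fun_eq_iff)

lemma push1_emb2: "v \<in> M2.TS (snd p) \<Longrightarrow> push1 p (emb2 p v) = 0"
  using emb2_fst by (auto simp: push1_def pushforward_def o_def fun_eq_iff)

lemma coord_fun_prod:
  "coord_fun (V \<times> W, map_prod \<phi> \<psi>) b = (\<lambda>z. coord_fun (V, \<phi>) (fst b) (fst z) + coord_fun (W, \<psi>) (snd b) (snd z))"
  by (simp add: coord_fun_def inner_prod_def fun_eq_iff)

text \<open>A coordinate function of the product is a sum of one function from each factor, so basis
  vectors \<open>(a, 0)\<close> and \<open>(0, a)\<close> of the product model space can be treated
  together.\<close>

lemma TS_coord_fun_prod:
  assumes u: "u \<in> P.TS p" and c: "(V, \<phi>) \<in> charts M1" "fst p \<in> V" "(W, \<psi>) \<in> charts M2" "snd p \<in> W"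
  shows "u (coord_fun (V \<times> W, map_prod \<phi> \<psi>) b) =
    push1 p u (coord_fun (V, \<phi>) (fst b)) + push2 p u (coord_fun (W, \<psi>) (snd b))"
proof -
  note s = M1.smooth_at_coord_fun[OF c(1,2)] M2.smooth_at_coord_fun[OF c(3,4)]
  show ?thesis
    unfolding coord_fun_prod push1_apply[OF s(1)] push2_apply[OF s(2)]
    by (rule P.TS_add[OF u smooth_at_fst[OF s(1) fst_snd_points(2)] smooth_at_snd[OF s(2) fst_snd_points(1)]])
qed

lemma push_eqI:
  assumes u: "u \<in> P.TS p" "v \<in> P.TS p" and eq: "push1 p u = push1 p v" "push2 p u = push2 p v"
  shows "u = v"
proof -
  obtain V \<phi> W \<psi> where c: "(V, \<phi>) \<in> charts M1" "fst p \<in> V" "(W, \<psi>) \<in> charts M2" "snd p \<in> W"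
    using M1.chart_cover[OF fst_snd_points(1)] M2.chart_cover[OF fst_snd_points(2)] by blast
  show ?thesis
  proof (rule P.TS_eqI[OF u charts_prodI[OF c(1,3)]])
    show "p \<in> V \<times> W" using c by (simp add: mem_Times_iff)
    show "u (coord_fun (V \<times> W, map_prod \<phi> \<psi>) b) = v (coord_fun (V \<times> W, map_prod \<phi> \<psi>) b)" for b
      unfolding TS_coord_fun_prod[OF u(1) c] TS_coord_fun_prod[OF u(2) c] eq ..
  qed
qed

lemma push_decompose:
  assumes u: "u \<in> P.TS p"
  shows "u = emb1 p (push1 p u) + emb2 p (push2 p u)"
proof (rule push_eqI[OF u])
  note T = push1_TS[OF u] push2_TS[OF u]
  show "emb1 p (push1 p u) + emb2 p (push2 p u) \<in> P.TS p"
    by (intro P.TS_add_closed emb1_TS emb2_TS T)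
  show "push1 p u = push1 p (emb1 p (push1 p u) + emb2 p (push2 p u))"
    unfolding push_simps push1_emb1[OF T(1)] push1_emb2[OF T(2)] by simp
  show "push2 p u = push2 p (emb1 p (push1 p u) + emb2 p (push2 p u))"
    unfolding push_simps push2_emb2[OF T(2)] push2_emb1[OF T(1)] by simp
qed

end

section \<open>Lifts of vector fields and their brackets\<close>

lemma VF_lift1:
  assumes X: "M1.VF U X" and W: "M2.OP W"
  shows "P.VF (U \<times> W) (lift1 X)"
proof (rule P.VF_local)
  note U = M1.VF_openin[OF X]
  show oUW: "P.OP (U \<times> W)" using OP_box[OF U W] .
  fix p assume p: "p \<in> U \<times> W"
  then obtain V \<phi> V' \<psi> A B where c: "(V, \<phi>) \<in> charts M1" "(V', \<psi>) \<in> charts M2"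
    and A: "M1.OP A" "M2.OP B" "A \<subseteq> U \<inter> V" "B \<subseteq> W \<inter> V'" "p \<in> A \<times> B" "P.OP (A \<times> B)"
    by (rule chart_box[OF U W])
  have q: "fst q \<in> U" "fst q \<in> V" "snd q \<in> V'" "q \<in> points P" if "q \<in> A \<times> B" for q
    using that A(3,4) openin_subset[OF A(6)] by (auto simp: mem_Times_iff)
  have T: "lift1 X q \<in> P.TS q" if "q \<in> A \<times> B" for q
    unfolding lift1_apply by (rule emb1_TS[OF q(4)[OF that] M1.VF_TS[OF X q(1)[OF that]]])
  have "P.VF (A \<times> B) (lift1 X)"
  proof (rule P.VF_chartI[OF charts_prodI[OF c] A(6) _ T])
    show "A \<times> B \<subseteq> V \<times> V'" using A by auto
    fix b :: "'e \<times> 'f"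
    have "M1.SF A (\<lambda>r. X r (coord_fun (V, \<phi>) (fst b)))"
      by (rule M1.VF_apply_coord_fun[OF M1.VF_subset[OF X A(1)] c(1)]) (use A in auto)
    from SF_fst[OF this A(2)]
    show "P.SF (A \<times> B) (\<lambda>q. lift1 X q (coord_fun (V \<times> V', map_prod \<phi> \<psi>) b))"
    proof (rule P.SF_cong)
      fix q assume "q \<in> A \<times> B"
      note q' = q[OF this] and Tq = T[OF this]
      note Xq = M1.VF_TS[OF X q'(1)]
      show "X (fst q) (coord_fun (V, \<phi>) (fst b)) = lift1 X q (coord_fun (V \<times> V', map_prod \<phi> \<psi>) b)"
        unfolding TS_coord_fun_prod[OF q'(4) Tq c(1) q'(2) c(2) q'(3)]
        unfolding lift1_apply push1_emb1[OF q'(4) Xq] push2_emb1[OF q'(4) Xq] by simp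
    qed
  qed
  with A(5) show "\<exists>W. p \<in> W \<and> P.VF W (lift1 X)"
    by (intro exI[of _ "A \<times> B"] conjI)
qed

lemma VF_lift2:
  assumes U: "M1.OP U" and X: "M2.VF W X"
  shows "P.VF (U \<times> W) (lift2 X)"
proof (rule P.VF_local)
  note W = M2.VF_openin[OF X]
  show oUW: "P.OP (U \<times> W)" using OP_box[OF U W] .
  fix p assume p: "p \<in> U \<times> W"
  then obtain V \<phi> V' \<psi> A B where c: "(V, \<phi>) \<in> charts M1" "(V', \<psi>) \<in> charts M2"
    and A: "M1.OP A" "M2.OP B" "A \<subseteq> U \<inter> V" "B \<subseteq> W \<inter> V'" "p \<in> A \<times> B" "P.OP (A \<times> B)"
    by (rule chart_box[OF U W])
  have q: "snd q \<in> W" "fst q \<in> V" "snd q \<in> V'" "q \<in> points P" if "q \<in> A \<times> B" for q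
    using that A(3,4) openin_subset[OF A(6)] by (auto simp: mem_Times_iff)
  have T: "lift2 X q \<in> P.TS q" if "q \<in> A \<times> B" for q
    unfolding lift2_apply by (rule emb2_TS[OF q(4)[OF that] M2.VF_TS[OF X q(1)[OF that]]])
  have "P.VF (A \<times> B) (lift2 X)"
  proof (rule P.VF_chartI[OF charts_prodI[OF c] A(6) _ T])
    show "A \<times> B \<subseteq> V \<times> V'" using A by auto
    fix b :: "'e \<times> 'f"
    have "M2.SF B (\<lambda>r. X r (coord_fun (V', \<psi>) (snd b)))"
      by (rule M2.VF_apply_coord_fun[OF M2.VF_subset[OF X A(2)] c(2)]) (use A in auto)
    from SF_snd[OF A(1) this]
    show "P.SF (A \<times> B) (\<lambda>q. lift2 X q (coord_fun (V \<times> V', map_prod \<phi> \<psi>) b))"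
    proof (rule P.SF_cong)
      fix q assume "q \<in> A \<times> B"
      note q' = q[OF this] and Tq = T[OF this]
      note Xq = M2.VF_TS[OF X q'(1)]
      show "X (snd q) (coord_fun (V', \<psi>) (snd b)) = lift2 X q (coord_fun (V \<times> V', map_prod \<phi> \<psi>) b)"
        unfolding TS_coord_fun_prod[OF q'(4) Tq c(1) q'(2) c(2) q'(3)]
        unfolding lift2_apply push2_emb2[OF q'(4) Xq] push1_emb2[OF q'(4) Xq] by simp
    qed
  qed
  with A(5) show "\<exists>W. p \<in> W \<and> P.VF W (lift2 X)"
    by (intro exI[of _ "A \<times> B"] conjI)
qed

context
  fixes U W p
  assumes U: "M1.OP U" and W: "M2.OP W" and p: "p \<in> U \<times> W"
begin

lemma box_points: "p \<in> points P"
  using openin_subset[OF OP_box[OF U W]] p by blast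

lemma lift1_fst_apply:
  assumes "M1.VF U X" "smooth_at M1 (fst p) h"
  shows "lift1 X p (\<lambda>z. h (fst z)) = X (fst p) h"
  unfolding lift1_apply by (rule emb1_fst[OF box_points assms(2)])

lemma lift2_snd_apply:
  assumes "M2.VF W X" "smooth_at M2 (snd p) h"
  shows "lift2 X p (\<lambda>z. h (snd z)) = X (snd p) h"
  unfolding lift2_apply by (rule emb2_snd[OF box_points assms(2)])

lemma lift1_snd_apply:
  assumes "M1.VF U X"
  shows "lift1 X p (\<lambda>z. h (snd z)) = 0"
  unfolding lift1_apply by (rule emb1_snd[OF box_points M1.VF_TS[OF assms]]) (use p in auto)

lemma lift2_fst_apply:
  assumes "M2.VF W X"
  shows "lift2 X p (\<lambda>z. h (fst z)) = 0"
  unfolding lift2_apply by (rule emb2_fst[OF box_points M2.VF_TS[OF assms]]) (use p in auto)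

end

text \<open>Tangent vectors of the product agree if their push-forwards do, so a bracket has to be
  tested only on functions pulled back from one of the factors.\<close>

lemma lie_bracket_eqI:
  assumes U: "M1.OP U" and W: "M2.OP W" and p: "p \<in> U \<times> W"
    and X: "P.VF (U \<times> W) X" and Y: "P.VF (U \<times> W) Y" and v: "v \<in> P.TS p"
    and 1: "\<And>A h. fst p \<in> A \<Longrightarrow> A \<subseteq> U \<Longrightarrow> M1.SF A h \<Longrightarrow>
      X p (\<lambda>q. Y q (\<lambda>z. h (fst z))) - Y p (\<lambda>q. X q (\<lambda>z. h (fst z))) = v (\<lambda>z. h (fst z))"
    and 2: "\<And>B h. snd p \<in> B \<Longrightarrow> B \<subseteq> W \<Longrightarrow> M2.SF B h \<Longrightarrow>
      X p (\<lambda>q. Y q (\<lambda>z. h (snd z))) - Y p (\<lambda>q. X q (\<lambda>z. h (snd z))) = v (\<lambda>z. h (snd z))"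
  shows "P.LB X Y p = v"
proof (rule push_eqI[OF box_points[OF U W p] P.VF_TS[OF P.VF_lie_bracket[OF X Y] p] v])
  note pP = box_points[OF U W p]
  have p': "fst p \<in> U" "snd p \<in> W" using p by (auto simp: mem_Times_iff)
  note T = P.VF_TS[OF P.VF_lie_bracket[OF X Y] p]
  show "push1 p (P.LB X Y p) = push1 p v"
  proof (rule M1.TS_eqI_SF[OF push1_TS[OF pP T] push1_TS[OF pP v] U p'(1)])
    fix A h assume A: "fst p \<in> A" "A \<subseteq> U" "M1.SF A h"
    have s: "smooth_at M1 (fst p) h" using M1.smooth_atI[OF A(1,3)] .
    have pAW: "p \<in> A \<times> W" using A(1) p' by (simp add: mem_Times_iff)
    show "push1 p (P.LB X Y p) h = push1 p v h"
      unfolding push1_apply[OF pP s] P.lie_bracket_apply[OF pAW SF_fst[OF A(3) W]] using 1[OF A] .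
  qed
  show "push2 p (P.LB X Y p) = push2 p v"
  proof (rule M2.TS_eqI_SF[OF push2_TS[OF pP T] push2_TS[OF pP v] W p'(2)])
    fix B h assume B: "snd p \<in> B" "B \<subseteq> W" "M2.SF B h"
    have s: "smooth_at M2 (snd p) h" using M2.smooth_atI[OF B(1,3)] .
    have pAW: "p \<in> U \<times> B" using B(1) p' by (simp add: mem_Times_iff)
    show "push2 p (P.LB X Y p) h = push2 p v h"
      unfolding push2_apply[OF pP s] P.lie_bracket_apply[OF pAW SF_snd[OF U B(3)]] using 2[OF B] .
  qed
qed

context
  fixes U W p
  assumes U: "M1.OP U" and W: "M2.OP W" and p: "p \<in> U \<times> W"
begin

lemma fst_snd_box: "fst p \<in> U" "snd p \<in> W"
  using p by (auto simp: mem_Times_iff)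

lemma deriv_lift1_fst:
  assumes u: "u \<in> P.TS p" and X: "M1.VF U X" and h: "fst p \<in> A" "A \<subseteq> U" "M1.SF A h"
  shows "u (\<lambda>q. lift1 X q (\<lambda>z. h (fst z))) = u (\<lambda>q. X (fst q) h)"
proof (rule P.TS_local[OF u OP_box[OF M1.SF_openin[OF h(3)] W]])
  show "p \<in> A \<times> W" using h fst_snd_box by (simp add: mem_Times_iff)
  fix q assume q: "q \<in> A \<times> W"
  then have "q \<in> U \<times> W" using h by auto
  from lift1_fst_apply[OF U W this X M1.smooth_atI[OF _ h(3)]] q
  show "lift1 X q (\<lambda>z. h (fst z)) = X (fst q) h" by auto
qed

lemma deriv_lift2_snd:
  assumes u: "u \<in> P.TS p" and X: "M2.VF W X" and h: "snd p \<in> B" "B \<subseteq> W" "M2.SF B h"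
  shows "u (\<lambda>q. lift2 X q (\<lambda>z. h (snd z))) = u (\<lambda>q. X (snd q) h)"
proof (rule P.TS_local[OF u OP_box[OF U M2.SF_openin[OF h(3)]]])
  show "p \<in> U \<times> B" using h fst_snd_box by (simp add: mem_Times_iff)
  fix q assume q: "q \<in> U \<times> B"
  then have "q \<in> U \<times> W" using h by auto
  from lift2_snd_apply[OF U W this X M2.smooth_atI[OF _ h(3)]] q
  show "lift2 X q (\<lambda>z. h (snd z)) = X (snd q) h" by auto
qed

lemma deriv_lift1_snd:
  assumes u: "u \<in> P.TS p" and X: "M1.VF U X"
  shows "u (\<lambda>q. lift1 X q (\<lambda>z. h (snd z))) = 0"
proof -
  have "u (\<lambda>q. lift1 X q (\<lambda>z. h (snd z))) = u (\<lambda>q. 0)"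
    by (rule P.TS_local[OF u OP_box[OF U W] p]) (rule lift1_snd_apply[OF U W _ X])
  then show ?thesis using P.TS_const[OF u box_points[OF U W p]] by simp
qed

lemma deriv_lift2_fst:
  assumes u: "u \<in> P.TS p" and X: "M2.VF W X"
  shows "u (\<lambda>q. lift2 X q (\<lambda>z. h (fst z))) = 0"
proof -
  have "u (\<lambda>q. lift2 X q (\<lambda>z. h (fst z))) = u (\<lambda>q. 0)"
    by (rule P.TS_local[OF u OP_box[OF U W] p]) (rule lift2_fst_apply[OF U W _ X])
  then show ?thesis using P.TS_const[OF u box_points[OF U W p]] by simp
qed

lemma lie_bracket_lift11:
  assumes X: "M1.VF U X" and Y: "M1.VF U Y"
  shows "P.LB (lift1 X) (lift1 Y) p = lift1 (M1.LB X Y) p"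
proof (rule lie_bracket_eqI[OF U W p VF_lift1[OF X W] VF_lift1[OF Y W] P.VF_TS[OF VF_lift1[OF M1.VF_lie_bracket[OF X Y] W] p]])
  note TX = P.VF_TS[OF VF_lift1[OF X W] p] and TY = P.VF_TS[OF VF_lift1[OF Y W] p]
  fix A h assume h: "fst p \<in> A" "A \<subseteq> U" "M1.SF A h"
  have s: "smooth_at M1 (fst p) (\<lambda>r. X r h)" "smooth_at M1 (fst p) (\<lambda>r. Y r h)"
    using M1.VF_smooth_at[OF X fst_snd_box(1)] M1.VF_smooth_at[OF Y fst_snd_box(1)] M1.smooth_atI[OF h(1,3)] by auto
  show "lift1 X p (\<lambda>q. lift1 Y q (\<lambda>z. h (fst z))) - lift1 Y p (\<lambda>q. lift1 X q (\<lambda>z. h (fst z))) =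
      lift1 (M1.LB X Y) p (\<lambda>z. h (fst z))"
    unfolding deriv_lift1_fst[OF TX Y h] deriv_lift1_fst[OF TY X h]
      lift1_fst_apply[OF U W p X s(2)] lift1_fst_apply[OF U W p Y s(1)]
      lift1_fst_apply[OF U W p M1.VF_lie_bracket[OF X Y] M1.smooth_atI[OF h(1,3)]]
      M1.lie_bracket_apply[OF h(1,3)] ..
next
  note TX = P.VF_TS[OF VF_lift1[OF X W] p] and TY = P.VF_TS[OF VF_lift1[OF Y W] p]
  fix B h assume h: "snd p \<in> B" "B \<subseteq> W" "M2.SF B h"
  show "lift1 X p (\<lambda>q. lift1 Y q (\<lambda>z. h (snd z))) - lift1 Y p (\<lambda>q. lift1 X q (\<lambda>z. h (snd z))) =
      lift1 (M1.LB X Y) p (\<lambda>z. h (snd z))"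
    unfolding deriv_lift1_snd[OF TX Y] deriv_lift1_snd[OF TY X]
      lift1_snd_apply[OF U W p M1.VF_lie_bracket[OF X Y]] by simp
qed

lemma lie_bracket_lift22:
  assumes X: "M2.VF W X" and Y: "M2.VF W Y"
  shows "P.LB (lift2 X) (lift2 Y) p = lift2 (M2.LB X Y) p"
proof (rule lie_bracket_eqI[OF U W p VF_lift2[OF U X] VF_lift2[OF U Y] P.VF_TS[OF VF_lift2[OF U M2.VF_lie_bracket[OF X Y]] p]])
  note TX = P.VF_TS[OF VF_lift2[OF U X] p] and TY = P.VF_TS[OF VF_lift2[OF U Y] p]
  fix A h assume h: "fst p \<in> A" "A \<subseteq> U" "M1.SF A h"
  show "lift2 X p (\<lambda>q. lift2 Y q (\<lambda>z. h (fst z))) - lift2 Y p (\<lambda>q. lift2 X q (\<lambda>z. h (fst z))) =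
      lift2 (M2.LB X Y) p (\<lambda>z. h (fst z))"
    unfolding deriv_lift2_fst[OF TX Y] deriv_lift2_fst[OF TY X]
      lift2_fst_apply[OF U W p M2.VF_lie_bracket[OF X Y]] by simp
next
  note TX = P.VF_TS[OF VF_lift2[OF U X] p] and TY = P.VF_TS[OF VF_lift2[OF U Y] p]
  fix B h assume h: "snd p \<in> B" "B \<subseteq> W" "M2.SF B h"
  have s: "smooth_at M2 (snd p) (\<lambda>r. X r h)" "smooth_at M2 (snd p) (\<lambda>r. Y r h)"
    using M2.VF_smooth_at[OF X fst_snd_box(2)] M2.VF_smooth_at[OF Y fst_snd_box(2)] M2.smooth_atI[OF h(1,3)] by auto
  show "lift2 X p (\<lambda>q. lift2 Y q (\<lambda>z. h (snd z))) - lift2 Y p (\<lambda>q. lift2 X q (\<lambda>z. h (snd z))) =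
      lift2 (M2.LB X Y) p (\<lambda>z. h (snd z))"
    unfolding deriv_lift2_snd[OF TX Y h] deriv_lift2_snd[OF TY X h]
      lift2_snd_apply[OF U W p X s(2)] lift2_snd_apply[OF U W p Y s(1)]
      lift2_snd_apply[OF U W p M2.VF_lie_bracket[OF X Y] M2.smooth_atI[OF h(1,3)]]
      M2.lie_bracket_apply[OF h(1,3)] ..
qed

text \<open>On functions from one factor, the lift from that factor gives again such a function and
  the lift from the other factor gives 0, so the iterated derivatives vanish in both orders.\<close>

lemma lie_bracket_lift12:
  assumes X: "M1.VF U X" and Y: "M2.VF W Y"
  shows "P.LB (lift1 X) (lift2 Y) p = 0"
proof (rule lie_bracket_eqI[OF U W p VF_lift1[OF X W] VF_lift2[OF U Y] P.TS_zero_closed])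
  note TX = P.VF_TS[OF VF_lift1[OF X W] p] and TY = P.VF_TS[OF VF_lift2[OF U Y] p]
  fix A h assume h: "fst p \<in> A" "A \<subseteq> U" "M1.SF A h"
  show "lift1 X p (\<lambda>q. lift2 Y q (\<lambda>z. h (fst z))) - lift2 Y p (\<lambda>q. lift1 X q (\<lambda>z. h (fst z))) = 0 (\<lambda>z. h (fst z))"
    unfolding deriv_lift2_fst[OF TX Y] deriv_lift1_fst[OF TY X h] lift2_fst_apply[OF U W p Y, of "\<lambda>r. X r h"] by simp
next
  note TX = P.VF_TS[OF VF_lift1[OF X W] p] and TY = P.VF_TS[OF VF_lift2[OF U Y] p]
  fix B h assume h: "snd p \<in> B" "B \<subseteq> W" "M2.SF B h"
  show "lift1 X p (\<lambda>q. lift2 Y q (\<lambda>z. h (snd z))) - lift2 Y p (\<lambda>q. lift1 X q (\<lambda>z. h (snd z))) = 0 (\<lambda>z. h (snd z))"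
    unfolding deriv_lift2_snd[OF TX Y h] deriv_lift1_snd[OF TY X] lift1_snd_apply[OF U W p X, of "\<lambda>r. Y r h"] by simp
qed

end

end

section \<open>Warped products\<close>

context smanifold
begin

text \<open>The Leibniz rule is applied to the product of \<open>h / k\<close> with
  \<open>k\<close>, which equals \<open>h\<close> near \<open>p\<close>, and solved for the
  derivative of the quotient.\<close>

lemma TS_divide:
  assumes v: "v \<in> TS p" and p: "p \<in> U" and h: "SF U h" and k: "SF U k" and nz: "\<And>q. q \<in> U \<Longrightarrow> k q \<noteq> 0"
  shows "v (\<lambda>q. h q / k q) = (v h * k p - h p * v k) / (k p)\<^sup>2"
proof -
  have s: "smooth_at M p (\<lambda>q. h q / k q)" "smooth_at M p k"
    using smooth_atI[OF p SF_divide[OF h k]] nz smooth_atI[OF p k] by auto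
  have "v h = v (\<lambda>q. h q / k q * k q)"
    by (rule TS_local[OF v SF_openin[OF h] p]) (simp add: nz)
  also have "\<dots> = v (\<lambda>q. h q / k q) * k p + h p / k p * v k"
    by (rule TS_mult[OF v s])
  finally show ?thesis using nz[OF p] by (simp add: field_simps power2_eq_square)
qed

end

context psriem
begin

lemma g_zero_left: "p \<in> points M \<Longrightarrow> v \<in> TS p \<Longrightarrow> g p 0 v = 0"
  using g_minus_left[OF _ TS_zero_closed, of p v] by simp

lemma g_zero_right: "p \<in> points M \<Longrightarrow> v \<in> TS p \<Longrightarrow> g p v 0 = 0"
  using g_minus_right[OF _ _ TS_zero_closed, of p v] by simp

lemma g_expand:
  assumes c: "(V, \<phi>) \<in> charts M" "p \<in> V" and u: "u \<in> TS p" and w: "w \<in> TS p"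
  shows "g p u w = (\<Sum>a\<in>Basis. \<Sum>b\<in>Basis. u (coord_fun (V, \<phi>) a) * (w (coord_fun (V, \<phi>) b) * g p (CF (V, \<phi>) b p) (CF (V, \<phi>) a p)))"
proof -
  have pM: "p \<in> points M" using chart_openin[OF c(1)] c(2) openin_subset by blast
  have T: "CF (V, \<phi>) b p \<in> TS p" for b using coord_field_TS[OF c] .
  have e: "g p u w = (\<Sum>a\<in>Basis. u (coord_fun (V, \<phi>) a) * g p (CF (V, \<phi>) a p) w)"
    if u: "u \<in> TS p" and w: "w \<in> TS p" for u w
  proof -
    have "g p u w = g p (\<Sum>a\<in>Basis. u (coord_fun (V, \<phi>) a) *\<^sub>t CF (V, \<phi>) a p) w"
      using TS_expand[OF u c] by (simp only:)
    also have "\<dots> = (\<Sum>a\<in>Basis. g p (u (coord_fun (V, \<phi>) a) *\<^sub>t CF (V, \<phi>) a p) w)"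
      by (intro g_sum_left pM finite_Basis TS_scale_closed T w)
    finally show ?thesis by (simp only: g_scale_left[OF pM T w])
  qed
  show ?thesis
    unfolding e[OF u w] g_sym[OF pM T w] e[OF w T] sum_distrib_left ..
qed

lemma D_zero_left:
  assumes "VF U X" "VF U Y" "p \<in> U" "\<And>q. q \<in> U \<Longrightarrow> X q = 0"
  shows "D X Y p = 0"
proof -
  note c = SF_const[OF VF_openin[OF assms(1)], of 0]
  have "D X Y p = D ((\<lambda>q. 0) *\<^sub>v X) Y p"
    by (rule D_local_left[OF assms(1) VF_scale[OF c assms(1)] assms(2,3)]) (simp add: assms(4) fun_eq_iff)
  then show ?thesis
    unfolding D_scale_left[OF assms(1-3) c] by (simp add: fun_eq_iff)
qed

lemma riemann_scale_middle:
  assumes "VF U X" "VF U Y" "VF U Z" "p \<in> U" "SF U h"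
  shows "R X (h *\<^sub>v Y) Z p = h p *\<^sub>t R X Y Z p"
  unfolding riemann_anti[OF assms(1) VF_scale[OF assms(5,2)] assms(3,4)]
    riemann_scale_left[OF assms(2,1,3,4,5)] riemann_anti[OF assms(1-4)]
  by (simp add: fun_eq_iff)

lemma riemann_diff_left:
  assumes "VF U X" "VF U X'" "VF U Y" "VF U Z" "p \<in> U"
  shows "R (X - X') Y Z p = R X Y Z p - R X' Y Z p"
proof -
  note c = SF_const[OF VF_openin[OF assms(1)], of "-1"]
  show ?thesis
    unfolding vfield_diff_conv riemann_add_left[OF assms(1,3,4,5) VF_scale[OF c assms(2)]]
      riemann_scale_left[OF assms(2-5) c] by (simp add: fun_eq_iff)
qed

lemma riemann_diff_right:
  assumes "VF U X" "VF U Y" "VF U Z" "VF U Z'" "p \<in> U"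
  shows "R X Y (Z - Z') p = R X Y Z p - R X Y Z' p"
proof -
  note c = SF_const[OF VF_openin[OF assms(1)], of "-1"]
  show ?thesis
    unfolding vfield_diff_conv riemann_add_right[OF assms(1-3,5) VF_scale[OF c assms(4)]]
      riemann_scale_right[OF assms(1,2,4,5) c] by (simp add: fun_eq_iff)
qed

end

section \<open>The warped metric\<close>

locale warped = prod_smanifold M1 M2 + M1: psriem M1 g1 + M2: psriem M2 g2
  for M1 :: "('a, 'e::euclidean_space) manifold" and g1
    and M2 :: "('b, 'f::euclidean_space) manifold" and g2 +
  fixes f :: "'a \<Rightarrow> real"
  assumes f_smooth: "smooth_fun M1 (points M1) f" and f_pos: "\<And>p. p \<in> points M1 \<Longrightarrow> 0 < f p"
begin

abbreviation "gw \<equiv> warped_metric M1 g1 M2 g2 f"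

lemma gw_eq: "gw p v w = g1 (fst p) (push1 p v) (push1 p w) + (f (fst p))\<^sup>2 * g2 (snd p) (push2 p v) (push2 p w)"
  by (simp add: warped_metric_def push1_def push2_def)

context
  fixes p assumes p: "p \<in> points P"
begin

lemma gw_11: "v \<in> M1.TS (fst p) \<Longrightarrow> w \<in> M1.TS (fst p) \<Longrightarrow> gw p (emb1 p v) (emb1 p w) = g1 (fst p) v w"
  unfolding gw_eq by (simp add: push1_emb1[OF p] push2_emb1[OF p] M2.g_zero_left[OF fst_snd_points(2)[OF p] M2.TS_zero_closed])

lemma gw_22: "v \<in> M2.TS (snd p) \<Longrightarrow> w \<in> M2.TS (snd p) \<Longrightarrow> gw p (emb2 p v) (emb2 p w) = (f (fst p))\<^sup>2 * g2 (snd p) v w"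
  unfolding gw_eq by (simp add: push2_emb2[OF p] push1_emb2[OF p] M1.g_zero_left[OF fst_snd_points(1)[OF p] M1.TS_zero_closed])

lemma gw_12: "v \<in> M1.TS (fst p) \<Longrightarrow> w \<in> M2.TS (snd p) \<Longrightarrow> gw p (emb1 p v) (emb2 p w) = 0"
  unfolding gw_eq
  by (simp add: push2_emb2[OF p] push1_emb2[OF p] push1_emb1[OF p] push2_emb1[OF p] M1.g_zero_right[OF fst_snd_points(1)[OF p]] M2.g_zero_left[OF fst_snd_points(2)[OF p]])

lemma gw_21: "v \<in> M1.TS (fst p) \<Longrightarrow> w \<in> M2.TS (snd p) \<Longrightarrow> gw p (emb2 p w) (emb1 p v) = 0"
  unfolding gw_eq
  by (simp add: push2_emb2[OF p] push1_emb2[OF p] push1_emb1[OF p] push2_emb1[OF p] M1.g_zero_left[OF fst_snd_points(1)[OF p]] M2.g_zero_right[OF fst_snd_points(2)[OF p]])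

end

text \<open>The coordinates of a push-forward are derivatives of coordinate functions pulled back
  from the factors, hence smooth; expanding both metrics in charts leaves sums of products of smooth
  functions.\<close>

lemma SF_gw:
  assumes X: "P.VF U X" and Y: "P.VF U Y"
  shows "P.SF U (\<lambda>p. gw p (X p) (Y p))"
proof (rule P.SF_local[OF P.VF_openin[OF X]])
  fix p assume p: "p \<in> U"
  have "openin (prod_topology (mtop M1) (mtop M2)) U" using P.VF_openin[OF X] by simp
  with p obtain S T where ST: "M1.OP S" "M2.OP T" "p \<in> S \<times> T" "S \<times> T \<subseteq> U"
    unfolding openin_prod_topology_alt by (metis mem_Sigma_iff prod.collapse)
  obtain V \<phi> V' \<psi> A B where c: "(V, \<phi>) \<in> charts M1" "(V', \<psi>) \<in> charts M2"
    and A: "M1.OP A" "M2.OP B" "A \<subseteq> S \<inter> V" "B \<subseteq> T \<inter> V'" "p \<in> A \<times> B" "P.OP (A \<times> B)"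
    by (rule chart_box[OF ST(1-3)])
  have sub: "A \<times> B \<subseteq> U" "A \<subseteq> V" "B \<subseteq> V'" using A ST(4) by auto
  have q: "q \<in> U" "fst q \<in> V" "snd q \<in> V'" "q \<in> points P" if "q \<in> A \<times> B" for q
    using that sub openin_subset[OF A(6)] by (auto simp: mem_Times_iff)
  have AM: "A \<subseteq> points M1" using openin_subset[OF A(1)] .
  note XY = P.VF_subset[OF X A(6) sub(1)] P.VF_subset[OF Y A(6) sub(1)]
  have s1: "P.SF (A \<times> B) (\<lambda>q. Z q (\<lambda>z. coord_fun (V, \<phi>) a (fst z)))" if "P.VF (A \<times> B) Z" for Z a
    by (rule P.VF_SF[OF that SF_fst[OF M1.SF_subset[OF M1.SF_coord_fun[OF c(1)] A(1) sub(2)] A(2)] order_refl])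
  have s2: "P.SF (A \<times> B) (\<lambda>q. Z q (\<lambda>z. coord_fun (V', \<psi>) a (snd z)))" if "P.VF (A \<times> B) Z" for Z a
    by (rule P.VF_SF[OF that SF_snd[OF A(1) M2.SF_subset[OF M2.SF_coord_fun[OF c(2)] A(2) sub(3)]] order_refl])
  have g1: "P.SF (A \<times> B) (\<lambda>q. g1 (fst q) (M1.CF (V, \<phi>) b (fst q)) (M1.CF (V, \<phi>) a (fst q)))" for a b
    by (rule SF_fst[OF M1.SF_subset[OF M1.SF_g[OF M1.VF_coord_field[OF c(1)] M1.VF_coord_field[OF c(1)]] A(1) sub(2)] A(2)])
  have g2: "P.SF (A \<times> B) (\<lambda>q. g2 (snd q) (M2.CF (V', \<psi>) b (snd q)) (M2.CF (V', \<psi>) a (snd q)))" for a b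
    by (rule SF_snd[OF A(1) M2.SF_subset[OF M2.SF_g[OF M2.VF_coord_field[OF c(2)] M2.VF_coord_field[OF c(2)]] A(2) sub(3)]])
  have sf: "P.SF (A \<times> B) (\<lambda>q. f (fst q))"
    by (rule SF_fst[OF M1.SF_subset[OF f_smooth A(1) AM] A(2)])
  have "P.SF (A \<times> B) (\<lambda>q. (\<Sum>a\<in>Basis. \<Sum>b\<in>Basis. X q (\<lambda>z. coord_fun (V, \<phi>) a (fst z)) *
        (Y q (\<lambda>z. coord_fun (V, \<phi>) b (fst z)) * g1 (fst q) (M1.CF (V, \<phi>) b (fst q)) (M1.CF (V, \<phi>) a (fst q)))) +
      (f (fst q) * f (fst q)) * (\<Sum>a\<in>Basis. \<Sum>b\<in>Basis. X q (\<lambda>z. coord_fun (V', \<psi>) a (snd z)) *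
        (Y q (\<lambda>z. coord_fun (V', \<psi>) b (snd z)) * g2 (snd q) (M2.CF (V', \<psi>) b (snd q)) (M2.CF (V', \<psi>) a (snd q)))))"
    by (intro P.SF_add P.SF_mult P.SF_sum A(6) s1 s2 g1 g2 sf XY)
  then have "P.SF (A \<times> B) (\<lambda>p. gw p (X p) (Y p))"
  proof (rule P.SF_cong)
    fix r assume "r \<in> A \<times> B"
    note r = q[OF this]
    note T = P.VF_TS[OF X r(1)] P.VF_TS[OF Y r(1)]
    show "(\<Sum>a\<in>Basis. \<Sum>b\<in>Basis. X r (\<lambda>z. coord_fun (V, \<phi>) a (fst z)) *
        (Y r (\<lambda>z. coord_fun (V, \<phi>) b (fst z)) * g1 (fst r) (M1.CF (V, \<phi>) b (fst r)) (M1.CF (V, \<phi>) a (fst r)))) +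
      (f (fst r) * f (fst r)) * (\<Sum>a\<in>Basis. \<Sum>b\<in>Basis. X r (\<lambda>z. coord_fun (V', \<psi>) a (snd z)) *
        (Y r (\<lambda>z. coord_fun (V', \<psi>) b (snd z)) * g2 (snd r) (M2.CF (V', \<psi>) b (snd r)) (M2.CF (V', \<psi>) a (snd r)))) =
      gw r (X r) (Y r)"
      unfolding gw_eq M1.g_expand[OF c(1) r(2) push1_TS[OF r(4) T(1)] push1_TS[OF r(4) T(2)]]
        M2.g_expand[OF c(2) r(3) push2_TS[OF r(4) T(1)] push2_TS[OF r(4) T(2)]]
        push1_apply[OF r(4) M1.smooth_at_coord_fun[OF c(1) r(2)]]
        push2_apply[OF r(4) M2.smooth_at_coord_fun[OF c(2) r(3)]] power2_eq_square ..
  qed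
  with A(5) show "\<exists>W. p \<in> W \<and> P.SF W (\<lambda>p. gw p (X p) (Y p))"
    by (intro exI[of _ "A \<times> B"] conjI)
qed

lemma metric_gw: "pseudo_riemannian_metric P gw"
  unfolding pseudo_riemannian_metric_def
proof (intro conjI ballI allI impI)
  fix p assume p: "p \<in> points P"
  note p1 = fst_snd_points[OF p] and T1 = push1_TS[OF p] and T2 = push2_TS[OF p]
  show "gw p u v = gw p v u" if "u \<in> P.TS p" "v \<in> P.TS p" for u v
    unfolding gw_eq M1.g_sym[OF p1(1) T1[OF that(1)] T1[OF that(2)]]
      M2.g_sym[OF p1(2) T2[OF that(1)] T2[OF that(2)]] ..
  show "gw p (u + v) w = gw p u w + gw p v w" if "u \<in> P.TS p" "v \<in> P.TS p" "w \<in> P.TS p" for u v w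
    unfolding gw_eq push_simps M1.g_add_left[OF p1(1) T1[OF that(1)] T1[OF that(2)] T1[OF that(3)]]
      M2.g_add_left[OF p1(2) T2[OF that(1)] T2[OF that(2)] T2[OF that(3)]] by (simp add: algebra_simps)
  show "gw p (c *\<^sub>t u) v = c * gw p u v" if "u \<in> P.TS p" "v \<in> P.TS p" for c u v
    unfolding gw_eq push_simps M1.g_scale_left[OF p1(1) T1[OF that(1)] T1[OF that(2)]]
      M2.g_scale_left[OF p1(2) T2[OF that(1)] T2[OF that(2)]] by (simp add: algebra_simps)
  \<comment> \<open>Nondegeneracy is tested on each factor separately by embedded vectors; on
    \<open>M2\<close> the factor in front of \<open>g2\<close> is cancelled because \<open>f\<close>
    is positive.\<close>
  fix u assume u: "u \<in> P.TS p" and 0: "\<forall>v\<in>P.TS p. gw p u v = 0"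
  have "push1 p u = 0"
  proof (rule M1.g_nondegenerate[OF p1(1) T1[OF u]])
    fix v assume v: "v \<in> M1.TS (fst p)"
    have "gw p u (emb1 p v) = 0" using 0 emb1_TS[OF p v] by blast
    then show "g1 (fst p) (push1 p u) v = 0"
      unfolding gw_eq push1_emb1[OF p v] push2_emb1[OF p v] M2.g_zero_right[OF p1(2) T2[OF u]] by simp
  qed
  moreover have "push2 p u = 0"
  proof (rule M2.g_nondegenerate[OF p1(2) T2[OF u]])
    fix v assume v: "v \<in> M2.TS (snd p)"
    have "gw p u (emb2 p v) = 0" using 0 emb2_TS[OF p v] by blast
    then show "g2 (snd p) (push2 p u) v = 0"
      unfolding gw_eq push1_emb2[OF p v] push2_emb2[OF p v] M1.g_zero_right[OF p1(1) T1[OF u]]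
      using f_pos[OF p1(1)] by simp
  qed
  ultimately show "u = 0"
    by (intro push_eqI[OF p u P.TS_zero_closed]) (simp_all only: push_simps)
next
  show "P.SF U (\<lambda>p. gw p (X p) (Y p))" if "P.VF U X \<and> P.VF U Y" for U X Y using that SF_gw by blast
qed

end

sublocale warped \<subseteq> P: psriem "prod_manifold M1 M2" "warped_metric M1 g1 M2 g2 f"
  by standard (rule metric_gw)

context warped
begin

abbreviation "gf \<equiv> grad M1 g1 f"

lemma f_nz: "p \<in> points M1 \<Longrightarrow> f p \<noteq> 0"
  using f_pos by fastforce

lemma SF_f: "M1.OP U \<Longrightarrow> M1.SF U f"
  by (rule M1.SF_subset[OF f_smooth _ openin_subset])

lemma VF_gf: "M1.OP U \<Longrightarrow> M1.VF U gf"
  by (rule M1.VF_subset[OF M1.VF_grad[OF f_smooth] _ openin_subset])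

context
  fixes U W p
  assumes U: "M1.OP U" and W: "M2.OP W" and p: "p \<in> U \<times> W"
begin

lemma fst_box_in_points: "fst p \<in> points M1" and snd_box_in_points: "snd p \<in> points M2"
  using fst_snd_points[OF box_points[OF U W p]] .

lemma TS_lift1: "M1.VF U X \<Longrightarrow> lift1 X p \<in> P.TS p"
  by (rule P.VF_TS[OF VF_lift1[OF _ W] p])

lemma TS_lift2: "M2.VF W X \<Longrightarrow> lift2 X p \<in> P.TS p"
  by (rule P.VF_TS[OF VF_lift2[OF U] p])

lemma gw_lift11: "M1.VF U X \<Longrightarrow> M1.VF U Y \<Longrightarrow>
    gw p (lift1 X p) (lift1 Y p) = g1 (fst p) (X (fst p)) (Y (fst p))"
  unfolding lift1_apply by (rule gw_11[OF box_points[OF U W p] M1.VF_TS[OF _ fst_snd_box(1)[OF U W p]] M1.VF_TS[OF _ fst_snd_box(1)[OF U W p]]])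

lemma gw_lift22: "M2.VF W X \<Longrightarrow> M2.VF W Y \<Longrightarrow>
    gw p (lift2 X p) (lift2 Y p) = (f (fst p))\<^sup>2 * g2 (snd p) (X (snd p)) (Y (snd p))"
  unfolding lift2_apply by (rule gw_22[OF box_points[OF U W p] M2.VF_TS[OF _ fst_snd_box(2)[OF U W p]] M2.VF_TS[OF _ fst_snd_box(2)[OF U W p]]])

lemma gw_lift12: "M1.VF U X \<Longrightarrow> M2.VF W Y \<Longrightarrow> gw p (lift1 X p) (lift2 Y p) = 0"
  unfolding lift1_apply lift2_apply by (rule gw_12[OF box_points[OF U W p] M1.VF_TS[OF _ fst_snd_box(1)[OF U W p]] M2.VF_TS[OF _ fst_snd_box(2)[OF U W p]]])

lemma gw_lift21: "M1.VF U X \<Longrightarrow> M2.VF W Y \<Longrightarrow> gw p (lift2 Y p) (lift1 X p) = 0"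
  unfolding lift1_apply lift2_apply by (rule gw_21[OF box_points[OF U W p] M1.VF_TS[OF _ fst_snd_box(1)[OF U W p]] M2.VF_TS[OF _ fst_snd_box(2)[OF U W p]]])

end

section \<open>Koszul's expression on lifts\<close>

context
  fixes U W p
  assumes U: "M1.OP U" and W: "M2.OP W" and p: "p \<in> U \<times> W"
begin

lemma deriv_gw11:
  assumes u: "u \<in> P.TS p" and X: "M1.VF U X" "M1.VF U Y"
  shows "u (\<lambda>q. gw q (lift1 X q) (lift1 Y q)) = u (\<lambda>q. g1 (fst q) (X (fst q)) (Y (fst q)))"
  by (rule P.TS_local[OF u OP_box[OF U W] p]) (rule gw_lift11[OF U W _ X])

lemma deriv_gw12:
  assumes u: "u \<in> P.TS p" and X: "M1.VF U X" "M2.VF W Y"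
  shows "u (\<lambda>q. gw q (lift1 X q) (lift2 Y q)) = 0" "u (\<lambda>q. gw q (lift2 Y q) (lift1 X q)) = 0"
proof -
  have "u (\<lambda>q. gw q (lift1 X q) (lift2 Y q)) = u (\<lambda>q. 0)"
    by (rule P.TS_local[OF u OP_box[OF U W] p]) (rule gw_lift12[OF U W _ X])
  then show "u (\<lambda>q. gw q (lift1 X q) (lift2 Y q)) = 0"
    unfolding P.TS_const[OF u box_points[OF U W p]] .
  have "u (\<lambda>q. gw q (lift2 Y q) (lift1 X q)) = u (\<lambda>q. 0)"
    by (rule P.TS_local[OF u OP_box[OF U W] p]) (rule gw_lift21[OF U W _ X])
  then show "u (\<lambda>q. gw q (lift2 Y q) (lift1 X q)) = 0"
    unfolding P.TS_const[OF u box_points[OF U W p]] .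
qed

lemma smooth_at_f: "smooth_at M1 (fst p) f"
  by (rule M1.smooth_atI[OF fst_box_in_points[OF U W p] f_smooth])

lemma deriv_gw22:
  assumes u: "u \<in> P.TS p" and X: "M2.VF W X" "M2.VF W Y"
  shows "u (\<lambda>q. gw q (lift2 X q) (lift2 Y q)) =
    2 * f (fst p) * u (\<lambda>q. f (fst q)) * g2 (snd p) (X (snd p)) (Y (snd p)) +
    (f (fst p))\<^sup>2 * u (\<lambda>q. g2 (snd q) (X (snd q)) (Y (snd q)))"
proof -
  have sf: "smooth_at P p (\<lambda>q. f (fst q))"
    by (rule smooth_at_fst[OF smooth_at_f snd_box_in_points[OF U W p]])
  have sg: "smooth_at P p (\<lambda>q. g2 (snd q) (X (snd q)) (Y (snd q)))"
    by (rule smooth_at_snd[OF M2.smooth_atI[OF fst_snd_box(2)[OF U W p] M2.SF_g[OF X]] fst_box_in_points[OF U W p]])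
  have "u (\<lambda>q. gw q (lift2 X q) (lift2 Y q)) = u (\<lambda>q. (f (fst q) * f (fst q)) * g2 (snd q) (X (snd q)) (Y (snd q)))"
    unfolding power2_eq_square[symmetric]
    by (rule P.TS_local[OF u OP_box[OF U W] p]) (rule gw_lift22[OF U W _ X])
  also have "\<dots> = u (\<lambda>q. f (fst q) * f (fst q)) * g2 (snd p) (X (snd p)) (Y (snd p)) +
    (f (fst p) * f (fst p)) * u (\<lambda>q. g2 (snd q) (X (snd q)) (Y (snd q)))"
    by (rule P.TS_mult[OF u P.smooth_at_mult[OF sf sf] sg])
  finally show ?thesis
    unfolding P.TS_mult[OF u sf sf] by (simp add: power2_eq_square algebra_simps)
qed

lemma lie_bracket_lift21:
  assumes X: "M1.VF U X" and Y: "M2.VF W Y"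
  shows "P.LB (lift2 Y) (lift1 X) p = 0"
  using lie_bracket_lift12[OF U W p X Y] P.lie_bracket_anti_apply[of "lift2 Y" "lift1 X" p] by simp

lemma koszul_111:
  assumes X: "M1.VF U X" and Y: "M1.VF U Y" and Z: "M1.VF U Z"
  shows "P.koszul (lift1 X) (lift1 Y) (lift1 Z) p = M1.koszul X Y Z (fst p)"
proof -
  have d: "lift1 A p (\<lambda>q. gw q (lift1 B q) (lift1 C q)) = A (fst p) (\<lambda>q. g1 q (B q) (C q))"
    if "M1.VF U A" "M1.VF U B" "M1.VF U C" for A B C
    unfolding deriv_gw11[OF TS_lift1[OF U W p that(1)] that(2,3)]
    by (rule lift1_fst_apply[OF U W p that(1) M1.smooth_atI[OF fst_snd_box(1)[OF U W p] M1.SF_g[OF that(2,3)]]])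
  have l: "gw p (P.LB (lift1 A) (lift1 B) p) (lift1 C p) = g1 (fst p) (M1.LB A B (fst p)) (C (fst p))"
    if "M1.VF U A" "M1.VF U B" "M1.VF U C" for A B C
    unfolding lie_bracket_lift11[OF U W p that(1,2)]
    by (rule gw_lift11[OF U W p M1.VF_lie_bracket[OF that(1,2)] that(3)])
  show ?thesis
    unfolding P.koszul_def M1.koszul_def d[OF X Y Z] d[OF Y X Z] d[OF Z X Y] l[OF X Y Z] l[OF X Z Y] l[OF Y Z X] ..
qed

lemma lift2_deriv_f: "M2.VF W T \<Longrightarrow> lift2 T p (\<lambda>q. f (fst q)) = 0"
  by (rule lift2_fst_apply[OF U W p])

lemma lift1_deriv_f: "M1.VF U X \<Longrightarrow> lift1 X p (\<lambda>q. f (fst q)) = X (fst p) f"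
  by (rule lift1_fst_apply[OF U W p _ smooth_at_f])

lemma koszul_112:
  assumes X: "M1.VF U X" and Y: "M1.VF U Y" and T: "M2.VF W T"
  shows "P.koszul (lift1 X) (lift1 Y) (lift2 T) p = 0"
proof -
  note u = TS_lift1[OF U W p X] TS_lift1[OF U W p Y] TS_lift2[OF U W p T]
  have 1: "lift2 T p (\<lambda>q. gw q (lift1 X q) (lift1 Y q)) = 0"
    unfolding deriv_gw11[OF u(3) X Y] by (rule lift2_fst_apply[OF U W p T])
  show ?thesis
    unfolding P.koszul_def deriv_gw12(1)[OF u(1) Y T] deriv_gw12(1)[OF u(2) X T] 1
      lie_bracket_lift11[OF U W p X Y] lie_bracket_lift12[OF U W p X T] lie_bracket_lift12[OF U W p Y T]
      gw_lift12[OF U W p M1.VF_lie_bracket[OF X Y] T] P.g_zero_left[OF box_points[OF U W p] u(1)]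
      P.g_zero_left[OF box_points[OF U W p] u(2)] by simp
qed

lemma koszul_121:
  assumes X: "M1.VF U X" and V: "M2.VF W V" and Z: "M1.VF U Z"
  shows "P.koszul (lift1 X) (lift2 V) (lift1 Z) p = 0"
proof -
  note u = TS_lift1[OF U W p X] TS_lift2[OF U W p V] TS_lift1[OF U W p Z]
  have 1: "lift2 V p (\<lambda>q. gw q (lift1 X q) (lift1 Z q)) = 0"
    unfolding deriv_gw11[OF u(2) X Z] by (rule lift2_fst_apply[OF U W p V])
  show ?thesis
    unfolding P.koszul_def deriv_gw12(2)[OF u(1) Z V] deriv_gw12(1)[OF u(3) X V] 1
      lie_bracket_lift11[OF U W p X Z] lie_bracket_lift12[OF U W p X V] lie_bracket_lift21[OF Z V]
      gw_lift12[OF U W p M1.VF_lie_bracket[OF X Z] V] P.g_zero_left[OF box_points[OF U W p] u(1)]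
      P.g_zero_left[OF box_points[OF U W p] u(3)] by simp
qed

text \<open>The only surviving term is the derivative of \<open>f\<^sup>2 g\<^sub>2(V, T)\<close>
  along \<open>X\<close>, and a lift from \<open>M1\<close> differentiates just the factor
  \<open>f\<^sup>2\<close>.\<close>

lemma koszul_122:
  assumes X: "M1.VF U X" and V: "M2.VF W V" and T: "M2.VF W T"
  shows "P.koszul (lift1 X) (lift2 V) (lift2 T) p =
    2 * f (fst p) * X (fst p) f * g2 (snd p) (V (snd p)) (T (snd p))"
proof -
  note u = TS_lift1[OF U W p X] TS_lift2[OF U W p V] TS_lift2[OF U W p T]
  have 1: "lift1 X p (\<lambda>q. g2 (snd q) (V (snd q)) (T (snd q))) = 0"
    by (rule lift1_snd_apply[OF U W p X])
  show ?thesis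
    unfolding P.koszul_def deriv_gw12(1)[OF u(2) X T] deriv_gw12(1)[OF u(3) X V] deriv_gw22[OF u(1) V T]
      lift1_deriv_f[OF X] 1
      lie_bracket_lift22[OF U W p V T] lie_bracket_lift12[OF U W p X V] lie_bracket_lift12[OF U W p X T]
      gw_lift21[OF U W p X M2.VF_lie_bracket[OF V T]] P.g_zero_left[OF box_points[OF U W p] u(2)]
      P.g_zero_left[OF box_points[OF U W p] u(3)] by simp
qed

text \<open>Here \<open>f\<^sup>2 g\<^sub>2(V, T)\<close> is differentiated along the last argument
  \<open>Z\<close>, which accounts for the sign.\<close>

lemma koszul_221:
  assumes V: "M2.VF W V" and T: "M2.VF W T" and Z: "M1.VF U Z"
  shows "P.koszul (lift2 V) (lift2 T) (lift1 Z) p =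
    - 2 * f (fst p) * Z (fst p) f * g2 (snd p) (V (snd p)) (T (snd p))"
proof -
  note u = TS_lift1[OF U W p Z] TS_lift2[OF U W p V] TS_lift2[OF U W p T]
  have 1: "lift1 Z p (\<lambda>q. g2 (snd q) (V (snd q)) (T (snd q))) = 0"
    by (rule lift1_snd_apply[OF U W p Z])
  show ?thesis
    unfolding P.koszul_def deriv_gw12(2)[OF u(2) Z T] deriv_gw12(2)[OF u(3) Z V] deriv_gw22[OF u(1) V T]
      lift1_deriv_f[OF Z] 1
      lie_bracket_lift22[OF U W p V T] lie_bracket_lift21[OF Z V] lie_bracket_lift21[OF Z T]
      gw_lift21[OF U W p Z M2.VF_lie_bracket[OF V T]] P.g_zero_left[OF box_points[OF U W p] u(2)]
      P.g_zero_left[OF box_points[OF U W p] u(3)] by simp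
qed

text \<open>Lifts from \<open>M2\<close> do not differentiate \<open>f\<close>, so
  \<open>f\<^sup>2\<close> comes out of every term.\<close>

lemma koszul_222:
  assumes X: "M2.VF W X" and Y: "M2.VF W Y" and Z: "M2.VF W Z"
  shows "P.koszul (lift2 X) (lift2 Y) (lift2 Z) p = (f (fst p))\<^sup>2 * M2.koszul X Y Z (snd p)"
proof -
  have d: "lift2 A p (\<lambda>q. gw q (lift2 B q) (lift2 C q)) = (f (fst p))\<^sup>2 * A (snd p) (\<lambda>q. g2 q (B q) (C q))"
    if "M2.VF W A" "M2.VF W B" "M2.VF W C" for A B C
    unfolding deriv_gw22[OF TS_lift2[OF U W p that(1)] that(2,3)] lift2_deriv_f[OF that(1)]
      lift2_snd_apply[OF U W p that(1) M2.smooth_atI[OF fst_snd_box(2)[OF U W p] M2.SF_g[OF that(2,3)]]] by simp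
  have l: "gw p (P.LB (lift2 A) (lift2 B) p) (lift2 C p) = (f (fst p))\<^sup>2 * g2 (snd p) (M2.LB A B (snd p)) (C (snd p))"
    if "M2.VF W A" "M2.VF W B" "M2.VF W C" for A B C
    unfolding lie_bracket_lift22[OF U W p that(1,2)]
    by (rule gw_lift22[OF U W p M2.VF_lie_bracket[OF that(1,2)] that(3)])
  show ?thesis
    unfolding P.koszul_def M2.koszul_def d[OF X Y Z] d[OF Y X Z] d[OF Z X Y] l[OF X Y Z] l[OF X Z Y] l[OF Y Z X]
    by (simp add: algebra_simps)
qed

text \<open>An arbitrary tangent vector is split by \<open>push_decompose\<close> and each summand
  extended to a lift, so Koszul's formula has to be checked on lifts only. The extension shrinks one
  factor of the box, hence the sets \<open>S\<close>.\<close>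

lemma D_eqI:
  assumes A: "P.VF (U \<times> W) A" and B: "P.VF (U \<times> W) B" and v: "v \<in> P.TS p"
    and 1: "\<And>S Z. p \<in> S \<times> W \<Longrightarrow> S \<subseteq> U \<Longrightarrow> M1.OP S \<Longrightarrow> M1.VF S Z \<Longrightarrow>
      P.koszul A B (lift1 Z) p = 2 * gw p v (lift1 Z p)"
    and 2: "\<And>S Z. p \<in> U \<times> S \<Longrightarrow> S \<subseteq> W \<Longrightarrow> M2.OP S \<Longrightarrow> M2.VF S Z \<Longrightarrow>
      P.koszul A B (lift2 Z) p = 2 * gw p v (lift2 Z p)"
  shows "P.D A B p = v"
proof (rule P.g_eqI[OF box_points[OF U W p] P.VF_TS[OF P.VF_D[OF A B] p] v])
  note TD = P.VF_TS[OF P.VF_D[OF A B] p] and pM = box_points[OF U W p] and pUW = fst_snd_box[OF U W p]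
  fix w assume w: "w \<in> P.TS p"
  note T1 = push1_TS[OF pM w] and T2 = push2_TS[OF pM w]
  note E1 = emb1_TS[OF pM T1] and E2 = emb2_TS[OF pM T2]
  obtain S Z where Z: "M1.VF S Z" "fst p \<in> S" "S \<subseteq> U" "Z (fst p) = push1 p w"
    by (rule M1.VF_extend[OF T1 pUW(1) U])
  obtain S' Z' where Z': "M2.VF S' Z'" "snd p \<in> S'" "S' \<subseteq> W" "Z' (snd p) = push2 p w"
    by (rule M2.VF_extend[OF T2 pUW(2) W])
  have pS: "p \<in> S \<times> W" "p \<in> U \<times> S'" using Z(2) Z'(2) pUW by (auto simp: mem_Times_iff)
  have sub: "S \<times> W \<subseteq> U \<times> W" "U \<times> S' \<subseteq> U \<times> W" using Z(3) Z'(3) by auto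
  note o = M1.VF_openin[OF Z(1)] and o' = M2.VF_openin[OF Z'(1)]
  have "2 * gw p (P.D A B p) (lift1 Z p) = 2 * gw p v (lift1 Z p)"
    unfolding 1[OF pS(1) Z(3) o Z(1), symmetric]
    by (rule P.D_koszul[OF P.VF_subset[OF A OP_box[OF o W] sub(1)] P.VF_subset[OF B OP_box[OF o W] sub(1)]
          VF_lift1[OF Z(1) W] pS(1)])
  then have e1: "gw p (P.D A B p) (emb1 p (push1 p w)) = gw p v (emb1 p (push1 p w))"
    unfolding lift1_apply Z(4) by simp
  have "2 * gw p (P.D A B p) (lift2 Z' p) = 2 * gw p v (lift2 Z' p)"
    unfolding 2[OF pS(2) Z'(3) o' Z'(1), symmetric]
    by (rule P.D_koszul[OF P.VF_subset[OF A OP_box[OF U o'] sub(2)] P.VF_subset[OF B OP_box[OF U o'] sub(2)]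
          VF_lift2[OF U Z'(1)] pS(2)])
  then have e2: "gw p (P.D A B p) (emb2 p (push2 p w)) = gw p v (emb2 p (push2 p w))"
    unfolding lift2_apply Z'(4) by simp
  have "gw p x w = gw p x (emb1 p (push1 p w)) + gw p x (emb2 p (push2 p w))" if "x \<in> P.TS p" for x
    by (subst push_decompose[OF pM w]) (rule P.g_add_right[OF pM E1 E2 that])
  then show "gw p (P.D A B p) w = gw p v w"
    using e1 e2 TD v by metis
qed

end

section \<open>The connection on lifts\<close>

lemma D_lift11:
  assumes U: "M1.OP U" and W: "M2.OP W" and p: "p \<in> U \<times> W" and X: "M1.VF U X" and Y: "M1.VF U Y"
  shows "P.D (lift1 X) (lift1 Y) p = lift1 (M1.D X Y) p"
proof (rule D_eqI[OF U W p VF_lift1[OF X W] VF_lift1[OF Y W] TS_lift1[OF U W p M1.VF_D[OF X Y]]])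
  fix S Z assume S: "p \<in> S \<times> W" "S \<subseteq> U" "M1.OP S" and Z: "M1.VF S Z"
  note r = M1.VF_subset[OF _ S(3,2)]
  show "P.koszul (lift1 X) (lift1 Y) (lift1 Z) p = 2 * gw p (lift1 (M1.D X Y) p) (lift1 Z p)"
    unfolding koszul_111[OF S(3) W S(1) r[OF X] r[OF Y] Z] gw_lift11[OF S(3) W S(1) r[OF M1.VF_D[OF X Y]] Z]
    by (rule M1.D_koszul[OF r[OF X] r[OF Y] Z fst_snd_box(1)[OF S(3) W S(1)], symmetric])
next
  fix S Z assume S: "p \<in> U \<times> S" "S \<subseteq> W" "M2.OP S" and Z: "M2.VF S Z"
  show "P.koszul (lift1 X) (lift1 Y) (lift2 Z) p = 2 * gw p (lift1 (M1.D X Y) p) (lift2 Z p)"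
    unfolding koszul_112[OF U S(3,1) X Y Z] gw_lift12[OF U S(3,1) M1.VF_D[OF X Y] Z] by simp
qed

text \<open>The coefficient compares \<open>2 f (X f) g\<^sub>2(V, Z)\<close> from
  \<open>koszul_122\<close> with \<open>2 f\<^sup>2 g\<^sub>2(V, Z)\<close> from the metric.\<close>

lemma D_lift12:
  assumes U: "M1.OP U" and W: "M2.OP W" and p: "p \<in> U \<times> W" and X: "M1.VF U X" and V: "M2.VF W V"
  shows "P.D (lift1 X) (lift2 V) p = (X (fst p) f / f (fst p)) *\<^sub>t lift2 V p"
proof (rule D_eqI[OF U W p VF_lift1[OF X W] VF_lift2[OF U V] P.TS_scale_closed[OF TS_lift2[OF U W p V]]])
  note pM = box_points[OF U W p]
  have s: "gw p ((X (fst p) f / f (fst p)) *\<^sub>t lift2 V p) w = (X (fst p) f / f (fst p)) * gw p (lift2 V p) w"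
    if "w \<in> P.TS p" for w
    by (rule P.g_scale_left[OF pM TS_lift2[OF U W p V] that])
  fix S Z assume S: "p \<in> S \<times> W" "S \<subseteq> U" "M1.OP S" and Z: "M1.VF S Z"
  note r = M1.VF_subset[OF _ S(3,2)]
  show "P.koszul (lift1 X) (lift2 V) (lift1 Z) p = 2 * gw p ((X (fst p) f / f (fst p)) *\<^sub>t lift2 V p) (lift1 Z p)"
    unfolding koszul_121[OF S(3) W S(1) r[OF X] V Z] s[OF TS_lift1[OF S(3) W S(1) Z]] gw_lift21[OF S(3) W S(1) Z V] by simp
next
  note pM = box_points[OF U W p]
  have s: "gw p ((X (fst p) f / f (fst p)) *\<^sub>t lift2 V p) w = (X (fst p) f / f (fst p)) * gw p (lift2 V p) w"
    if "w \<in> P.TS p" for w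
    by (rule P.g_scale_left[OF pM TS_lift2[OF U W p V] that])
  fix S Z assume S: "p \<in> U \<times> S" "S \<subseteq> W" "M2.OP S" and Z: "M2.VF S Z"
  note r = M2.VF_subset[OF _ S(3,2)]
  show "P.koszul (lift1 X) (lift2 V) (lift2 Z) p = 2 * gw p ((X (fst p) f / f (fst p)) *\<^sub>t lift2 V p) (lift2 Z p)"
    unfolding koszul_122[OF U S(3,1) X r[OF V] Z] s[OF TS_lift2[OF U S(3,1) Z]] gw_lift22[OF U S(3,1) r[OF V] Z]
    using f_nz[OF fst_box_in_points[OF U W p]] by (simp add: power2_eq_square)
qed

text \<open>Vanishing torsion, since lifts from different factors commute.\<close>

lemma D_lift21:
  assumes U: "M1.OP U" and W: "M2.OP W" and p: "p \<in> U \<times> W" and X: "M1.VF U X" and V: "M2.VF W V"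
  shows "P.D (lift2 V) (lift1 X) p = (X (fst p) f / f (fst p)) *\<^sub>t lift2 V p"
  using P.D_torsion[OF VF_lift2[OF U V] VF_lift1[OF X W] p]
  unfolding lie_bracket_lift21[OF U W p X V] D_lift12[OF assms] by simp

text \<open>The subtracted term is, up to sign, the second fundamental form of the fibres:
  \<open>g(V, T) / f\<close> times \<open>grad f\<close>, where
  \<open>g(V, T) = f\<^sup>2 g\<^sub>2(V, T)\<close>.\<close>

lemma D_lift22:
  assumes U: "M1.OP U" and W: "M2.OP W" and p: "p \<in> U \<times> W" and V: "M2.VF W V" and T: "M2.VF W T"
  shows "P.D (lift2 V) (lift2 T) p = lift2 (M2.D V T) p -
    (f (fst p) * g2 (snd p) (V (snd p)) (T (snd p))) *\<^sub>t lift1 gf p"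
    (is "_ = _ - ?c *\<^sub>t _")
proof (rule D_eqI[OF U W p VF_lift2[OF U V] VF_lift2[OF U T]])
  note pM = box_points[OF U W p]
  note T2 = TS_lift2[OF U W p M2.VF_D[OF V T]] and T1 = TS_lift1[OF U W p VF_gf[OF U]]
  show "lift2 (M2.D V T) p - ?c *\<^sub>t lift1 gf p \<in> P.TS p"
    by (intro P.TS_diff_closed P.TS_scale_closed T1 T2)
  have s: "gw p (lift2 (M2.D V T) p - ?c *\<^sub>t lift1 gf p) w = gw p (lift2 (M2.D V T) p) w - ?c * gw p (lift1 gf p) w"
    if "w \<in> P.TS p" for w
    unfolding P.g_diff_left[OF pM T2 P.TS_scale_closed[OF T1] that] P.g_scale_left[OF pM T1 that] ..
  {
    fix S Z assume S: "p \<in> S \<times> W" "S \<subseteq> U" "M1.OP S" and Z: "M1.VF S Z"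
    have "g1 (fst p) (gf (fst p)) (Z (fst p)) = Z (fst p) f"
      by (rule M1.g_grad[OF smooth_at_f[OF U W p] M1.VF_TS[OF Z fst_snd_box(1)[OF S(3) W S(1)]]])
    then show "P.koszul (lift2 V) (lift2 T) (lift1 Z) p = 2 * gw p (lift2 (M2.D V T) p - ?c *\<^sub>t lift1 gf p) (lift1 Z p)"
      unfolding koszul_221[OF S(3) W S(1) V T Z] s[OF TS_lift1[OF S(3) W S(1) Z]]
        gw_lift21[OF S(3) W S(1) Z M2.VF_D[OF V T]] gw_lift11[OF S(3) W S(1) VF_gf[OF S(3)] Z] by simp
  next
    fix S Z assume S: "p \<in> U \<times> S" "S \<subseteq> W" "M2.OP S" and Z: "M2.VF S Z"
    note r = M2.VF_subset[OF _ S(3,2)]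
    show "P.koszul (lift2 V) (lift2 T) (lift2 Z) p = 2 * gw p (lift2 (M2.D V T) p - ?c *\<^sub>t lift1 gf p) (lift2 Z p)"
      unfolding koszul_222[OF U S(3,1) r[OF V] r[OF T] Z] s[OF TS_lift2[OF U S(3,1) Z]]
        gw_lift22[OF U S(3,1) r[OF M2.VF_D[OF V T]] Z] gw_lift12[OF U S(3,1) VF_gf[OF U] Z]
        M2.D_koszul[OF r[OF V] r[OF T] Z fst_snd_box(2)[OF U S(3,1)], symmetric] by simp
  }
qed

end

section \<open>The curvature on lifts\<close>

context warped
begin

text \<open>The derivative of \<open>log f\<close>: the factor by which the connection along the
  lift of \<open>X\<close> multiplies lifts from \<open>M2\<close>.\<close>

abbreviation dlog :: "'a vfield \<Rightarrow> 'a \<Rightarrow> real" where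
  "dlog X \<equiv> (\<lambda>r. X r f / f r)"

lemma SF_Xf: "M1.VF U X \<Longrightarrow> M1.SF U (\<lambda>r. X r f)"
  by (rule M1.VF_SF[OF _ SF_f[OF M1.VF_openin] order_refl])

lemma SF_dlog: "M1.VF U X \<Longrightarrow> M1.SF U (dlog X)"
  by (rule M1.SF_divide[OF SF_Xf SF_f[OF M1.VF_openin] f_nz[OF M1.VF_points]])

lemma SF_dlog_fst: "M1.VF U X \<Longrightarrow> M2.OP W \<Longrightarrow> P.SF (U \<times> W) (\<lambda>q. dlog X (fst q))"
  by (rule SF_fst[OF SF_dlog])

text \<open>\<open>H\<^sup>f / f\<close> in terms of second derivatives of \<open>f\<close>, the
  form in which it comes out of the curvature; no gradient has to be differentiated.\<close>

definition hessf :: "'a vfield \<Rightarrow> 'a vfield \<Rightarrow> 'a \<Rightarrow> real" where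
  "hessf X Y r = (X r (\<lambda>s. Y s f) - M1.D X Y r f) / f r"

lemma SF_hessf: "M1.VF U X \<Longrightarrow> M1.VF U Y \<Longrightarrow> M1.SF U (hessf X Y)"
  unfolding hessf_def[abs_def]
  by (rule M1.SF_divide[OF M1.SF_diff[OF M1.VF_SF[OF _ SF_Xf order_refl] SF_Xf[OF M1.VF_D]]
        SF_f[OF M1.VF_openin] f_nz[OF M1.VF_points]])

text \<open>The equation \<open>g1(grad f, Y) = Y f\<close> is differentiated along \<open>X\<close>
  by metric compatibility.\<close>

lemma hessf_eq_hessian:
  assumes X: "M1.VF U X" and Y: "M1.VF U Y" and r: "r \<in> U"
  shows "(1 / f r) * hessian M1 g1 f X Y r = hessf X Y r"
proof -
  note rM = M1.VF_points[OF X r]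
  have s: "smooth_at M1 q f" if "q \<in> U" for q
    by (rule M1.smooth_atI[OF M1.VF_points[OF X that] f_smooth])
  note G = VF_gf[OF M1.VF_openin[OF X]]
  have "X r (\<lambda>s. Y s f) = X r (\<lambda>s. g1 s (gf s) (Y s))"
    by (rule M1.TS_local[OF M1.VF_TS[OF X r] M1.VF_openin[OF X] r])
      (rule M1.g_grad[OF s M1.VF_TS[OF Y], symmetric])
  also have "\<dots> = g1 r (M1.D X gf r) (Y r) + M1.D X Y r f"
    unfolding M1.D_metric[OF X G r Y] M1.g_grad[OF s[OF r] M1.VF_TS[OF M1.VF_D[OF X Y] r]] ..
  finally show ?thesis
    unfolding hessf_def hessian_def by simp
qed

text \<open>The squared length of the gradient, because \<open>g1(grad f, grad f)\<close> is the
  derivative of \<open>f\<close> along \<open>grad f\<close>.\<close>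

definition ngrad :: "'a \<Rightarrow> real" where
  "ngrad r = gf r f"

lemma SF_ngrad: "M1.OP U \<Longrightarrow> M1.SF U ngrad"
  unfolding ngrad_def[abs_def] by (rule SF_Xf[OF VF_gf])

text \<open>The coefficient of \<open>grad f\<close> in \<open>D_lift22\<close>, as a function on
  the product, so that the derivative of one lift along another is a vector field that can be
  differentiated again.\<close>

definition phi :: "'b vfield \<Rightarrow> 'b vfield \<Rightarrow> 'a \<times> 'b \<Rightarrow> real" where
  "phi V T q = f (fst q) * g2 (snd q) (V (snd q)) (T (snd q))"

lemma SF_phi: "M1.OP U \<Longrightarrow> M2.VF W V \<Longrightarrow> M2.VF W T \<Longrightarrow> P.SF (U \<times> W) (phi V T)"
  unfolding phi_def[abs_def]
  by (rule P.SF_mult[OF SF_fst[OF SF_f M2.VF_openin] SF_snd[OF _ M2.SF_g]])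

context
  fixes U W
  assumes U: "M1.OP U" and W: "M2.OP W"
begin

lemma D_lift22_phi:
  assumes p: "p \<in> U \<times> W" and V: "M2.VF W V" and T: "M2.VF W T"
  shows "P.D (lift2 V) (lift2 T) p = (lift2 (M2.D V T) - phi V T *\<^sub>v lift1 gf) p"
  unfolding D_lift22[OF U W p V T] vfield_diff_apply vscale_apply phi_def ..

lemmas VF_dlog_field = P.VF_scale[OF SF_dlog_fst[OF _ W] VF_lift2[OF U]]
lemmas VF_phi_field = P.VF_diff[OF VF_lift2[OF U] P.VF_scale[OF SF_phi[OF U] VF_lift1[OF VF_gf[OF U] W]]]

context
  fixes p assumes p: "p \<in> U \<times> W"
begin

lemma lift1_deriv_fst: "M1.VF U X \<Longrightarrow> M1.SF U h \<Longrightarrow> lift1 X p (\<lambda>q. h (fst q)) = X (fst p) h"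
  by (rule lift1_fst_apply[OF U W p _ M1.smooth_atI[OF fst_snd_box(1)[OF U W p]]])

lemma lift2_deriv_phi:
  assumes A: "M2.VF W A" and V: "M2.VF W V" and T: "M2.VF W T"
  shows "lift2 A p (phi V T) = f (fst p) * A (snd p) (\<lambda>s. g2 s (V s) (T s))"
proof -
  note s = M2.smooth_atI[OF fst_snd_box(2)[OF U W p] M2.SF_g[OF V T]]
  show ?thesis
    unfolding phi_def[abs_def]
      P.TS_mult[OF TS_lift2[OF U W p A] smooth_at_fst[OF smooth_at_f[OF U W p] snd_box_in_points[OF U W p]]
        smooth_at_snd[OF s fst_box_in_points[OF U W p]]] lift2_deriv_f[OF U W p A] lift2_snd_apply[OF U W p A s] by simp
qed

text \<open>The last term comes from differentiating \<open>grad f\<close> along the lift of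
  \<open>A\<close>: the factor \<open>f\<close> in \<open>phi\<close> cancels the
  \<open>1 / f\<close> of \<open>D_lift21\<close>.\<close>

lemma D_lift2_phi_field:
  assumes A: "M2.VF W A" and V: "M2.VF W V" and T: "M2.VF W T" and S: "M2.VF W S"
  shows "P.D (lift2 A) (lift2 S - phi V T *\<^sub>v lift1 gf) p = lift2 (M2.D A S) p -
    (phi A S p + lift2 A p (phi V T)) *\<^sub>t lift1 gf p -
    (g2 (snd p) (V (snd p)) (T (snd p)) * ngrad (fst p)) *\<^sub>t lift2 A p"
proof -
  note LA = VF_lift2[OF U A] and LS = VF_lift2[OF U S] and LG = VF_lift1[OF VF_gf[OF U] W] and SP = SF_phi[OF U V T]
  show ?thesis
    unfolding P.D_diff_right[OF LA LS p P.VF_scale[OF SP LG]] P.D_scale_right[OF LA LG p SP]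
      D_lift22_phi[OF p A S] D_lift21[OF U W p VF_gf[OF U] A] ngrad_def vfield_diff_apply vscale_apply
    using f_nz[OF fst_box_in_points[OF U W p]] by (simp add: fun_eq_iff phi_def algebra_simps)
qed

lemma D_lift1_phi_field:
  assumes X: "M1.VF U X" and V: "M2.VF W V" and T: "M2.VF W T" and S: "M2.VF W S"
  shows "P.D (lift1 X) (lift2 S - phi V T *\<^sub>v lift1 gf) p = dlog X (fst p) *\<^sub>t lift2 S p -
    (lift1 X p (phi V T) *\<^sub>t lift1 gf p + phi V T p *\<^sub>t lift1 (M1.D X gf) p)"
proof -
  note LX = VF_lift1[OF X W] and LS = VF_lift2[OF U S] and LG = VF_lift1[OF VF_gf[OF U] W] and SP = SF_phi[OF U V T]
  show ?thesis
    unfolding P.D_diff_right[OF LX LS p P.VF_scale[OF SP LG]] P.D_scale_right[OF LX LG p SP]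
      D_lift12[OF U W p X S] D_lift11[OF U W p X VF_gf[OF U]] ..
qed

lemma D_dlog_field:
  assumes A: "P.VF (U \<times> W) A" and X: "M1.VF U X" and V: "M2.VF W V"
  shows "P.D A ((\<lambda>q. dlog X (fst q)) *\<^sub>v lift2 V) p =
    A p (\<lambda>q. dlog X (fst q)) *\<^sub>t lift2 V p + dlog X (fst p) *\<^sub>t P.D A (lift2 V) p"
  by (rule P.D_scale_right[OF A VF_lift2[OF U V] p SF_dlog_fst[OF X W]])

text \<open>The formulas for the connection on lifts hold at every point of the box, so they may be
  substituted inside a second derivative.\<close>

lemma D_cong_right:
  assumes "P.VF (U \<times> W) A" "P.VF (U \<times> W) B" "P.VF (U \<times> W) C" "\<And>q. q \<in> U \<times> W \<Longrightarrow> B q = C q"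
  shows "P.D A B p = P.D A C p"
  by (rule P.D_local_right[OF assms(1-3) p assms(4)])

lemma riemann_lift111:
  assumes X: "M1.VF U X" and Y: "M1.VF U Y" and Z: "M1.VF U Z"
  shows "P.R (lift1 X) (lift1 Y) (lift1 Z) p = lift1 (M1.R X Y Z) p"
proof -
  note L = VF_lift1[OF _ W]
  have 1: "P.D (lift1 B) (P.D (lift1 A) (lift1 Z)) p = lift1 (M1.D B (M1.D A Z)) p" if "M1.VF U A" "M1.VF U B" for A B
  proof -
    have "P.D (lift1 B) (P.D (lift1 A) (lift1 Z)) p = P.D (lift1 B) (lift1 (M1.D A Z)) p"
      by (rule D_cong_right[OF L[OF that(2)] P.VF_D[OF L[OF that(1)] L[OF Z]] L[OF M1.VF_D[OF that(1) Z]]])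
        (rule D_lift11[OF U W _ that(1) Z])
    then show ?thesis unfolding D_lift11[OF U W p that(2) M1.VF_D[OF that(1) Z]] .
  qed
  have 2: "P.D (P.LB (lift1 X) (lift1 Y)) (lift1 Z) p = lift1 (M1.D (M1.LB X Y) Z) p"
  proof -
    have "P.D (P.LB (lift1 X) (lift1 Y)) (lift1 Z) p = P.D (lift1 (M1.LB X Y)) (lift1 Z) p"
      by (rule P.D_local_left[OF P.VF_lie_bracket[OF L[OF X] L[OF Y]] L[OF M1.VF_lie_bracket[OF X Y]] L[OF Z] p])
        (rule lie_bracket_lift11[OF U W _ X Y])
    then show ?thesis unfolding D_lift11[OF U W p M1.VF_lie_bracket[OF X Y] Z] .
  qed
  show ?thesis
    unfolding P.riemann_apply 1[OF X Y] 1[OF Y X] 2 lift1_apply M1.riemann_apply emb_simps ..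
qed

lemma riemann_lift211:
  assumes V: "M2.VF W V" and X: "M1.VF U X" and Y: "M1.VF U Y"
  shows "P.R (lift2 V) (lift1 X) (lift1 Y) p = hessf X Y (fst p) *\<^sub>t lift2 V p"
proof -
  note L1 = VF_lift1[OF _ W] and L2 = VF_lift2[OF U V]
  have 1: "P.D (lift1 X) (P.D (lift2 V) (lift1 Y)) p =
      (X (fst p) (dlog Y) + dlog Y (fst p) * dlog X (fst p)) *\<^sub>t lift2 V p"
  proof -
    have "P.D (lift1 X) (P.D (lift2 V) (lift1 Y)) p = P.D (lift1 X) ((\<lambda>q. dlog Y (fst q)) *\<^sub>v lift2 V) p"
      by (rule D_cong_right[OF L1[OF X] P.VF_D[OF L2 L1[OF Y]] VF_dlog_field[OF Y V]])
        (simp only: D_lift21[OF U W _ Y V] vscale_apply)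
    also have "\<dots> = X (fst p) (dlog Y) *\<^sub>t lift2 V p + dlog Y (fst p) *\<^sub>t dlog X (fst p) *\<^sub>t lift2 V p"
      unfolding D_dlog_field[OF L1[OF X] Y V] lift1_deriv_fst[OF X SF_dlog[OF Y]] D_lift12[OF U W p X V] ..
    finally show ?thesis by (simp add: fun_eq_iff algebra_simps)
  qed
  have 2: "P.D (lift2 V) (P.D (lift1 X) (lift1 Y)) p = dlog (M1.D X Y) (fst p) *\<^sub>t lift2 V p"
  proof -
    have "P.D (lift2 V) (P.D (lift1 X) (lift1 Y)) p = P.D (lift2 V) (lift1 (M1.D X Y)) p"
      by (rule D_cong_right[OF L2 P.VF_D[OF L1[OF X] L1[OF Y]] L1[OF M1.VF_D[OF X Y]]])
        (rule D_lift11[OF U W _ X Y])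
    then show ?thesis unfolding D_lift21[OF U W p M1.VF_D[OF X Y] V] .
  qed
  have 3: "P.D (P.LB (lift2 V) (lift1 X)) (lift1 Y) p = 0"
    by (rule P.D_zero_left[OF P.VF_lie_bracket[OF L2 L1[OF X]] L1[OF Y] p])
      (rule lie_bracket_lift21[OF U W _ X V])
  have 4: "X (fst p) (dlog Y) = (X (fst p) (\<lambda>s. Y s f) * f (fst p) - Y (fst p) f * X (fst p) f) / (f (fst p))\<^sup>2"
    by (rule M1.TS_divide[OF M1.VF_TS[OF X fst_snd_box(1)[OF U W p]] fst_snd_box(1)[OF U W p] SF_Xf[OF Y] SF_f[OF U] f_nz[OF M1.VF_points[OF X]]])
  \<comment> \<open>By the quotient rule \<open>4\<close>, the products of first derivatives in
    \<open>X (Y f / f) + (Y f / f) (X f / f)\<close> cancel and the second derivative divided by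
    \<open>f\<close> remains.\<close>
  have 5: "X (fst p) (dlog Y) + dlog Y (fst p) * dlog X (fst p) - dlog (M1.D X Y) (fst p) = hessf X Y (fst p)"
    unfolding 4 hessf_def using f_nz[OF fst_box_in_points[OF U W p]] by (simp add: field_simps power2_eq_square)
  show ?thesis
    unfolding P.riemann_apply 1 2 3 5[symmetric] by (simp add: fun_eq_iff algebra_simps)
qed

text \<open>The Gauss equation of the fibres. The terms along \<open>grad f\<close> cancel because
  the connection of \<open>g2\<close> is metric and without torsion; what remains of the second
  fundamental form is the multiple of \<open>M2.G\<close>.\<close>

lemma riemann_lift222:
  assumes V: "M2.VF W V" and T: "M2.VF W T" and S: "M2.VF W S"
  shows "P.R (lift2 V) (lift2 T) (lift2 S) p = lift2 (M2.R V T S) p - ngrad (fst p) *\<^sub>t lift2 (M2.G V T S) p"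
proof -
  note L2 = VF_lift2[OF U]
  note q2 = fst_snd_box(2)[OF U W p] and q2M = snd_box_in_points[OF U W p]
  have 1: "P.D (lift2 B) (P.D (lift2 A) (lift2 S)) p = lift2 (M2.D B (M2.D A S)) p -
      (f (fst p) * (g2 (snd p) (B (snd p)) (M2.D A S (snd p)) + B (snd p) (\<lambda>s. g2 s (A s) (S s)))) *\<^sub>t lift1 gf p -
      (g2 (snd p) (A (snd p)) (S (snd p)) * ngrad (fst p)) *\<^sub>t lift2 B p"
    if A: "M2.VF W A" and B: "M2.VF W B" for A B
  proof -
    have "P.D (lift2 B) (P.D (lift2 A) (lift2 S)) p = P.D (lift2 B) (lift2 (M2.D A S) - phi A S *\<^sub>v lift1 gf) p"
      by (rule D_cong_right[OF L2[OF B] P.VF_D[OF L2[OF A] L2[OF S]] VF_phi_field[OF M2.VF_D[OF A S] A S]])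
        (rule D_lift22_phi[OF _ A S])
    then show ?thesis
      unfolding D_lift2_phi_field[OF B A S M2.VF_D[OF A S]] lift2_deriv_phi[OF B A S]
      by (simp add: phi_def algebra_simps)
  qed
  have 2: "P.D (P.LB (lift2 V) (lift2 T)) (lift2 S) p = lift2 (M2.D (M2.LB V T) S) p -
      (f (fst p) * g2 (snd p) (M2.LB V T (snd p)) (S (snd p))) *\<^sub>t lift1 gf p"
  proof -
    have "P.D (P.LB (lift2 V) (lift2 T)) (lift2 S) p = P.D (lift2 (M2.LB V T)) (lift2 S) p"
      by (rule P.D_local_left[OF P.VF_lie_bracket[OF L2[OF V] L2[OF T]] L2[OF M2.VF_lie_bracket[OF V T]] L2[OF S] p])
        (rule lie_bracket_lift22[OF U W _ V T])
    then show ?thesis unfolding D_lift22[OF U W p M2.VF_lie_bracket[OF V T] S] .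
  qed
  have T2: "M2.D A B (snd p) \<in> M2.TS (snd p)" if "M2.VF W A" "M2.VF W B" for A B
    using M2.VF_TS[OF M2.VF_D[OF that] q2] .
  have 3: "g2 (snd p) (M2.LB V T (snd p)) (S (snd p)) =
      g2 (snd p) (M2.D V T (snd p)) (S (snd p)) - g2 (snd p) (M2.D T V (snd p)) (S (snd p))"
    unfolding M2.D_torsion[OF V T q2, symmetric]
    by (rule M2.g_diff_left[OF q2M T2[OF V T] T2[OF T V] M2.VF_TS[OF S q2]])
  have 4: "g2 (snd p) (M2.D A S (snd p)) (B (snd p)) = g2 (snd p) (B (snd p)) (M2.D A S (snd p))"
    if "M2.VF W A" "M2.VF W B" for A B
    by (rule M2.g_sym[OF q2M T2[OF that(1) S] M2.VF_TS[OF that(2) q2]])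
  show ?thesis
    unfolding P.riemann_apply 1[OF V T] 1[OF T V] 2 3 M2.D_metric[OF T V q2 S] M2.D_metric[OF V T q2 S]
    unfolding lift2_apply M2.riemann_apply M2.G_apply emb_simps
    by (simp add: fun_eq_iff algebra_simps)
qed

text \<open>Only the component along \<open>M2\<close> is wanted. This lemma and the next dispose of
  the curvature terms in which \<open>grad f\<close>, the normal part of a derivative of lifts from
  \<open>M2\<close>, takes the place of an argument.\<close>

lemma push2_riemann_lift122:
  assumes X: "M1.VF U X" and T: "M2.VF W T" and S: "M2.VF W S"
  shows "push2 p (P.R (lift1 X) (lift2 T) (lift2 S) p) = 0"
proof -
  note L1 = VF_lift1[OF X W] and L2 = VF_lift2[OF U]
  note q1 = fst_snd_box(1)[OF U W p] and q2 = fst_snd_box(2)[OF U W p]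
  have 1: "P.D (lift2 T) (P.D (lift1 X) (lift2 S)) p =
      dlog X (fst p) *\<^sub>t (lift2 (M2.D T S) p - phi T S p *\<^sub>t lift1 gf p)"
  proof -
    have "P.D (lift2 T) (P.D (lift1 X) (lift2 S)) p = P.D (lift2 T) ((\<lambda>q. dlog X (fst q)) *\<^sub>v lift2 S) p"
      by (rule D_cong_right[OF L2[OF T] P.VF_D[OF L1 L2[OF S]] VF_dlog_field[OF X S]])
        (simp only: D_lift12[OF U W _ X S] vscale_apply)
    also have "\<dots> = 0 *\<^sub>t lift2 S p + dlog X (fst p) *\<^sub>t (lift2 (M2.D T S) p - phi T S p *\<^sub>t lift1 gf p)"
      unfolding D_dlog_field[OF L2[OF T] X S] lift2_fst_apply[OF U W p T, of "dlog X"] D_lift22_phi[OF p T S]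
        vfield_diff_apply vscale_apply ..
    finally show ?thesis by (simp add: fun_eq_iff)
  qed
  have 2: "P.D (lift1 X) (P.D (lift2 T) (lift2 S)) p = dlog X (fst p) *\<^sub>t lift2 (M2.D T S) p -
    (lift1 X p (phi T S) *\<^sub>t lift1 gf p + phi T S p *\<^sub>t lift1 (M1.D X gf) p)"
  proof -
    have "P.D (lift1 X) (P.D (lift2 T) (lift2 S)) p = P.D (lift1 X) (lift2 (M2.D T S) - phi T S *\<^sub>v lift1 gf) p"
      by (rule D_cong_right[OF L1 P.VF_D[OF L2[OF T] L2[OF S]] VF_phi_field[OF M2.VF_D[OF T S] T S]])
        (rule D_lift22_phi[OF _ T S])
    then show ?thesis unfolding D_lift1_phi_field[OF X T S M2.VF_D[OF T S]] .
  qed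
  have 3: "P.D (P.LB (lift1 X) (lift2 T)) (lift2 S) p = 0"
    by (rule P.D_zero_left[OF P.VF_lie_bracket[OF L1 L2[OF T]] L2[OF S] p])
      (rule lie_bracket_lift12[OF U W _ X T])
  note pe = push2_emb1[OF box_points[OF U W p] M1.VF_TS[OF VF_gf[OF U] q1]]
    push2_emb1[OF box_points[OF U W p] M1.VF_TS[OF M1.VF_D[OF X VF_gf[OF U]] q1]]
    push2_emb2[OF box_points[OF U W p] M2.VF_TS[OF M2.VF_D[OF T S] q2]]
  show ?thesis
    unfolding P.riemann_apply 1 2 3 push_simps lift1_apply lift2_apply pe
    by (simp add: fun_eq_iff)
qed

lemma push2_riemann_lift221:
  assumes X: "M1.VF U X" and V: "M2.VF W V" and T: "M2.VF W T"
  shows "push2 p (P.R (lift2 V) (lift2 T) (lift1 X) p) = 0"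
proof -
  note L1 = VF_lift1[OF X W] and L2 = VF_lift2[OF U]
  have 1: "P.D (lift2 B) (P.D (lift2 A) (lift1 X)) p = dlog X (fst p) *\<^sub>t P.D (lift2 B) (lift2 A) p"
    if A: "M2.VF W A" and B: "M2.VF W B" for A B
  proof -
    have "P.D (lift2 B) (P.D (lift2 A) (lift1 X)) p = P.D (lift2 B) ((\<lambda>q. dlog X (fst q)) *\<^sub>v lift2 A) p"
      by (rule D_cong_right[OF L2[OF B] P.VF_D[OF L2[OF A] L1] VF_dlog_field[OF X A]])
        (simp only: D_lift21[OF U W _ X A] vscale_apply)
    also have "\<dots> = 0 *\<^sub>t lift2 A p + dlog X (fst p) *\<^sub>t P.D (lift2 B) (lift2 A) p"
      unfolding D_dlog_field[OF L2[OF B] X A] lift2_fst_apply[OF U W p B, of "dlog X"] ..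
    finally show ?thesis by (simp add: fun_eq_iff)
  qed
  have 2: "P.D (P.LB (lift2 V) (lift2 T)) (lift1 X) p = dlog X (fst p) *\<^sub>t P.LB (lift2 V) (lift2 T) p"
  proof -
    have "P.D (P.LB (lift2 V) (lift2 T)) (lift1 X) p = P.D (lift2 (M2.LB V T)) (lift1 X) p"
      by (rule P.D_local_left[OF P.VF_lie_bracket[OF L2[OF V] L2[OF T]] L2[OF M2.VF_lie_bracket[OF V T]] L1 p])
        (rule lie_bracket_lift22[OF U W _ V T])
    then show ?thesis
      unfolding D_lift21[OF U W p X M2.VF_lie_bracket[OF V T]] lie_bracket_lift22[OF U W p V T] .
  qed
  \<comment> \<open>The three terms add up to \<open>dlog X\<close> times the negative torsion of
    the two lifts, so the whole vector vanishes.\<close>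
  have "P.R (lift2 V) (lift2 T) (lift1 X) p = 0"
    unfolding P.riemann_apply 1[OF V T] 1[OF T V] 2 P.D_torsion[OF L2[OF V] L2[OF T] p, symmetric]
    by (simp add: fun_eq_iff algebra_simps)
  then show ?thesis by (simp only: push_simps)
qed

end

end

section \<open>Consequences of local symmetry of the warped product\<close>

lemma locally_symmetric_cov_deriv:
  assumes "locally_symmetric P gw" "P.VF U A" "P.VF U B" "P.VF U C" "P.VF U E" "p \<in> U"
  shows "P.D A (P.R B C E) p - P.R (P.D A B) C E p - P.R B (P.D A C) E p - P.R B C (P.D A E) p = 0"
  using assms unfolding locally_symmetric_def parallel_13_def P.cov_deriv_13_apply by blast

text \<open>Connection and curvature both commute with \<open>lift1\<close>, so the identity on the
  product is the lift of the one on \<open>M1\<close>, over any point \<open>s\<close> of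
  \<open>M2\<close>, and \<open>emb1\<close> is injective on tangent vectors.\<close>

lemma locally_symmetric_M1:
  assumes ls: "locally_symmetric P gw"
  shows "locally_symmetric M1 g1"
  unfolding locally_symmetric_def parallel_13_def
proof (intro allI impI ballI)
  fix U A X Y Z r assume a: "M1.VF U A \<and> M1.VF U X \<and> M1.VF U Y \<and> M1.VF U Z" and r: "r \<in> U"
  then have A: "M1.VF U A" and X: "M1.VF U X" and Y: "M1.VF U Y" and Z: "M1.VF U Z" by auto
  obtain s where s: "s \<in> points M2"
    using M2.smooth_manifold unfolding smooth_manifold_def by blast
  define W where "W = points M2"
  define p where "p = (r, s)"
  have W: "M2.OP W" unfolding W_def by blast
  note U = M1.VF_openin[OF A]
  have p: "p \<in> U \<times> W" using r s by (simp add: p_def W_def)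
  note L = VF_lift1[OF _ W]
  have 1: "P.D (lift1 A) (P.R (lift1 X) (lift1 Y) (lift1 Z)) p = lift1 (M1.D A (M1.R X Y Z)) p"
  proof -
    have "P.D (lift1 A) (P.R (lift1 X) (lift1 Y) (lift1 Z)) p = P.D (lift1 A) (lift1 (M1.R X Y Z)) p"
      by (rule D_cong_right[OF U W p L[OF A] P.VF_riemann[OF L[OF X] L[OF Y] L[OF Z]] L[OF M1.VF_riemann[OF X Y Z]]])
        (rule riemann_lift111[OF U W _ X Y Z])
    then show ?thesis unfolding D_lift11[OF U W p A M1.VF_riemann[OF X Y Z]] .
  qed
  note V = M1.VF_D[OF A X] M1.VF_D[OF A Y] M1.VF_D[OF A Z]
  have 2: "P.R (P.D (lift1 A) (lift1 X)) (lift1 Y) (lift1 Z) p = lift1 (M1.R (M1.D A X) Y Z) p"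
    unfolding riemann_lift111[OF U W p V(1) Y Z, symmetric]
    by (rule P.riemann_pointwise[OF P.VF_D[OF L[OF A] L[OF X]] L[OF Y] L[OF Z] L[OF V(1)] L[OF Y] L[OF Z] p
          D_lift11[OF U W p A X] refl refl])
  have 3: "P.R (lift1 X) (P.D (lift1 A) (lift1 Y)) (lift1 Z) p = lift1 (M1.R X (M1.D A Y) Z) p"
    unfolding riemann_lift111[OF U W p X V(2) Z, symmetric]
    by (rule P.riemann_pointwise[OF L[OF X] P.VF_D[OF L[OF A] L[OF Y]] L[OF Z] L[OF X] L[OF V(2)] L[OF Z] p
          refl D_lift11[OF U W p A Y] refl])
  have 4: "P.R (lift1 X) (lift1 Y) (P.D (lift1 A) (lift1 Z)) p = lift1 (M1.R X Y (M1.D A Z)) p"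
    unfolding riemann_lift111[OF U W p X Y V(3), symmetric]
    by (rule P.riemann_pointwise[OF L[OF X] L[OF Y] P.VF_D[OF L[OF A] L[OF Z]] L[OF X] L[OF Y] L[OF V(3)] p
          refl refl D_lift11[OF U W p A Z]])
  have VN: "M1.VF U (M1.D A (M1.R X Y Z) - M1.R (M1.D A X) Y Z - M1.R X (M1.D A Y) Z - M1.R X Y (M1.D A Z))"
    by (intro M1.VF_diff M1.VF_D M1.VF_riemann A X Y Z)
  have "emb1 p (M1.D A (M1.R X Y Z) r - M1.R (M1.D A X) Y Z r - M1.R X (M1.D A Y) Z r - M1.R X Y (M1.D A Z) r) = 0"
    using locally_symmetric_cov_deriv[OF ls L[OF A] L[OF X] L[OF Y] L[OF Z] p]
    unfolding 1 2 3 4 unfolding lift1_apply emb_simps by (simp add: p_def)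
  moreover have "M1.D A (M1.R X Y Z) r - M1.R (M1.D A X) Y Z r - M1.R X (M1.D A Y) Z r - M1.R X Y (M1.D A Z) r \<in> M1.TS r"
    using M1.VF_TS[OF VN r] unfolding vfield_diff_apply .
  ultimately show "cov_deriv_13 M1 g1 M1.R A X Y Z r = 0"
    using push1_emb1[OF box_points[OF U W p], of "M1.D A (M1.R X Y Z) r - M1.R (M1.D A X) Y Z r - M1.R X (M1.D A Y) Z r - M1.R X Y (M1.D A Z) r"]
    unfolding M1.cov_deriv_13_apply by (simp add: p_def push_simps)
qed

lemma parallel_hessian:
  assumes ls: "locally_symmetric P gw"
  shows "parallel_02 M1 g1 (\<lambda>Y Z p. (1 / f p) * hessian M1 g1 f Y Z p)"
  unfolding parallel_02_def
proof (intro allI impI ballI)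
  fix U A X Y r assume a: "M1.VF U A \<and> M1.VF U X \<and> M1.VF U Y" and r: "r \<in> U"
  then have A: "M1.VF U A" and X: "M1.VF U X" and Y: "M1.VF U Y" by auto
  note U = M1.VF_openin[OF A]
  obtain s where s: "s \<in> points M2"
    using M2.smooth_manifold unfolding smooth_manifold_def by blast
  then obtain W \<psi> where c: "(W, \<psi>) \<in> charts M2" "s \<in> W" using M2.chart_cover by blast
  \<comment> \<open>A coordinate field of \<open>M2\<close> serves as \<open>V\<close>, since
    \<open>V\<close> must not vanish at the point; its own coordinate function reads off the
    coefficient in the end.\<close>
  obtain b :: 'f where b: "b \<in> Basis" using nonempty_Basis by blast
  define V where "V = M2.CF (W, \<psi>) b"
  have V: "M2.VF W V" unfolding V_def by (rule M2.VF_coord_field[OF c(1)])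
  have W: "M2.OP W" by (rule M2.chart_openin[OF c(1)])
  define p where "p = (r, s)"
  have p: "p \<in> U \<times> W" using r c by (simp add: p_def)
  have fp: "fst p = r" "snd p = s" by (simp_all add: p_def)
  note L1 = VF_lift1[OF _ W] and L2 = VF_lift2[OF U V]
  note AX = M1.VF_D[OF A X] and AY = M1.VF_D[OF A Y]
  have sh: "P.SF (U \<times> W) (\<lambda>q. hessf X Y (fst q))" by (rule SF_fst[OF SF_hessf[OF X Y] W])
  have 1: "P.D (lift1 A) (P.R (lift2 V) (lift1 X) (lift1 Y)) p =
     A r (hessf X Y) *\<^sub>t lift2 V p + hessf X Y r *\<^sub>t (dlog A r *\<^sub>t lift2 V p)"
  proof -
    have "P.D (lift1 A) (P.R (lift2 V) (lift1 X) (lift1 Y)) p = P.D (lift1 A) ((\<lambda>q. hessf X Y (fst q)) *\<^sub>v lift2 V) p"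
      by (rule D_cong_right[OF U W p L1[OF A] P.VF_riemann[OF L2 L1[OF X] L1[OF Y]] P.VF_scale[OF sh L2]])
        (simp only: riemann_lift211[OF U W _ V X Y] vscale_apply)
    then show ?thesis
      unfolding P.D_scale_right[OF L1[OF A] L2 p sh] lift1_deriv_fst[OF U W p A SF_hessf[OF X Y]] D_lift12[OF U W p A V] fp .
  qed
  have 2: "P.R (P.D (lift1 A) (lift2 V)) (lift1 X) (lift1 Y) p = dlog A r *\<^sub>t (hessf X Y r *\<^sub>t lift2 V p)"
  proof -
    have "P.R (P.D (lift1 A) (lift2 V)) (lift1 X) (lift1 Y) p = P.R ((\<lambda>q. dlog A (fst q)) *\<^sub>v lift2 V) (lift1 X) (lift1 Y) p"
      by (rule P.riemann_pointwise[OF P.VF_D[OF L1[OF A] L2] L1[OF X] L1[OF Y] VF_dlog_field[OF U W A V] L1[OF X] L1[OF Y] p _ refl refl])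
        (simp only: D_lift12[OF U W p A V] vscale_apply)
    then show ?thesis
      unfolding P.riemann_scale_left[OF L2 L1[OF X] L1[OF Y] p SF_dlog_fst[OF A W]] riemann_lift211[OF U W p V X Y] fp .
  qed
  have 3: "P.R (lift2 V) (P.D (lift1 A) (lift1 X)) (lift1 Y) p = hessf (M1.D A X) Y r *\<^sub>t lift2 V p"
    unfolding riemann_lift211[OF U W p V AX Y, unfolded fp, symmetric]
    by (rule P.riemann_pointwise[OF L2 P.VF_D[OF L1[OF A] L1[OF X]] L1[OF Y] L2 L1[OF AX] L1[OF Y] p refl D_lift11[OF U W p A X] refl])
  have 4: "P.R (lift2 V) (lift1 X) (P.D (lift1 A) (lift1 Y)) p = hessf X (M1.D A Y) r *\<^sub>t lift2 V p"
    unfolding riemann_lift211[OF U W p V X AY, unfolded fp, symmetric]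
    by (rule P.riemann_pointwise[OF L2 L1[OF X] P.VF_D[OF L1[OF A] L1[OF Y]] L2 L1[OF X] L1[OF AY] p refl refl D_lift11[OF U W p A Y]])
  have "V s (coord_fun (W, \<psi>) b) = 1"
    unfolding V_def M2.coord_field_coord_fun[OF c b b] by simp
  then have v1: "lift2 V p (\<lambda>z. coord_fun (W, \<psi>) b (snd z)) = 1"
    using lift2_snd_apply[OF U W p V M2.smooth_at_coord_fun[OF c, of b, folded fp(2)]] fp by simp
  \<comment> \<open>The factor \<open>A f / f\<close> from differentiating the lift of
    \<open>V\<close> occurs in \<open>1\<close> and in \<open>2\<close> and cancels, so only the
    covariant derivative of \<open>hessf\<close> is left.\<close>
  from fun_cong[OF locally_symmetric_cov_deriv[OF ls L1[OF A] L2 L1[OF X] L1[OF Y] p], of "\<lambda>z. coord_fun (W, \<psi>) b (snd z)"]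
  have e: "A r (hessf X Y) - hessf (M1.D A X) Y r - hessf X (M1.D A Y) r = 0"
    unfolding 1 2 3 4 by (simp add: v1)
  have "A r (\<lambda>q. (1 / f q) * hessian M1 g1 f X Y q) = A r (hessf X Y)"
    by (rule M1.TS_local[OF M1.VF_TS[OF A r] U r]) (rule hessf_eq_hessian[OF X Y])
  then show "cov_deriv_02 M1 g1 (\<lambda>Y Z p. (1 / f p) * hessian M1 g1 f Y Z p) A X Y r = 0"
    unfolding cov_deriv_02_def Let_def hessf_eq_hessian[OF AX Y r] hessf_eq_hessian[OF X AY r]
    using e by simp
qed

text \<open>Derivatives of lifts from \<open>M2\<close> have a part along \<open>grad f\<close>, but
  neither this part nor the curvature terms it creates have a component along \<open>M2\<close>.
  Lifts from \<open>M2\<close> do not differentiate the squared length of \<open>grad f\<close>, and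
  \<open>G\<close> is parallel on \<open>M2\<close>; so the projection leaves the covariant
  derivative of the curvature of \<open>M2\<close>.\<close>

lemma locally_symmetric_M2:
  assumes ls: "locally_symmetric P gw"
  shows "locally_symmetric M2 g2"
  unfolding locally_symmetric_def parallel_13_def
proof (intro allI impI ballI)
  fix W A V T S s assume a: "M2.VF W A \<and> M2.VF W V \<and> M2.VF W T \<and> M2.VF W S" and s: "s \<in> W"
  then have A: "M2.VF W A" and V: "M2.VF W V" and T: "M2.VF W T" and S: "M2.VF W S" by auto
  obtain r where r: "r \<in> points M1"
    using M1.smooth_manifold unfolding smooth_manifold_def by blast
  define U where "U = points M1"
  define p where "p = (r, s)"
  have U: "M1.OP U" unfolding U_def by blast
  note W = M2.VF_openin[OF A]
  have p: "p \<in> U \<times> W" using r s by (simp add: p_def U_def)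
  have fp: "fst p = r" "snd p = s" by (simp_all add: p_def)
  note pM = box_points[OF U W p]
  note L = VF_lift2[OF U] and G = VF_gf[OF U]
  note LG = VF_lift1[OF G W]
  let ?n = "ngrad r"
  have sn: "P.SF (U \<times> W) (\<lambda>q. ngrad (fst q))" by (rule SF_fst[OF SF_ngrad[OF U] W])
  have pl: "push2 p (lift2 X p) = X s" if "M2.VF W X" for X
    using push2_emb2[OF pM, unfolded fp, OF M2.VF_TS[OF that s]] unfolding lift2_apply fp .
  have pg: "push2 p (lift1 gf p) = 0"
    unfolding lift1_apply by (rule push2_emb1[OF pM M1.VF_TS[OF G fst_snd_box(1)[OF U W p]]])
  have pD: "push2 p (P.D (lift2 X) (lift2 Y) p) = M2.D X Y s" if "M2.VF W X" "M2.VF W Y" for X Y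
    unfolding D_lift22[OF U W p that] push_simps pg pl[OF M2.VF_D[OF that]] by (simp add: fun_eq_iff)
  note VR = M2.VF_riemann[OF V T S] and VG = M2.VF_G[OF V T S]
  have 1: "push2 p (P.D (lift2 A) (P.R (lift2 V) (lift2 T) (lift2 S)) p) =
      M2.D A (M2.R V T S) s - ?n *\<^sub>t M2.D A (M2.G V T S) s"
  proof -
    have "P.D (lift2 A) (P.R (lift2 V) (lift2 T) (lift2 S)) p =
        P.D (lift2 A) (lift2 (M2.R V T S) - (\<lambda>q. ngrad (fst q)) *\<^sub>v lift2 (M2.G V T S)) p"
      by (rule D_cong_right[OF U W p L[OF A] P.VF_riemann[OF L[OF V] L[OF T] L[OF S]]
            P.VF_diff[OF L[OF VR] P.VF_scale[OF sn L[OF VG]]]])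
        (simp only: riemann_lift222[OF U W _ V T S] vfield_diff_apply vscale_apply)
    also have "\<dots> = P.D (lift2 A) (lift2 (M2.R V T S)) p -
        (0 *\<^sub>t lift2 (M2.G V T S) p + ?n *\<^sub>t P.D (lift2 A) (lift2 (M2.G V T S)) p)"
      unfolding P.D_diff_right[OF L[OF A] L[OF VR] p P.VF_scale[OF sn L[OF VG]]] P.D_scale_right[OF L[OF A] L[OF VG] p sn]
        lift2_fst_apply[OF U W p A, of ngrad] fp ..
    finally have e: "P.D (lift2 A) (P.R (lift2 V) (lift2 T) (lift2 S)) p = P.D (lift2 A) (lift2 (M2.R V T S)) p -
        (0 *\<^sub>t lift2 (M2.G V T S) p + ?n *\<^sub>t P.D (lift2 A) (lift2 (M2.G V T S)) p)" .
    show ?thesis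
      unfolding e push_simps pD[OF A VR] pD[OF A VG] by (simp add: fun_eq_iff)
  qed
  have eD: "P.D (lift2 A) (lift2 X) p = (lift2 (M2.D A X) - phi A X *\<^sub>v lift1 gf) p" if "M2.VF W X" for X
    by (rule D_lift22_phi[OF U W p A that])
  have pR: "push2 p (P.R (lift2 X) (lift2 Y) (lift2 Z) p) = M2.R X Y Z s - ?n *\<^sub>t M2.G X Y Z s"
    if "M2.VF W X" "M2.VF W Y" "M2.VF W Z" for X Y Z
    unfolding riemann_lift222[OF U W p that] push_simps pl[OF M2.VF_riemann[OF that]] pl[OF M2.VF_G[OF that]] fp ..
  have left: "push2 p (P.R (P.D (lift2 A) (lift2 X)) (lift2 Y) (lift2 Z) p) =
      M2.R (M2.D A X) Y Z s - ?n *\<^sub>t M2.G (M2.D A X) Y Z s"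
    if X: "M2.VF W X" and Y: "M2.VF W Y" and Z: "M2.VF W Z" for X Y Z
  proof -
    note AX = M2.VF_D[OF A X] and SP = SF_phi[OF U A X]
    have "P.R (P.D (lift2 A) (lift2 X)) (lift2 Y) (lift2 Z) p =
        P.R (lift2 (M2.D A X) - phi A X *\<^sub>v lift1 gf) (lift2 Y) (lift2 Z) p"
      by (rule P.riemann_pointwise[OF P.VF_D[OF L[OF A] L[OF X]] L[OF Y] L[OF Z]
            VF_phi_field[OF U W AX A X] L[OF Y] L[OF Z] p eD[OF X] refl refl])
    also have "\<dots> = P.R (lift2 (M2.D A X)) (lift2 Y) (lift2 Z) p - phi A X p *\<^sub>t P.R (lift1 gf) (lift2 Y) (lift2 Z) p"
      unfolding P.riemann_diff_left[OF L[OF AX] P.VF_scale[OF SP LG] L[OF Y] L[OF Z] p]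
        P.riemann_scale_left[OF LG L[OF Y] L[OF Z] p SP] ..
    finally have e: "P.R (P.D (lift2 A) (lift2 X)) (lift2 Y) (lift2 Z) p =
        P.R (lift2 (M2.D A X)) (lift2 Y) (lift2 Z) p - phi A X p *\<^sub>t P.R (lift1 gf) (lift2 Y) (lift2 Z) p" .
    show ?thesis
      unfolding e push_simps pR[OF AX Y Z] push2_riemann_lift122[OF U W p G Y Z] by (simp add: fun_eq_iff)
  qed
  have 2: "push2 p (P.R (P.D (lift2 A) (lift2 V)) (lift2 T) (lift2 S) p) =
      M2.R (M2.D A V) T S s - ?n *\<^sub>t M2.G (M2.D A V) T S s"
    by (rule left[OF V T S])
  have 3: "push2 p (P.R (lift2 V) (P.D (lift2 A) (lift2 T)) (lift2 S) p) =
      M2.R V (M2.D A T) S s - ?n *\<^sub>t M2.G V (M2.D A T) S s"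
  proof -
    have neg: "push2 p (- u) = - push2 p u" for u
      by (auto simp: push2_def pushforward_def fun_eq_iff)
    show ?thesis
      unfolding P.riemann_anti[OF L[OF V] P.VF_D[OF L[OF A] L[OF T]] L[OF S] p] neg left[OF T V S]
        M2.riemann_anti[OF M2.VF_D[OF A T] V S s] M2.G_apply
      by (simp add: fun_eq_iff algebra_simps)
  qed
  have 4: "push2 p (P.R (lift2 V) (lift2 T) (P.D (lift2 A) (lift2 S)) p) =
      M2.R V T (M2.D A S) s - ?n *\<^sub>t M2.G V T (M2.D A S) s"
  proof -
    note AS = M2.VF_D[OF A S] and SP = SF_phi[OF U A S]
    have "P.R (lift2 V) (lift2 T) (P.D (lift2 A) (lift2 S)) p =
        P.R (lift2 V) (lift2 T) (lift2 (M2.D A S) - phi A S *\<^sub>v lift1 gf) p"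
      by (rule P.riemann_pointwise[OF L[OF V] L[OF T] P.VF_D[OF L[OF A] L[OF S]] L[OF V] L[OF T]
            VF_phi_field[OF U W AS A S] p refl refl eD[OF S]])
    also have "\<dots> = P.R (lift2 V) (lift2 T) (lift2 (M2.D A S)) p - phi A S p *\<^sub>t P.R (lift2 V) (lift2 T) (lift1 gf) p"
      unfolding P.riemann_diff_right[OF L[OF V] L[OF T] L[OF AS] P.VF_scale[OF SP LG] p]
        P.riemann_scale_right[OF L[OF V] L[OF T] LG p SP] ..
    finally have e: "P.R (lift2 V) (lift2 T) (P.D (lift2 A) (lift2 S)) p =
        P.R (lift2 V) (lift2 T) (lift2 (M2.D A S)) p - phi A S p *\<^sub>t P.R (lift2 V) (lift2 T) (lift1 gf) p" .
    show ?thesis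
      unfolding e push_simps pR[OF V T AS] push2_riemann_lift221[OF U W p G V T] by (simp add: fun_eq_iff)
  qed
  from arg_cong[OF locally_symmetric_cov_deriv[OF ls L[OF A] L[OF V] L[OF T] L[OF S] p], of "push2 p"]
  have "cov_deriv_13 M2 g2 M2.R A V T S s - ?n *\<^sub>t cov_deriv_13 M2 g2 M2.G A V T S s = 0"
    unfolding push_simps 1 2 3 4 M2.cov_deriv_13_apply by (simp add: fun_eq_iff algebra_simps)
  then show "cov_deriv_13 M2 g2 M2.R A V T S s = 0"
    unfolding M2.cov_deriv_G[OF A V T S s] by (simp add: fun_eq_iff)
qed

text \<open>At a point of \<open>M1\<close> where \<open>X f\<close> does not vanish, \<open>(\<nabla>\<^sub>X R)(V, T)S = 0\<close> determines the curvature
  tensor of \<open>M2\<close>.\<close>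

lemma riemann_M2_eq:
  assumes ls: "locally_symmetric P gw" and X: "M1.VF U X" and r: "r \<in> U" and Xf: "X r f \<noteq> 0"
    and V: "M2.VF W V" and T: "M2.VF W T" and S: "M2.VF W S" and s: "s \<in> W"
  shows "M2.R V T S s = (ngrad r - X r ngrad * f r / (2 * X r f)) *\<^sub>t M2.G V T S s"
proof -
  define p where "p = (r, s)"
  note U = M1.VF_openin[OF X] and W = M2.VF_openin[OF V]
  have p: "p \<in> U \<times> W" using r s by (simp add: p_def)
  have fp: "fst p = r" "snd p = s" by (simp_all add: p_def)
  note pM = box_points[OF U W p]
  note L = VF_lift2[OF U] and LX = VF_lift1[OF X W]
  have sn: "P.SF (U \<times> W) (\<lambda>q. ngrad (fst q))" by (rule SF_fst[OF SF_ngrad[OF U] W])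
  note sd = SF_dlog_fst[OF X W]
  note VR = M2.VF_riemann[OF V T S] and VG = M2.VF_G[OF V T S]
  let ?R = "P.R (lift2 V) (lift2 T) (lift2 S) p" and ?r = "lift2 (M2.R V T S) p" and ?g = "lift2 (M2.G V T S) p"
  have R: "?R = ?r - ngrad r *\<^sub>t ?g"
    unfolding riemann_lift222[OF U W p V T S] fp ..
  have 1: "P.D (lift1 X) (P.R (lift2 V) (lift2 T) (lift2 S)) p =
      dlog X r *\<^sub>t ?r - (X r ngrad *\<^sub>t ?g + ngrad r *\<^sub>t (dlog X r *\<^sub>t ?g))"
  proof -
    have "P.D (lift1 X) (P.R (lift2 V) (lift2 T) (lift2 S)) p =
        P.D (lift1 X) (lift2 (M2.R V T S) - (\<lambda>q. ngrad (fst q)) *\<^sub>v lift2 (M2.G V T S)) p"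
      by (rule D_cong_right[OF U W p LX P.VF_riemann[OF L[OF V] L[OF T] L[OF S]]
            P.VF_diff[OF L[OF VR] P.VF_scale[OF sn L[OF VG]]]])
        (simp only: riemann_lift222[OF U W _ V T S] vfield_diff_apply vscale_apply)
    then show ?thesis
      unfolding P.D_diff_right[OF LX L[OF VR] p P.VF_scale[OF sn L[OF VG]]] P.D_scale_right[OF LX L[OF VG] p sn]
        lift1_deriv_fst[OF U W p X SF_ngrad[OF U]] D_lift12[OF U W p X VR] D_lift12[OF U W p X VG] fp .
  qed
  have eD: "P.D (lift1 X) (lift2 Y) p = ((\<lambda>q. dlog X (fst q)) *\<^sub>v lift2 Y) p" if "M2.VF W Y" for Y
    unfolding D_lift12[OF U W p X that] vscale_apply ..
  note Vd = VF_dlog_field[OF U W X]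
  have 2: "P.R (P.D (lift1 X) (lift2 V)) (lift2 T) (lift2 S) p = dlog X r *\<^sub>t ?R"
    unfolding P.riemann_scale_left[OF L[OF V] L[OF T] L[OF S] p sd, unfolded fp, symmetric]
    by (rule P.riemann_pointwise[OF P.VF_D[OF LX L[OF V]] L[OF T] L[OF S] Vd[OF V] L[OF T] L[OF S] p eD[OF V] refl refl])
  have 3: "P.R (lift2 V) (P.D (lift1 X) (lift2 T)) (lift2 S) p = dlog X r *\<^sub>t ?R"
    unfolding P.riemann_scale_middle[OF L[OF V] L[OF T] L[OF S] p sd, unfolded fp, symmetric]
    by (rule P.riemann_pointwise[OF L[OF V] P.VF_D[OF LX L[OF T]] L[OF S] L[OF V] Vd[OF T] L[OF S] p refl eD[OF T] refl])
  have 4: "P.R (lift2 V) (lift2 T) (P.D (lift1 X) (lift2 S)) p = dlog X r *\<^sub>t ?R"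
    unfolding P.riemann_scale_right[OF L[OF V] L[OF T] L[OF S] p sd, unfolded fp, symmetric]
    by (rule P.riemann_pointwise[OF L[OF V] L[OF T] P.VF_D[OF LX L[OF S]] L[OF V] L[OF T] Vd[OF S] p refl refl eD[OF S]])
  have pl: "push2 p (lift2 Y p) = Y s" if "M2.VF W Y" for Y
    using push2_emb2[OF pM, unfolded fp, OF M2.VF_TS[OF that s]] unfolding lift2_apply fp .
  have fr: "f r \<noteq> 0" using f_nz[OF M1.VF_points[OF X r]] .
  from arg_cong[OF locally_symmetric_cov_deriv[OF ls LX L[OF V] L[OF T] L[OF S] p], of "push2 p"]
  have e: "dlog X r *\<^sub>t M2.R V T S s - (X r ngrad *\<^sub>t M2.G V T S s + ngrad r *\<^sub>t (dlog X r *\<^sub>t M2.G V T S s)) -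
      dlog X r *\<^sub>t (M2.R V T S s - ngrad r *\<^sub>t M2.G V T S s) - dlog X r *\<^sub>t (M2.R V T S s - ngrad r *\<^sub>t M2.G V T S s) -
      dlog X r *\<^sub>t (M2.R V T S s - ngrad r *\<^sub>t M2.G V T S s) = 0"
    unfolding 1 2 3 4 R push_simps pl[OF VR] pl[OF VG] .
  show ?thesis
  proof
    fix h
    from fun_cong[OF e, of h]
    \<comment> \<open>Differentiating the value contributes \<open>dlog X\<close> once and the three
      arguments subtract it three times, \<open>- 2\<close> in total; the equation is stated with
      the sign reversed.\<close>
    have "2 * dlog X r * (M2.R V T S s h - ngrad r * M2.G V T S s h) + X r ngrad * M2.G V T S s h = 0"
      by (simp add: algebra_simps)
    then show "M2.R V T S s h = ((ngrad r - X r ngrad * f r / (2 * X r f)) *\<^sub>t M2.G V T S s) h"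
      using Xf fr by (simp add: field_simps)
  qed
qed

text \<open>The factor in \<open>riemann_M2_eq\<close> is computed at the one point \<open>r\<close>
  of \<open>M1\<close>, hence it is the same at all points of \<open>M2\<close>; and pairing
  \<open>G(V, T)V\<close> with \<open>T\<close> gives exactly \<open>plane_area\<close>.\<close>

lemma constant_curvature_M2:
  assumes ls: "locally_symmetric P gw" and X: "M1.VF U X" and r: "r \<in> U" and Xf: "X r f \<noteq> 0"
  shows "constant_curvature M2 g2"
  unfolding constant_curvature_def
proof (intro exI allI impI ballI)
  fix W V T s assume a: "M2.VF W V \<and> M2.VF W T" and s: "s \<in> W" and area: "plane_area g2 V T s \<noteq> 0"
  then have V: "M2.VF W V" and T: "M2.VF W T" by auto
  note sM = M2.VF_points[OF V s] and TV = M2.VF_TS[OF V s] and TT = M2.VF_TS[OF T s]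
  let ?k = "ngrad r - X r ngrad * f r / (2 * X r f)"
  have "g2 s (M2.G V T V s) (T s) = g2 s (g2 s (V s) (V s) *\<^sub>t T s) (T s) - g2 s (g2 s (T s) (V s) *\<^sub>t V s) (T s)"
    unfolding M2.G_apply by (rule M2.g_diff_left[OF sM M2.TS_scale_closed[OF TT] M2.TS_scale_closed[OF TV] TT])
  also have "\<dots> = plane_area g2 V T s"
    unfolding M2.g_scale_left[OF sM TT TT] M2.g_scale_left[OF sM TV TT] plane_area_def M2.g_sym[OF sM TT TV]
    by (simp add: power2_eq_square)
  finally have "g2 s (M2.R V T V s) (T s) = ?k * plane_area g2 V T s"
    unfolding riemann_M2_eq[OF ls X r Xf V T V s] M2.g_scale_left[OF sM M2.VF_TS[OF M2.VF_G[OF V T V] s] TT] by simp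
  then show "sectional_curvature M2 g2 V T s = ?k"
    using area by (simp add: sectional_curvature_def)
qed

end

section \<open>Functions with vanishing differential\<close>

context smanifold
begin

text \<open>In a ball of a chart the derivative is zero, so \<open>f\<close> is locally constant; a
  level set and its complement are then both open, and connectedness makes the complement
  empty.\<close>

lemma constant_on_if_derivatives_zero:
  assumes conn: "connected_space (mtop M)" and f: "SF (points M) f"
    and zero: "\<And>p v. p \<in> points M \<Longrightarrow> v \<in> TS p \<Longrightarrow> v f = 0"
  shows "f constant_on points M"
proof -
  have loc: "\<exists>W. OP W \<and> p \<in> W \<and> (\<forall>q\<in>W. f q = f p)" if p: "p \<in> points M" for p
  proof -
    obtain V \<phi> where c: "(V, \<phi>) \<in> charts M" "p \<in> V" using chart_cover[OF p] by blast
    note o = chart_open_image[OF c(1) chart_openin[OF c(1)] order_refl]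
    obtain e where e: "e > 0" "ball (\<phi> p) e \<subseteq> \<phi> ` V" using o c(2) open_contains_ball by blast
    let ?F = "\<lambda>x. f (inv_into V \<phi> x)"
    have "(?F has_derivative (\<lambda>h. 0)) (at x within ball (\<phi> p) e)" if x: "x \<in> ball (\<phi> p) e" for x
    proof -
      obtain q where q: "q \<in> V" "x = \<phi> q" using e x by blast
      have qM: "q \<in> points M" using openin_subset[OF chart_openin[OF c(1)]] q(1) by blast
      have "(?F has_derivative (\<lambda>b. CF (V, \<phi>) b q f)) (at x)"
        using smooth_at_chart_derivative[OF smooth_atI[OF qM f] c(1) q(1)] q(2) by simp
      moreover have "CF (V, \<phi>) b q f = 0" for b
        by (rule zero[OF qM coord_field_TS[OF c(1) q(1)]])
      ultimately show ?thesis by (simp add: has_derivative_at_withinI)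
    qed
    then obtain k where k: "\<And>x. x \<in> ball (\<phi> p) e \<Longrightarrow> ?F x = k"
      using has_derivative_zero_constant[OF convex_ball, of "\<phi> p" e ?F] by blast
    have "f q = k" if "q \<in> V" "\<phi> q \<in> ball (\<phi> p) e" for q
      using k[OF that(2)] chart_inv[OF c(1) that(1)] by simp
    then have "\<forall>q\<in>{q\<in>V. \<phi> q \<in> ball (\<phi> p) e}. f q = f p"
      using c(2) e(1) by simp
    moreover have "p \<in> {q\<in>V. \<phi> q \<in> ball (\<phi> p) e}" using c(2) e(1) by simp
    ultimately show ?thesis using chart_open_vimage[OF c(1) open_ball] by blast
  qed
  have op: "OP {q \<in> points M. Q (f q)}" for Q
  proof (subst openin_subopen, intro ballI)
    fix p assume "p \<in> {q \<in> points M. Q (f q)}"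
    then have p: "p \<in> points M" "Q (f p)" by auto
    obtain W where W: "OP W" "p \<in> W" "\<forall>q\<in>W. f q = f p" using loc[OF p(1)] by blast
    have "W \<subseteq> {q \<in> points M. Q (f q)}"
    proof
      fix q assume q: "q \<in> W"
      then have "f q = f p" using W(3) by blast
      then show "q \<in> {q \<in> points M. Q (f q)}" using q p(2) openin_subset[OF W(1)] by auto
    qed
    then show "\<exists>T. OP T \<and> p \<in> T \<and> T \<subseteq> {q \<in> points M. Q (f q)}"
      using W(1,2) by blast
  qed
  show ?thesis
  proof (cases "points M = {}")
    case True
    then show ?thesis by (simp add: constant_on_def)
  next
    case False
    then obtain p where p: "p \<in> points M" by blast
    let ?A = "{q \<in> points M. f q = f p}" and ?B = "{q \<in> points M. f q \<noteq> f p}"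
    have "?B = {}"
    proof (rule ccontr)
      assume "?B \<noteq> {}"
      moreover have "?A \<noteq> {}" "points M \<subseteq> ?A \<union> ?B" "?A \<inter> ?B = {}" using p by auto
      ultimately show False
        using conn op[of "\<lambda>x. x = f p"] op[of "\<lambda>x. x \<noteq> f p"] unfolding connected_space_def by blast
    qed
    then show ?thesis unfolding constant_on_def by blast
  qed
qed

end

theorem theorem5:
  fixes M1 :: "('a, 'e::euclidean_space) manifold" and M2 :: "('b, 'f::euclidean_space) manifold"
    and g1 :: "'a metric_tensor" and g2 :: "'b metric_tensor"
    and f :: "'a \<Rightarrow> real"
  assumes "pseudo_riemannian_manifold M1 g1"
    and "pseudo_riemannian_manifold M2 g2"
    and "smooth_fun M1 (points M1) f"
    and "\<And>p. p \<in> points M1 \<Longrightarrow> 0 < f p"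
    and "DIM('e \<times> 'f) \<ge> 3"
    and "concircularly_symmetric (prod_manifold M1 M2) (warped_metric M1 g1 M2 g2 f)"
  shows "locally_symmetric M1 g1 \<and> locally_symmetric M2 g2 \<and>
    (connected_space (mtop M1) \<and> \<not> f constant_on points M1 \<longrightarrow> constant_curvature M2 g2) \<and>
    parallel_02 M1 g1 (\<lambda>Y Z p. (1 / f p) * hessian M1 g1 f Y Z p)"
proof -
  interpret warped M1 g1 M2 g2 f
    by standard (use assms(1-4) in \<open>auto simp: pseudo_riemannian_manifold_def\<close>)
  have ls: "locally_symmetric P gw"
    by (rule P.concircularly_symmetric_imp_locally_symmetric[OF assms(6,5)])
  \<comment> \<open>Connectedness turns a nonconstant \<open>f\<close> into a point and a direction
    with nonzero derivative, the number by which \<open>riemann_M2_eq\<close> divides.\<close>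
  have "constant_curvature M2 g2" if conn: "connected_space (mtop M1)" and nc: "\<not> f constant_on points M1"
  proof -
    obtain r v where r: "r \<in> points M1" "v \<in> M1.TS r" "v f \<noteq> 0"
      using M1.constant_on_if_derivatives_zero[OF conn f_smooth] nc by blast
    have "M1.OP (points M1)" by blast
    then obtain U X where "M1.VF U X" "r \<in> U" "X r = v"
      using M1.VF_extend[OF r(2,1)] by blast
    then show ?thesis using constant_curvature_M2[OF ls, of U X r] r(3) by simp
  qed
  then show ?thesis
    using locally_symmetric_M1[OF ls] locally_symmetric_M2[OF ls] parallel_hessian[OF ls] by blast
qed

end
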